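(* Let $(X^i_t)_{t\ge 0}$, $i\in\{1,\dots,n\}$, be Feller processes on $E_i$ with generators $(\mathcal{L}_i,\mathcal{D}(\mathcal{L}_i))$ such that $C_c^\infty(E_i)$ is a core for $\mathcal{L}_i$, let $\bar E=E_1\times\dots\times E_n$, and let $\mathcal{G}$ be the associated set of coupling operators. For any $\Gamma\in\mathcal{G}$, the Feller process generated by $$\bar{\mathcal{L}}_\Gamma=\sum_{i=1}^n\mathcal{L}_i+\Gamma$$ is a coupling of the processes $\big((X^i_t)_{t\ge0},\ i\in\{1,\dots,n\}\big)$. Conversely, if $(\bar X_t)_{t\ge 0}$ is a Feller coupling of the processes $\big((X^i_t)_{t\ge0},\ i\in\{1,\dots,n\}\big)$, then its generator is of the form $\sum_{i=1}^n\mathcal{L}_i+\Gamma$ with $\Gamma\in\mathcal{G}$.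
   Context: All state spaces are locally compact Polish spaces equipped with a differentiable structure, so that $C_c^\infty$ (smooth compactly supported functions) makes sense. $\mathcal{B}_b$, $C_b$, $C_0$ denote bounded Borel functions, bounded continuous functions, and continuous functions vanishing at infinity, with the supremum norm. A Markov process $(X_t)_{t\ge0}$ on $E$ with semigroup $(S_tf)(x)=\mathbb{E}[f(X_t)\mid X_0=x]$ is Feller if $S_t$ maps $C_0(E)$ into itself and $\|S_tf-f\|_\infty\to0$ as $t\to0$ for all $f\in C_0(E)$; its generator is $(\mathcal{L},\mathcal{D}(\mathcal{L}))$. All Feller processes considered (including those on product spaces) are assumed rich: $C_c^\infty(E)\subset\mathcal{D}(\mathcal{L})$. The generator is also extended (same notation) to $\{f\in C_b(E):\lim_{t\to0}(S_tf-f)/t\text{ exists uniformly on compact sets}\}$ by $\mathcal{L}f=\lim_{t\to0}(S_tf-f)/t$. A function on $E_i$ is regarded as a function on $\bar E$ depending only on the coordinate $x_i$; $\mathcal{L}_i$ acts on the $i$-th variable of functions on $\bar E$, and $\sum_i\mathcal{L}_i$ is defined on the (topological) tensor product of the domains $\mathcal{D}(\mathcal{L}_i)$. Feller coupling: a Feller process $(\bar X_t)_{t\ge0}$ on $\bar E$ with coordinate processes $(\bar X^i_t)_{t\ge0}$ is a Feller coupling of the $(X^i_t)_{t\ge0}$ if for every $i$ the processes $(\bar X^i_t)_{t\ge0}$ and $(X^i_t)_{t\ge0}$ induce the same law on the càdlàg space $D([0,\infty),E_i)$. Coupling operators: $\mathcal{G}$ is the set of (possibly unbounded) linear operators $(\Gamma,\mathcal{D}(\Gamma))$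 on $\mathcal{B}_b(\bar E)$ such that (1) for all $i$ and all $f\in C_c^\infty(E_i)$, $f\in\mathcal{D}(\Gamma)$ and $\Gamma f=0$; (2) the operator $\bar{\mathcal{L}}_\Gamma=\sum_{i=1}^n\mathcal{L}_i+\Gamma$ with domain $\bigotimes_{i=1}^n\mathcal{D}(\mathcal{L}_i)\cap\mathcal{D}(\Gamma)$ is closable and its closure is the generator of a Feller process on $\bar E$. No notational distinction is made between $\bar{\mathcal{L}}_\Gamma$ and its closure.
   Formalization: In the converse, Γ ∈ G is claimed only if the functions in the tensor product of the D(L_i) and in the coupling generator's domain, with bounded Borel difference, form a core for that generator; this is necessary, and it fails for some Feller couplings of Brownian motions. *)

theory Defs
  imports "HOL-Probability.Probability"
begin

(* State spaces are abstract topologies, so that the E_i may be different spaces carried by one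
   ambient type; the product is product_topology E UNIV over a finite index type.  A real function
   on a space T is represented by its extension by 0 to the ambient type. *)

definition borel_of :: "'a topology \<Rightarrow> 'a measure" where
  "borel_of T = sigma (topspace T) {U. openin T U}"

definition vanishes_off :: "'a topology \<Rightarrow> ('a \<Rightarrow> real) \<Rightarrow> bool" where
  "vanishes_off T f \<longleftrightarrow> (\<forall>x. x \<notin> topspace T \<longrightarrow> f x = 0)"

definition B_b :: "'a topology \<Rightarrow> ('a \<Rightarrow> real) set" where
  "B_b T = {f. vanishes_off T f \<and> f \<in> borel_measurable (borel_of T) \<and> bounded (range f)}"

definition C_b :: "'a topology \<Rightarrow> ('a \<Rightarrow> real) set" where
  "C_b T = {f. vanishes_off T f \<and> continuous_map T euclideanreal f \<and> bounded (range f)}"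

definition C_0 :: "'a topology \<Rightarrow> ('a \<Rightarrow> real) set" where
  "C_0 T = {f. vanishes_off T f \<and> continuous_map T euclideanreal f \<and>
     (\<forall>e>0. \<exists>K. compactin T K \<and> (\<forall>x \<in> topspace T - K. \<bar>f x\<bar> < e))}"

primrec Ck_on :: "nat \<Rightarrow> 'b::euclidean_space set \<Rightarrow> ('b \<Rightarrow> 'c::real_normed_vector) \<Rightarrow> bool" where
  "Ck_on 0 S f \<longleftrightarrow> continuous_on S f"
| "Ck_on (Suc k) S f \<longleftrightarrow>
     (\<exists>f'. (\<forall>x\<in>S. (f has_derivative f' x) (at x)) \<and> (\<forall>v. Ck_on k S (\<lambda>x. f' x v)))"

(* Smoothness on an arbitrary subset A of a Euclidean space: locally the restriction of a
   C^infinity function defined on an open set. *)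
definition smooth_on :: "'b::euclidean_space set \<Rightarrow> ('b \<Rightarrow> 'c::real_normed_vector) \<Rightarrow> bool" where
  "smooth_on A f \<longleftrightarrow> (\<forall>x\<in>A. \<exists>U g. open U \<and> x \<in> U \<and> (\<forall>k. Ck_on k U g) \<and> (\<forall>y\<in>A \<inter> U. g y = f y))"

type_synonym ('a, 'b) chart = "'a set \<times> ('a \<Rightarrow> 'b)"

(* Charts take values in arbitrary subsets of 'b.  Images that are open in 'b or in a linear
   subspace of 'b give manifolds (whose dimensions may differ from one E_i to another), relatively
   open subsets of half-spaces give manifolds with boundary, and points give discrete spaces. *)
definition smooth_atlas :: "'a topology \<Rightarrow> ('a, 'b::euclidean_space) chart set \<Rightarrow> bool" where
  "smooth_atlas T A \<longleftrightarrow>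
     (\<Union>(U, \<phi>)\<in>A. U) = topspace T \<and>
     (\<forall>(U, \<phi>)\<in>A. openin T U \<and> homeomorphic_map (subtopology T U) (top_of_set (\<phi> ` U)) \<phi>) \<and>
     (\<forall>(U, \<phi>)\<in>A. \<forall>(V, \<psi>)\<in>A. smooth_on (\<phi> ` (U \<inter> V)) (\<psi> \<circ> inv_into U \<phi>))"

definition state_space :: "'a topology \<Rightarrow> ('a, 'b::euclidean_space) chart set \<Rightarrow> bool" where
  "state_space T A \<longleftrightarrow> completely_metrizable_space T \<and> second_countable T \<and>
     locally_compact_space T \<and> smooth_atlas T A"

definition product_atlas ::
    "('i::finite \<Rightarrow> ('a, 'b::euclidean_space) chart set) \<Rightarrow> ('i \<Rightarrow> 'a, 'b ^ 'i) chart set" where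
  "product_atlas A =
     {(\<Pi>\<^sub>E i\<in>UNIV. fst (c i), \<lambda>x. \<chi> i. snd (c i) (x i)) | c. \<forall>i. c i \<in> A i}"

definition C_c_inf :: "'a topology \<Rightarrow> ('a, 'b::euclidean_space) chart set \<Rightarrow> ('a \<Rightarrow> real) set" where
  "C_c_inf T A = {f. vanishes_off T f \<and> continuous_map T euclideanreal f \<and>
     compactin T (T closure_of {x \<in> topspace T. f x \<noteq> 0}) \<and>
     (\<forall>(U, \<phi>)\<in>A. smooth_on (\<phi> ` U) (f \<circ> inv_into U \<phi>))}"

definition cadlag :: "'a topology \<Rightarrow> (real \<Rightarrow> 'a) set" where
  "cadlag T = {w \<in> {0..} \<rightarrow>\<^sub>E topspace T.
     (\<forall>t\<ge>0. limitin T w (w t) (at_right t)) \<and> (\<forall>t>0. \<exists>l. limitin T w l (at_left t))}"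

(* The sigma-algebra on the cadlag space D([0,infinity), T) is the one generated by the
   evaluations, which for Polish T is the Borel sigma-algebra of the Skorokhod topology. *)
definition path_space :: "'a topology \<Rightarrow> (real \<Rightarrow> 'a) measure" where
  "path_space T = restrict_space (\<Pi>\<^sub>M t\<in>{0..}. borel_of T) (cadlag T)"

definition filtration :: "'a topology \<Rightarrow> real \<Rightarrow> (real \<Rightarrow> 'a) measure" where
  "filtration T s =
     vimage_algebra (cadlag T) (\<lambda>w. restrict w {0..s}) (\<Pi>\<^sub>M t\<in>{0..s}. borel_of T)"

(* A Markov process is given by its laws P x on the cadlag space, x being the starting point. *)

definition semigroup_of ::
    "'a topology \<Rightarrow> ('a \<Rightarrow> (real \<Rightarrow> 'a) measure) \<Rightarrow> real \<Rightarrow> ('a \<Rightarrow> real) \<Rightarrow> 'a \<Rightarrow> real" where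
  "semigroup_of T P t f x = (if x \<in> topspace T then \<integral>w. f (w t) \<partial>P x else 0)"

definition markov_process :: "'a topology \<Rightarrow> ('a \<Rightarrow> (real \<Rightarrow> 'a) measure) \<Rightarrow> bool" where
  "markov_process T P \<longleftrightarrow>
     P \<in> borel_of T \<rightarrow>\<^sub>M prob_algebra (path_space T) \<and>
     (\<forall>x\<in>topspace T. AE w in P x. w 0 = x) \<and>
     (\<forall>x\<in>topspace T. \<forall>s\<ge>0. \<forall>t\<ge>0. \<forall>f\<in>B_b T.
        AE w in P x. real_cond_exp (P x) (filtration T s) (\<lambda>w. f (w (s + t))) w
                     = semigroup_of T P t f (w s))"

definition diff_quotient ::
    "'a topology \<Rightarrow> ('a \<Rightarrow> (real \<Rightarrow> 'a) measure) \<Rightarrow> ('a \<Rightarrow> real) \<Rightarrow> real \<Rightarrow> 'a \<Rightarrow> real" where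
  "diff_quotient T P f t x = (semigroup_of T P t f x - f x) / t"

definition gen :: "'a topology \<Rightarrow> ('a \<Rightarrow> (real \<Rightarrow> 'a) measure) \<Rightarrow> ('a \<Rightarrow> real) \<Rightarrow> 'a \<Rightarrow> real" where
  "gen T P f x = Lim (at_right 0) (\<lambda>t. diff_quotient T P f t x)"

(* The domain of the generator as an operator on C_0 ... *)
definition gen_dom0 :: "'a topology \<Rightarrow> ('a \<Rightarrow> (real \<Rightarrow> 'a) measure) \<Rightarrow> ('a \<Rightarrow> real) set" where
  "gen_dom0 T P =
     {f \<in> C_0 T. \<exists>g\<in>C_0 T. uniform_limit (topspace T) (diff_quotient T P f) g (at_right 0)}"

(* ... and of its extension to C_b, which contains the constants. *)
definition gen_dom :: "'a topology \<Rightarrow> ('a \<Rightarrow> (real \<Rightarrow> 'a) measure) \<Rightarrow> ('a \<Rightarrow> real) set" where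
  "gen_dom T P =
     {f \<in> C_b T. \<exists>g. \<forall>K. compactin T K \<longrightarrow> uniform_limit K (diff_quotient T P f) g (at_right 0)}"

definition feller_process ::
    "'a topology \<Rightarrow> ('a, 'b::euclidean_space) chart set \<Rightarrow> ('a \<Rightarrow> (real \<Rightarrow> 'a) measure) \<Rightarrow> bool" where
  "feller_process T A P \<longleftrightarrow>
     markov_process T P \<and>
     (\<forall>t\<ge>0. \<forall>f\<in>C_0 T. semigroup_of T P t f \<in> C_0 T) \<and>
     (\<forall>f\<in>C_0 T. uniform_limit (topspace T) (\<lambda>t. semigroup_of T P t f) f (at_right 0)) \<and>
     C_c_inf T A \<subseteq> gen_dom0 T P"

(* Closure, for the supremum norm, of the graph of the operator L with domain D. *)
definition op_closure ::
    "'a topology \<Rightarrow> ('a \<Rightarrow> real) set \<Rightarrow> (('a \<Rightarrow> real) \<Rightarrow> 'a \<Rightarrow> real) \<Rightarrow>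
     (('a \<Rightarrow> real) \<times> ('a \<Rightarrow> real)) set" where
  "op_closure T D L = {(f, g). vanishes_off T f \<and> vanishes_off T g \<and>
     (\<forall>e>0. \<exists>h\<in>D. \<forall>x\<in>topspace T. \<bar>h x - f x\<bar> < e \<and> \<bar>L h x - g x\<bar> < e)}"

(* The generator and its extension to C_b share one notation.  Accordingly, the closure of an
   operator is the generator of P if it contains the generator on C_0 and is contained in the
   extended one; then its part in C_0 x C_0 is exactly the generator on C_0. *)
definition closure_generates ::
    "'a topology \<Rightarrow> ('a \<Rightarrow> real) set \<Rightarrow> (('a \<Rightarrow> real) \<Rightarrow> 'a \<Rightarrow> real) \<Rightarrow>
     ('a \<Rightarrow> (real \<Rightarrow> 'a) measure) \<Rightarrow> bool" where
  "closure_generates T D L P \<longleftrightarrow>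
     single_valued (op_closure T D L) \<and>
     (\<forall>f\<in>gen_dom0 T P. (f, gen T P f) \<in> op_closure T D L) \<and>
     (\<forall>(f, g)\<in>op_closure T D L. f \<in> gen_dom T P \<and> gen T P f = g)"

definition is_core ::
    "'a topology \<Rightarrow> ('a \<Rightarrow> (real \<Rightarrow> 'a) measure) \<Rightarrow> ('a \<Rightarrow> real) set \<Rightarrow> bool" where
  "is_core T P D \<longleftrightarrow> D \<subseteq> gen_dom T P \<and> (\<forall>f\<in>gen_dom0 T P. (f, gen T P f) \<in> op_closure T D (gen T P))"

abbreviation prod_space :: "('i::finite \<Rightarrow> 'a topology) \<Rightarrow> ('i \<Rightarrow> 'a) topology" where
  "prod_space E \<equiv> product_topology E UNIV"

definition coord_fun :: "('i::finite \<Rightarrow> 'a topology) \<Rightarrow> 'i \<Rightarrow> ('a \<Rightarrow> real) \<Rightarrow> ('i \<Rightarrow> 'a) \<Rightarrow> real" where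
  "coord_fun E i f x = (if x \<in> topspace (prod_space E) then f (x i) else 0)"

definition partial_gen ::
    "('i::finite \<Rightarrow> 'a topology) \<Rightarrow> ('i \<Rightarrow> 'a \<Rightarrow> (real \<Rightarrow> 'a) measure) \<Rightarrow> 'i \<Rightarrow>
     (('i \<Rightarrow> 'a) \<Rightarrow> real) \<Rightarrow> ('i \<Rightarrow> 'a) \<Rightarrow> real" where
  "partial_gen E P i f x = gen (E i) (P i) (\<lambda>y. f (x(i := y))) (x i)"

definition sum_gen ::
    "('i::finite \<Rightarrow> 'a topology) \<Rightarrow> ('i \<Rightarrow> 'a \<Rightarrow> (real \<Rightarrow> 'a) measure) \<Rightarrow>
     (('i \<Rightarrow> 'a) \<Rightarrow> real) \<Rightarrow> ('i \<Rightarrow> 'a) \<Rightarrow> real" where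
  "sum_gen E P f x = (\<Sum>i\<in>UNIV. partial_gen E P i f x)"

definition alg_tensor ::
    "('i::finite \<Rightarrow> 'a topology) \<Rightarrow> ('i \<Rightarrow> 'a \<Rightarrow> (real \<Rightarrow> 'a) measure) \<Rightarrow> (('i \<Rightarrow> 'a) \<Rightarrow> real) set" where
  "alg_tensor E P =
     {\<lambda>x. \<Sum>k<m. \<Prod>i\<in>UNIV. u k i (x i) | (m::nat) u. \<forall>k<m. \<forall>i. u k i \<in> gen_dom (E i) (P i)}"

(* Topological tensor product of the domains: the closure of the algebraic one for the norm
   |f| + sum_i |L_i f| (supremum norms).  The extended domains have to be taken here, since with
   the domains in C_0 a function of one coordinate would not lie in the tensor product. *)
definition tensor_dom ::
    "('i::finite \<Rightarrow> 'a topology) \<Rightarrow> ('i \<Rightarrow> 'a \<Rightarrow> (real \<Rightarrow> 'a) measure) \<Rightarrow> (('i \<Rightarrow> 'a) \<Rightarrow> real) set" where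
  "tensor_dom E P = {f \<in> C_b (prod_space E).
     (\<forall>x\<in>topspace (prod_space E). \<forall>i. (\<lambda>y. f (x(i := y))) \<in> gen_dom (E i) (P i)) \<and>
     (\<forall>e>0. \<exists>h\<in>alg_tensor E P. \<forall>x\<in>topspace (prod_space E).
        \<bar>h x - f x\<bar> < e \<and> (\<forall>i. \<bar>partial_gen E P i h x - partial_gen E P i f x\<bar> < e))}"

(* An operator is a pair of a domain and a map; the values of the map off the domain are irrelevant. *)
definition linear_operator_on_B_b ::
    "'a topology \<Rightarrow> ('a \<Rightarrow> real) set \<times> (('a \<Rightarrow> real) \<Rightarrow> 'a \<Rightarrow> real) \<Rightarrow> bool" where
  "linear_operator_on_B_b T = (\<lambda>(D, G).
     D \<subseteq> B_b T \<and> G ` D \<subseteq> B_b T \<and> (\<lambda>_. 0) \<in> D \<and>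
     (\<forall>f\<in>D. \<forall>g\<in>D. \<forall>a b. (\<lambda>x. a * f x + b * g x) \<in> D \<and>
        G (\<lambda>x. a * f x + b * g x) = (\<lambda>x. a * G f x + b * G g x)))"

definition kills_marginals ::
    "('i::finite \<Rightarrow> 'a topology) \<Rightarrow> ('i \<Rightarrow> ('a, 'b::euclidean_space) chart set) \<Rightarrow>
     (('i \<Rightarrow> 'a) \<Rightarrow> real) set \<times> ((('i \<Rightarrow> 'a) \<Rightarrow> real) \<Rightarrow> ('i \<Rightarrow> 'a) \<Rightarrow> real) \<Rightarrow> bool" where
  "kills_marginals E A = (\<lambda>(D, G).
     \<forall>i. \<forall>f\<in>C_c_inf (E i) (A i). coord_fun E i f \<in> D \<and> G (coord_fun E i f) = (\<lambda>_. 0))"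

definition generated_by_sum ::
    "('i::finite \<Rightarrow> 'a topology) \<Rightarrow> ('i \<Rightarrow> 'a \<Rightarrow> (real \<Rightarrow> 'a) measure) \<Rightarrow>
     (('i \<Rightarrow> 'a) \<Rightarrow> real) set \<times> ((('i \<Rightarrow> 'a) \<Rightarrow> real) \<Rightarrow> ('i \<Rightarrow> 'a) \<Rightarrow> real) \<Rightarrow>
     (('i \<Rightarrow> 'a) \<Rightarrow> (real \<Rightarrow> 'i \<Rightarrow> 'a) measure) \<Rightarrow> bool" where
  "generated_by_sum E P = (\<lambda>(D, G) Q.
     closure_generates (prod_space E) (tensor_dom E P \<inter> D) (\<lambda>f x. sum_gen E P f x + G f x) Q)"

definition coupling_operators ::
    "('i::finite \<Rightarrow> 'a topology) \<Rightarrow> ('i \<Rightarrow> ('a, 'b::euclidean_space) chart set) \<Rightarrow>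
     ('i \<Rightarrow> 'a \<Rightarrow> (real \<Rightarrow> 'a) measure) \<Rightarrow>
     ((('i \<Rightarrow> 'a) \<Rightarrow> real) set \<times> ((('i \<Rightarrow> 'a) \<Rightarrow> real) \<Rightarrow> ('i \<Rightarrow> 'a) \<Rightarrow> real)) set" where
  "coupling_operators E A P = {\<Gamma>.
     linear_operator_on_B_b (prod_space E) \<Gamma> \<and> kills_marginals E A \<Gamma> \<and>
     (\<exists>Q. feller_process (prod_space E) (product_atlas A) Q \<and> generated_by_sum E P \<Gamma> Q)}"

definition coord_path :: "'i \<Rightarrow> (real \<Rightarrow> 'i \<Rightarrow> 'a) \<Rightarrow> real \<Rightarrow> 'a" where
  "coord_path i w = (\<lambda>t\<in>{0..}. w t i)"

(* Processes started from x, resp. from x i, for every starting point x. *)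
definition feller_coupling ::
    "('i::finite \<Rightarrow> 'a topology) \<Rightarrow> ('i \<Rightarrow> ('a, 'b::euclidean_space) chart set) \<Rightarrow>
     ('i \<Rightarrow> 'a \<Rightarrow> (real \<Rightarrow> 'a) measure) \<Rightarrow> (('i \<Rightarrow> 'a) \<Rightarrow> (real \<Rightarrow> 'i \<Rightarrow> 'a) measure) \<Rightarrow> bool" where
  "feller_coupling E A P Q \<longleftrightarrow>
     feller_process (prod_space E) (product_atlas A) Q \<and>
     (\<forall>i. \<forall>x\<in>topspace (prod_space E). distr (Q x) (path_space (E i)) (coord_path i) = P i (x i))"

(* The functions on which both the generator of Q and the sum of the L_i are defined and their
   difference takes values in B_b.  This set need not be a core for the generator of a Feller
   coupling Q.  Let X, Y be Brownian motions on the line with covariation density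
   1 - min(1, |x - y|^a), 0 < a < 1, and let X - Y be absorbed at 0.  The domain of the generator
   contains functions equal to |x - y| near a part of the diagonal.  Those are not in the closure
   of the restriction to common_dom: for f in common_dom, averages of f along the diagonal
   direction are C^1 functions of z = x - y whose second derivatives are bounded by a constant
   times 1 / min(1, |z|^a), which is locally integrable, and the constant is uniform along
   sequences converging in the graph norm, so that no kink appears in the limit. *)
definition common_dom ::
    "('i::finite \<Rightarrow> 'a topology) \<Rightarrow> ('i \<Rightarrow> 'a \<Rightarrow> (real \<Rightarrow> 'a) measure) \<Rightarrow>
     (('i \<Rightarrow> 'a) \<Rightarrow> (real \<Rightarrow> 'i \<Rightarrow> 'a) measure) \<Rightarrow> (('i \<Rightarrow> 'a) \<Rightarrow> real) set" where
  "common_dom E P Q = {f \<in> tensor_dom E P \<inter> gen_dom (prod_space E) Q.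
     (\<lambda>x. gen (prod_space E) Q f x - sum_gen E P f x) \<in> B_b (prod_space E)}"

end

(* A process on the product couples the X^i as soon as its semigroup acts on functions of one
   coordinate as that of X^i does.  Since Gamma kills test functions and C_c^infinity(E_i) is a core,
   the generator of the product process agrees with L_i on functions f(x_i), f in the domain of L_i.
   For such f, v(t, x) = S_t f(x) - (S^i_t f)(x_i) solves the evolution equation with zero initial
   value, and a maximum principle gives v = 0.  Density of the domain yields the equality for all f in
   C_0(E_i), the Markov property the finite-dimensional distributions, and these determine the law
   of the path.  Conversely, Gamma is the difference of the generator and the sum of the L_i.  The
   closure of sum_i L_i + Gamma stays inside the extended generator because the latter is closed under
   uniform convergence of functions and images, which again rests on the maximum principle. *)

theory Submission
  imports Defs
begin

section \<open>Function spaces over a topology\<close>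

text \<open>A function of one coordinate that is not 0 fails to vanish at infinity on the product as
  soon as another factor is noncompact. The Feller property of the product process speaks of
  \<open>C_0\<close> only, so uniqueness for the Cauchy problem in a Banach space is not at hand for
  such functions; on \<open>C_b\<close> the difference quotients converge merely uniformly on
  compact sets, with no global bound. The substitute is conservation of mass: the laws are
  probability measures, so for a suitable cutoff \<eta> in \<open>C_0\<close> the function 1 -
  \<open>S t \<eta>\<close> is small at a prescribed point although \<eta> vanishes at infinity.
  This controls the part of a \<open>C_b\<close> function near infinity, both for joint continuity
  and in comparison arguments.

  Comparison must moreover be uniform in the function. Along the backward flow the function to which
  the product semigroup is applied changes with the time step h, and in a closure it runs through
  approximants. The estimates are therefore arranged so that the time threshold depends only on the
  target image and the compact set.\<close>

lemma continuous_map_real_iff: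
  "continuous_map X euclideanreal f \<longleftrightarrow>
    (\<forall>x\<in>topspace X. \<forall>e>0. \<exists>U. openin X U \<and> x \<in> U \<and> (\<forall>y\<in>U. \<bar>f y - f x\<bar> < e))"
  using Met_TC.continuous_map_to_metric[of X f] by (simp add: dist_real_def abs_minus_commute)

lemma continuous_map_real_uniform_limit:
  assumes "\<And>e. e > 0 \<Longrightarrow> \<exists>g. continuous_map X euclideanreal g \<and> (\<forall>x\<in>topspace X. \<bar>g x - f x\<bar> < e)"
  shows "continuous_map X euclideanreal f"
  unfolding continuous_map_real_iff
proof (intro ballI allI impI)
  fix x and e :: real assume x: "x \<in> topspace X" and e: "e > 0"
  obtain g where g: "continuous_map X euclideanreal g" "\<And>x. x \<in> topspace X \<Longrightarrow> \<bar>g x - f x\<bar> < e/3"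
    using assms[of "e/3"] e by auto
  obtain U where U: "openin X U" "x \<in> U" "\<And>y. y \<in> U \<Longrightarrow> \<bar>g y - g x\<bar> < e/3"
    using g(1) x e unfolding continuous_map_real_iff by (metis divide_pos_pos zero_less_numeral)
  have "\<bar>f y - f x\<bar> < e" if "y \<in> U" for y
  proof -
    have "y \<in> topspace X" using openin_subset[OF U(1)] that by blast
    then show ?thesis using g(2)[OF x] g(2)[of y] U(3)[OF that] by linarith
  qed
  then show "\<exists>U. openin X U \<and> x \<in> U \<and> (\<forall>y\<in>U. \<bar>f y - f x\<bar> < e)"
    using U by blast
qed

section \<open>Borel sets of an abstract topology\<close>

lemma space_borel_of [simp]: "space (borel_of T) = topspace T"
  unfolding borel_of_def by (subst space_measure_of) (auto dest: openin_subset)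

lemma openin_sets_borel_of: "openin T U \<Longrightarrow> U \<in> sets (borel_of T)"
  unfolding borel_of_def
  by (subst sets_measure_of) (auto dest: openin_subset intro: sigma_sets.Basic)

lemma closedin_sets_borel_of: "closedin T C \<Longrightarrow> C \<in> sets (borel_of T)"
  by (metis closedin_def openin_sets_borel_of sets.compl_sets space_borel_of double_diff subset_refl)

lemma continuous_map_measurable:
  assumes "continuous_map T T' f"
  shows "f \<in> borel_of T \<rightarrow>\<^sub>M borel_of T'"
  unfolding borel_of_def[of T']
proof (rule measurable_measure_of)
  show "f \<in> space (borel_of T) \<rightarrow> topspace T'"
    using assms by (auto simp: continuous_map_def)
  fix U assume "U \<in> {U. openin T' U}"
  then have "openin T {x \<in> topspace T. f x \<in> U}"
    using assms by (auto simp: continuous_map_def)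
  moreover have "{x \<in> topspace T. f x \<in> U} = f -` U \<inter> space (borel_of T)" by auto
  ultimately show "f -` U \<inter> space (borel_of T) \<in> sets (borel_of T)"
    by (metis openin_sets_borel_of)
qed (auto dest: openin_subset)

lemma borel_of_euclidean: "borel_of euclidean = borel"
  by (simp add: borel_of_def borel_def)

lemma continuous_map_borel_measurable:
  "continuous_map T euclideanreal f \<Longrightarrow> f \<in> borel_measurable (borel_of T)"
  using continuous_map_measurable[of T euclideanreal f] by (simp add: borel_of_euclidean)

section \<open>Algebra and uniform limits in \<open>B_b\<close>, \<open>C_b\<close> and
  \<open>C_0\<close>\<close>

lemma bounded_range_real_iff: "bounded (range (f :: 'a \<Rightarrow> real)) \<longleftrightarrow> (\<exists>C. \<forall>x. \<bar>f x\<bar> \<le> C)"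
  by (auto simp: bounded_iff)

lemma C_0_small_off_compact:
  assumes "f \<in> C_0 T" "e > 0"
  obtains K where "compactin T K" "\<And>x. x \<in> topspace T \<Longrightarrow> x \<notin> K \<Longrightarrow> \<bar>f x\<bar> < e"
  using assms unfolding C_0_def by blast

lemma C_0_subset_C_b: "C_0 T \<subseteq> C_b T"
proof
  fix f assume f: "f \<in> C_0 T"
  obtain K where K: "compactin T K" "\<And>x. x \<in> topspace T \<Longrightarrow> x \<notin> K \<Longrightarrow> \<bar>f x\<bar> < 1"
    using C_0_small_off_compact[OF f zero_less_one] by blast
  have cont: "continuous_map T euclideanreal f" and off: "vanishes_off T f"
    using f by (auto simp: C_0_def)
  have "compact (f ` K)"
    using image_compactin[OF K(1) cont] by simp
  then obtain B where B: "\<And>x. x \<in> K \<Longrightarrow> \<bar>f x\<bar> \<le> B"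
    by (meson bounded_real compact_imp_bounded imageI)
  have "\<bar>f x\<bar> \<le> max B 1" for x
    using B[of x] K(2)[of x] off unfolding vanishes_off_def
    by (cases "x \<in> K"; cases "x \<in> topspace T") (auto simp: max_def)
  then show "f \<in> C_b T"
    using cont off by (auto simp: C_b_def bounded_range_real_iff)
qed

lemma C_b_subset_B_b: "C_b T \<subseteq> B_b T"
  by (auto simp: C_b_def B_b_def continuous_map_borel_measurable)

lemma abs_lincomb_le:
  fixes a b u v :: real
  assumes "\<bar>u\<bar> \<le> C" "\<bar>v\<bar> \<le> D"
  shows "\<bar>a * u + b * v\<bar> \<le> \<bar>a\<bar> * C + \<bar>b\<bar> * D"
proof -
  have "\<bar>a * u + b * v\<bar> \<le> \<bar>a\<bar> * \<bar>u\<bar> + \<bar>b\<bar> * \<bar>v\<bar>" by (metis abs_mult abs_triangle_ineq)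
  also have "\<dots> \<le> \<bar>a\<bar> * C + \<bar>b\<bar> * D" using assms by (intro add_mono mult_left_mono) auto
  finally show ?thesis .
qed

text \<open>The summand 1 keeps the denominator positive, so that one tolerance serves for all
  coefficients, including a = b = 0. All linearity proofs for approximations below rest on
  it.\<close>

lemma abs_lincomb_less:
  fixes a b u v :: real
  assumes "\<bar>u\<bar> < e / (\<bar>a\<bar> + \<bar>b\<bar> + 1)" "\<bar>v\<bar> < e / (\<bar>a\<bar> + \<bar>b\<bar> + 1)"
  shows "\<bar>a * u + b * v\<bar> < e"
proof -
  define r where "r = e / (\<bar>a\<bar> + \<bar>b\<bar> + 1)"
  have r: "\<bar>u\<bar> < r" "\<bar>v\<bar> < r" using assms by (auto simp: r_def)
  have "\<bar>a * u + b * v\<bar> \<le> \<bar>a\<bar> * r + \<bar>b\<bar> * r" using r by (intro abs_lincomb_le) auto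
  also have "\<dots> < (\<bar>a\<bar> + \<bar>b\<bar> + 1) * r" using r by (simp add: algebra_simps)
  also have "\<dots> = e" by (simp add: r_def add_nonneg_pos less_imp_neq[THEN not_sym])
  finally show ?thesis .
qed

lemma C_b_linear:
  assumes "f \<in> C_b T" "g \<in> C_b T"
  shows "(\<lambda>x. a * f x + b * g x) \<in> C_b T"
proof -
  obtain C D where C: "\<And>x. \<bar>f x\<bar> \<le> C" and D: "\<And>x. \<bar>g x\<bar> \<le> D"
    using assms by (auto simp: C_b_def bounded_range_real_iff)
  have "\<bar>a * f x + b * g x\<bar> \<le> \<bar>a\<bar> * C + \<bar>b\<bar> * D" for x
    by (intro abs_lincomb_le C D)
  then show ?thesis
    using assms unfolding C_b_def vanishes_off_def bounded_range_real_iff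
    by (auto intro!: continuous_map_add continuous_map_real_mult simp: continuous_map_const)
qed

lemma B_b_linear:
  assumes "f \<in> B_b T" "g \<in> B_b T"
  shows "(\<lambda>x. a * f x + b * g x) \<in> B_b T"
proof -
  obtain C D where C: "\<And>x. \<bar>f x\<bar> \<le> C" and D: "\<And>x. \<bar>g x\<bar> \<le> D"
    using assms by (auto simp: B_b_def bounded_range_real_iff)
  have "\<bar>a * f x + b * g x\<bar> \<le> \<bar>a\<bar> * C + \<bar>b\<bar> * D" for x
    by (intro abs_lincomb_le C D)
  then show ?thesis
    using assms unfolding B_b_def vanishes_off_def bounded_range_real_iff by auto
qed

lemma C_0_linear:
  assumes "f \<in> C_0 T" "g \<in> C_0 T"
  shows "(\<lambda>x. a * f x + b * g x) \<in> C_0 T"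
proof -
  have "\<exists>K. compactin T K \<and> (\<forall>x\<in>topspace T - K. \<bar>a * f x + b * g x\<bar> < e)" if e: "e > 0" for e
  proof -
    define r where "r = e / (\<bar>a\<bar> + \<bar>b\<bar> + 1)"
    have r: "r > 0" using e by (simp add: r_def add_nonneg_pos)
    obtain K L where K: "compactin T K" "\<And>x. x \<in> topspace T - K \<Longrightarrow> \<bar>f x\<bar> < r"
      and L: "compactin T L" "\<And>x. x \<in> topspace T - L \<Longrightarrow> \<bar>g x\<bar> < r"
      using assms r unfolding C_0_def by blast
    have "\<bar>a * f x + b * g x\<bar> < e" if "x \<in> topspace T - (K \<union> L)" for x
      using abs_lincomb_less[OF K(2)[of x, unfolded r_def] L(2)[of x, unfolded r_def]] that by simp
    then show ?thesis using compactin_Un[OF K(1) L(1)] by blast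
  qed
  then show ?thesis
    using assms unfolding C_0_def vanishes_off_def
    by (auto intro!: continuous_map_add continuous_map_real_mult simp: continuous_map_const)
qed

lemma C_0_mult:
  assumes "f \<in> C_0 T" "g \<in> C_b T"
  shows "(\<lambda>x. f x * g x) \<in> C_0 T"
proof -
  obtain C where C: "\<And>x. \<bar>g x\<bar> \<le> C"
    using assms by (auto simp: C_b_def bounded_range_real_iff)
  have C0: "C \<ge> 0" using C[of undefined] by linarith
  have "\<exists>K. compactin T K \<and> (\<forall>x\<in>topspace T - K. \<bar>f x * g x\<bar> < e)" if e: "e > 0" for e
  proof -
    have r: "e / (C + 1) > 0" using e C0 by simp
    then obtain K where K: "compactin T K" "\<And>x. x \<in> topspace T - K \<Longrightarrow> \<bar>f x\<bar> < e / (C+1)"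
      using assms(1) unfolding C_0_def by blast
    have "\<bar>f x * g x\<bar> < e" if "x \<in> topspace T - K" for x
    proof -
      have "\<bar>f x * g x\<bar> \<le> \<bar>f x\<bar> * (C + 1)"
        unfolding abs_mult using C[of x] by (intro mult_left_mono) auto
      also have "\<dots> < e" using K(2)[OF that] C0 by (simp add: pos_less_divide_eq)
      finally show ?thesis .
    qed
    then show ?thesis using K by blast
  qed
  then show ?thesis
    using assms unfolding C_0_def C_b_def vanishes_off_def
    by (auto intro!: continuous_map_real_mult)
qed

lemma C_0_uniform_limit:
  assumes "\<And>e. e > 0 \<Longrightarrow> \<exists>g\<in>C_0 T. \<forall>x\<in>topspace T. \<bar>g x - f x\<bar> < e" "vanishes_off T f"
  shows "f \<in> C_0 T"
proof -
  have "continuous_map T euclideanreal f"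
  proof (rule continuous_map_real_uniform_limit)
    fix e :: real assume "e > 0"
    then obtain g where "g \<in> C_0 T" "\<forall>x\<in>topspace T. \<bar>g x - f x\<bar> < e"
      using assms(1) by blast
    then show "\<exists>g. continuous_map T euclideanreal g \<and> (\<forall>x\<in>topspace T. \<bar>g x - f x\<bar> < e)"
      by (auto simp: C_0_def)
  qed
  moreover have "\<exists>K. compactin T K \<and> (\<forall>x\<in>topspace T - K. \<bar>f x\<bar> < e)" if e: "e > 0" for e
  proof -
    obtain g where g: "g \<in> C_0 T" "\<And>x. x \<in> topspace T \<Longrightarrow> \<bar>g x - f x\<bar> < e/2"
      using assms(1)[of "e/2"] e by auto
    obtain K where K: "compactin T K" "\<And>x. x \<in> topspace T \<Longrightarrow> x \<notin> K \<Longrightarrow> \<bar>g x\<bar> < e/2"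
      using C_0_small_off_compact[OF g(1), of "e/2"] e by auto
    have "\<bar>f x\<bar> < e" if "x \<in> topspace T - K" for x
    proof -
      have x: "x \<in> topspace T" "x \<notin> K" using that by auto
      show ?thesis using g(2)[OF x(1)] K(2)[OF x] by linarith
    qed
    then show ?thesis using K by blast
  qed
  ultimately show ?thesis using assms(2) by (auto simp: C_0_def)
qed

lemma C_0_sum:
  assumes "\<And>k. k \<in> I \<Longrightarrow> f k \<in> C_0 T"
  shows "(\<lambda>x. \<Sum>k\<in>I. f k x) \<in> C_0 T"
proof -
  have zero: "(\<lambda>x. 0) \<in> C_0 T"
    unfolding C_0_def vanishes_off_def by (auto intro: compactin_empty)
  show ?thesis
  proof (cases "finite I")
    case True
    then show ?thesis using assms
    proof (induction I)
      case (insert k I)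
      then show ?case
        using C_0_linear[of "f k" T "\<lambda>x. \<Sum>k\<in>I. f k x" 1 1] by simp
    qed (simp add: zero)
  qed (simp add: zero)
qed

text \<open>Local compactness places an open \<open>U\<close> and a compact \<open>L\<close> with
  \<open>K \<subseteq> U \<subseteq> L\<close>. Urysohn's function for \<open>K\<close> and the
  complement of \<open>U\<close> vanishes off \<open>L\<close>; the explicit 0 off the space is the
  convention of \<open>vanishes_off\<close>.\<close>

lemma C_0_cutoff:
  assumes "metrizable_space T" "locally_compact_space T" "compactin T K"
  obtains \<eta> where "\<eta> \<in> C_0 T" "\<And>x. 0 \<le> \<eta> x" "\<And>x. \<eta> x \<le> 1" "\<And>x. x \<in> K \<Longrightarrow> \<eta> x = 1"
proof -
  have H: "Hausdorff_space T" using assms(1) by (rule metrizable_imp_Hausdorff_space)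
  have N: "normal_space T" using assms(1) by (rule metrizable_imp_normal_space)
  obtain U L where UL: "openin T U" "compactin T L" "K \<subseteq> U" "U \<subseteq> L"
    using locally_compact_space_compact_closed_compact[of T] H assms by metis
  have cl: "closedin T (topspace T - U)" "closedin T K"
    using UL(1) compactin_imp_closedin[OF H assms(3)] by auto
  have dj: "disjnt (topspace T - U) K" using UL(3) by (auto simp: disjnt_def)
  obtain f :: "'a \<Rightarrow> real" where f: "continuous_map T (top_of_set {0..1}) f"
    "f ` (topspace T - U) \<subseteq> {0}" "f ` K \<subseteq> {1}"
    using Urysohn_lemma[OF N cl dj, of 0 1] by auto
  define \<eta> where "\<eta> x = (if x \<in> topspace T then f x else 0)" for x
  have f01: "f x \<in> {0..1}" if "x \<in> topspace T" for x
    using f(1) that by (auto simp: continuous_map_def)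
  have "continuous_map T euclideanreal f"
    using f(1) by (simp add: continuous_map_in_subtopology)
  then have "continuous_map T euclideanreal \<eta>"
    by (rule continuous_map_eq) (simp add: \<eta>_def)
  moreover have "\<eta> x = 0" if "x \<in> topspace T - L" for x
    using f(2) that UL(4) by (auto simp: \<eta>_def)
  ultimately have "\<eta> \<in> C_0 T"
    using UL(2) by (auto simp: C_0_def vanishes_off_def \<eta>_def)
  moreover have "\<eta> x = 1" if "x \<in> K" for x
    using f(3) that compactin_subset_topspace[OF assms(3)] by (auto simp: \<eta>_def)
  ultimately show ?thesis
    using that[of \<eta>] f01 by (auto simp: \<eta>_def)
qed

text \<open>For products of state spaces \<open>\<sigma>\<close>-compactness is easier to obtain than second countability.\<close>

definition sigma_compact :: "'a topology \<Rightarrow> bool" where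
  "sigma_compact T \<longleftrightarrow> (\<exists>K :: nat \<Rightarrow> 'a set. (\<forall>n. compactin T (K n)) \<and> topspace T = (\<Union>n. K n))"

lemma sigma_compact_ascending:
  assumes "sigma_compact T"
  obtains K :: "nat \<Rightarrow> 'a set" where "\<And>n. compactin T (K n)" "incseq K" "topspace T = (\<Union>n. K n)"
proof -
  obtain L :: "nat \<Rightarrow> 'a set" where L: "\<And>n. compactin T (L n)" "topspace T = (\<Union>n. L n)"
    using assms unfolding sigma_compact_def by blast
  show ?thesis
  proof
    show "compactin T (\<Union>j\<le>n. L j)" for n using L(1) by (intro compactin_Union) auto
    show "incseq (\<lambda>n. \<Union>j\<le>n. L j)" by (force simp: incseq_def)
    show "topspace T = (\<Union>n. \<Union>j\<le>n. L j)" using L(2) by auto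
  qed
qed

text \<open>Second countability acts through the Lindelof property: countably many of the open sets
  that have a compact superset cover the space.\<close>

lemma sigma_compact_second_countable:
  assumes "second_countable T" "locally_compact_space T"
  shows "sigma_compact T"
proof -
  have "\<forall>x\<in>topspace T. \<exists>U K. openin T U \<and> compactin T K \<and> x \<in> U \<and> U \<subseteq> K"
    using assms(2) unfolding locally_compact_space_def by blast
  then obtain U K where UK: "\<And>x. x \<in> topspace T \<Longrightarrow> openin T (U x) \<and> compactin T (K x) \<and> x \<in> U x \<and> U x \<subseteq> K x"
    by metis
  have "Lindelof_space T" using assms(1) by (rule second_countable_imp_Lindelof_space)
  then have "\<exists>\<V>. countable \<V> \<and> \<V> \<subseteq> U ` topspace T \<and> \<Union>\<V> = topspace T"
  proof (rule Lindelof_spaceD)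
    show "\<Union> (U ` topspace T) = topspace T"
      using UK openin_subset by fastforce
  qed (use UK in auto)
  then obtain \<V> where \<V>: "countable \<V>" "\<V> \<subseteq> U ` topspace T" "\<Union>\<V> = topspace T" by blast
  obtain C where C: "countable C" "C \<subseteq> topspace T" "\<V> = U ` C"
    using countable_subset_image[THEN iffD1, OF conjI[OF \<V>(1,2)]] by blast
  have UC: "\<Union> (U ` C) = topspace T" using \<V>(3) C(3) by simp
  show ?thesis
  \<comment> \<open>\<open>from_nat_into\<close> enumerates nonempty sets only; an empty
    \<open>C\<close> means an empty space.\<close>
  proof (cases "C = {}")
    case True
    then have "topspace T = (\<Union>n::nat. {})" using UC by simp
    then show ?thesis unfolding sigma_compact_def by (metis compactin_empty)
  next
    case False
    have "compactin T (K (from_nat_into C n))" for n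
      using UK C(2) from_nat_into[OF False] by blast
    moreover have "topspace T = (\<Union>n. K (from_nat_into C n))"
    proof -
      have "(\<Union>n. K (from_nat_into C n)) = \<Union> (K ` C)"
        using range_from_nat_into[OF False C(1)] by (metis image_image)
      also have "\<dots> = topspace T"
      proof
        show "\<Union> (K ` C) \<subseteq> topspace T" using UK C(2) compactin_subset_topspace by fast
        show "topspace T \<subseteq> \<Union> (K ` C)"
          unfolding UC[symmetric] using UK C(2) by (intro UN_mono) auto
      qed
      finally show ?thesis ..
    qed
    ultimately show ?thesis unfolding sigma_compact_def
      by (intro exI[of _ "\<lambda>n. K (from_nat_into C n)"]) auto
  qed
qed

text \<open>With ascending exhaustions a single index suffices for all coordinates: a point lies in
  the box whose index is the maximum of the finitely many indices at which its coordinates are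
  caught.\<close>

lemma sigma_compact_product:
  fixes E :: "'i::finite \<Rightarrow> 'a topology"
  assumes "\<And>i. sigma_compact (E i)"
  shows "sigma_compact (prod_space E)"
proof -
  have "\<exists>K :: nat \<Rightarrow> 'a set. (\<forall>n. compactin (E i) (K n)) \<and> incseq K \<and> topspace (E i) = (\<Union>n. K n)" for i
    using sigma_compact_ascending[OF assms[of i]] by metis
  then obtain K :: "'i \<Rightarrow> nat \<Rightarrow> 'a set" where K: "\<And>i n. compactin (E i) (K i n)" "\<And>i. incseq (K i)"
    "\<And>i. topspace (E i) = (\<Union>n. K i n)"
    by metis
  have "x \<in> (\<Union>n. \<Pi>\<^sub>E i\<in>UNIV. K i n)" if x: "x \<in> topspace (prod_space E)" for x
  proof -
    have "\<exists>n. x i \<in> K i n" for i using x K(3)[of i] by (auto simp: PiE_iff)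
    then obtain n where n: "\<And>i. x i \<in> K i (n i)" by metis
    have "x i \<in> K i (Max (range n))" for i
      using n[of i] monoD[OF K(2)[of i], of "n i" "Max (range n)"] by (auto intro: Max_ge)
    then show ?thesis by auto
  qed
  moreover have "(\<Pi>\<^sub>E i\<in>UNIV. K i n) \<subseteq> topspace (prod_space E)" for n
    using K(3) by auto
  ultimately have "topspace (prod_space E) = (\<Union>n. \<Pi>\<^sub>E i\<in>UNIV. K i n)"
    by (intro equalityI subsetI) blast+
  moreover have "\<forall>n. compactin (prod_space E) (\<Pi>\<^sub>E i\<in>UNIV. K i n)"
    using K(1) by (simp add: compactin_PiE)
  ultimately show ?thesis
    unfolding sigma_compact_def
    by (intro exI[of _ "\<lambda>n. \<Pi>\<^sub>E i\<in>UNIV. K i n"] conjI)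
qed

text \<open>A sequence, rather than a net of cutoffs, is what dominated convergence asks for. Since
  the compact sets ascend, each point eventually stays where the cutoff equals 1.\<close>

lemma C_0_cutoff_sequence:
  assumes "metrizable_space T" "locally_compact_space T" "sigma_compact T"
  obtains \<eta> :: "nat \<Rightarrow> 'a \<Rightarrow> real" where "\<And>n. \<eta> n \<in> C_0 T" "\<And>n x. 0 \<le> \<eta> n x" "\<And>n x. \<eta> n x \<le> 1"
    "\<And>x. x \<in> topspace T \<Longrightarrow> (\<lambda>n. \<eta> n x) \<longlonglongrightarrow> 1"
proof -
  obtain K :: "nat \<Rightarrow> 'a set" where K: "\<And>n. compactin T (K n)" "incseq K" "topspace T = (\<Union>n. K n)"
    using sigma_compact_ascending[OF assms(3)] by metis
  have "\<exists>\<eta>. \<eta> \<in> C_0 T \<and> (\<forall>x. 0 \<le> \<eta> x \<and> \<eta> x \<le> 1) \<and> (\<forall>x\<in>K n. \<eta> x = 1)" for n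
    using C_0_cutoff[OF assms(1,2) K(1)[of n]] by metis
  then obtain \<eta> where \<eta>: "\<And>n. \<eta> n \<in> C_0 T \<and> (\<forall>x. 0 \<le> \<eta> n x \<and> \<eta> n x \<le> 1) \<and> (\<forall>x\<in>K n. \<eta> n x = 1)"
    by metis
  have "(\<lambda>n. \<eta> n x) \<longlonglongrightarrow> 1" if "x \<in> topspace T" for x
  proof -
    have "x \<in> (\<Union>n. K n)" using that K(3) by simp
    then obtain N where N: "x \<in> K N" by blast
    then have "\<eta> n x = 1" if "n \<ge> N" for n
      using \<eta>[of n] monoD[OF K(2) that] N by blast
    then have "\<forall>\<^sub>F n in sequentially. \<eta> n x = 1"
      by (auto simp: eventually_sequentially)
    then show ?thesis by (rule tendsto_eventually)
  qed
  then show ?thesis using that[of \<eta>] \<eta> by blast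
qed

text \<open>In a metrizable space a closed set is the intersection of a descending sequence of open
  sets. Urysohn functions equal to 1 on \<open>C\<close> and to 0 off the n-th open set converge to
  the indicator; the cutoffs bring them into \<open>C_0\<close>.\<close>

lemma indicator_closed_limit:
  assumes T: "metrizable_space T" "locally_compact_space T" "sigma_compact T" and C: "closedin T C"
  obtains g :: "nat \<Rightarrow> 'a \<Rightarrow> real" where "\<And>n. g n \<in> C_0 T" "\<And>n x. 0 \<le> g n x" "\<And>n x. g n x \<le> 1"
    "\<And>x. x \<in> topspace T \<Longrightarrow> (\<lambda>n. g n x) \<longlonglongrightarrow> indicator C x"
proof -
  have N: "normal_space T" using T(1) by (rule metrizable_imp_normal_space)
  obtain U where U: "\<And>n::nat. openin T (U n)" "\<Inter> (range U) = C" "\<And>n. U (Suc n) \<subseteq> U n"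
    using closed_imp_gdelta_in[OF T(1) C] unfolding gdelta_in_descending by auto
  have "\<exists>f. continuous_map T (top_of_set {0..1::real}) f \<and> f ` (topspace T - U n) \<subseteq> {0} \<and> f ` C \<subseteq> {1}" for n
  proof -
    have "closedin T (topspace T - U n)" "disjnt (topspace T - U n) C"
      using U(1)[of n] U(2) by (auto simp: disjnt_def)
    then show ?thesis using Urysohn_lemma[OF N _ C, of "topspace T - U n" 0 1] by (metis zero_le_one)
  qed
  then obtain f where f: "\<And>n. continuous_map T (top_of_set {0..1::real}) (f n)"
    "\<And>n. f n ` (topspace T - U n) \<subseteq> {0}" "\<And>n. f n ` C \<subseteq> {1}" by metis
  obtain \<eta> :: "nat \<Rightarrow> 'a \<Rightarrow> real" where \<eta>: "\<And>n. \<eta> n \<in> C_0 T" "\<And>n x. 0 \<le> \<eta> n x" "\<And>n x. \<eta> n x \<le> 1"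
    "\<And>x. x \<in> topspace T \<Longrightarrow> (\<lambda>n. \<eta> n x) \<longlonglongrightarrow> 1"
    using C_0_cutoff_sequence[OF T] by metis
  define g where "g n x = (if x \<in> topspace T then \<eta> n x * f n x else 0)" for n x
  have f01: "0 \<le> f n x" "f n x \<le> 1" if "x \<in> topspace T" for n x
    using f(1)[of n] that by (auto simp: continuous_map_def)
  have fb: "(\<lambda>x. if x \<in> topspace T then f n x else 0) \<in> C_b T" for n
    unfolding C_b_def mem_Collect_eq bounded_range_real_iff
  proof (intro conjI)
    have "continuous_map T euclideanreal (f n)"
      using f(1)[of n] by (simp add: continuous_map_in_subtopology)
    then show "continuous_map T euclideanreal (\<lambda>x. if x \<in> topspace T then f n x else 0)"
      by (rule continuous_map_eq) simp
    show "\<exists>C. \<forall>x. \<bar>if x \<in> topspace T then f n x else 0\<bar> \<le> C"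
      using f01 by (intro exI[of _ 1]) auto
  qed (simp add: vanishes_off_def)
  have "g n \<in> C_0 T" for n
    using C_0_mult[OF \<eta>(1)[of n] fb[of n]]
    by (rule back_subst[of "\<lambda>h. h \<in> C_0 T"]) (use \<eta>(1)[of n] in \<open>auto simp: g_def C_0_def vanishes_off_def\<close>)
  moreover have "0 \<le> g n x" "g n x \<le> 1" for n x
    using f01[of x n] \<eta>(2,3)[of n x] by (auto simp: g_def mult_le_one)
  moreover have "(\<lambda>n. g n x) \<longlonglongrightarrow> indicator C x" if x: "x \<in> topspace T" for x
  proof (cases "x \<in> C")
    case True
    then have "g n x = \<eta> n x" for n using f(3)[of n] x by (auto simp: g_def)
    then show ?thesis using \<eta>(4)[OF x] True by simp
  next
    case False
    then obtain m where m: "x \<notin> U m" using U(2) by auto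
    have "g n x = 0" if "n \<ge> m" for n
    proof -
      have "U n \<subseteq> U m" using U(3) that by (rule lift_Suc_antimono_le)
      then show ?thesis using f(2)[of n] m x by (auto simp: g_def)
    qed
    then have "\<forall>\<^sub>F n in sequentially. g n x = 0"
      by (auto simp: eventually_sequentially)
    then show ?thesis using False by (simp add: tendsto_eventually)
  qed
  ultimately show ?thesis using that[of g] by blast
qed

text \<open>Closed sets form an intersection-stable generator of the Borel sets, and their measures
  are limits of integrals of \<open>C_0\<close> functions by dominated convergence.\<close>

lemma measure_eqI_C_0:
  assumes T: "metrizable_space T" "locally_compact_space T" "sigma_compact T"
    and M: "prob_space M" "sets M = sets (borel_of T)" and N: "prob_space N" "sets N = sets (borel_of T)"
    and eq: "\<And>f. f \<in> C_0 T \<Longrightarrow> (\<integral>x. f x \<partial>M) = (\<integral>x. f x \<partial>N)"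
  shows "M = N"
proof (rule measure_eqI_generator_eq)
  interpret M: prob_space M by fact
  interpret N: prob_space N by fact
  let ?G = "{C. closedin T C}"
  show "Int_stable ?G" by (auto simp: Int_stable_def)
  show "?G \<subseteq> Pow (topspace T)" by (auto dest: closedin_subset)
  have "sets (borel_of T) = sigma_sets (topspace T) ?G"
  proof
    have "sets (borel_of T) = sigma_sets (topspace T) {U. openin T U}"
      unfolding borel_of_def by (rule sets_measure_of) (auto dest: openin_subset)
    also have "\<dots> \<subseteq> sigma_sets (topspace T) ?G"
    proof (rule sigma_sets_mono, safe)
      fix U assume "openin T U"
      then have "topspace T - (topspace T - U) \<in> sigma_sets (topspace T) ?G"
        by (intro sigma_sets.Compl sigma_sets.Basic) auto
      then show "U \<in> sigma_sets (topspace T) ?G"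
        using openin_subset[OF \<open>openin T U\<close>] by (simp add: double_diff)
    qed
    finally show "sets (borel_of T) \<subseteq> sigma_sets (topspace T) ?G" .
    show "sigma_sets (topspace T) ?G \<subseteq> sets (borel_of T)"
      using sets.sigma_sets_subset[of ?G "borel_of T"] closedin_sets_borel_of by auto
  qed
  then show "sets M = sigma_sets (topspace T) ?G" "sets N = sigma_sets (topspace T) ?G"
    using M N by auto
  show "range (\<lambda>_::nat. topspace T) \<subseteq> ?G" "(\<Union>n::nat. topspace T) = topspace T" by auto
  show "emeasure M (topspace T) \<noteq> \<infinity>" for i :: nat by simp
  fix C assume "C \<in> ?G"
  then have C: "closedin T C" by simp
  have sp: "space M = topspace T" "space N = topspace T"
    using M(2) N(2) by (auto dest: sets_eq_imp_space_eq)
  have CM: "C \<in> sets M" "C \<in> sets N" using closedin_sets_borel_of[OF C] M N by auto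
  obtain g :: "nat \<Rightarrow> 'a \<Rightarrow> real" where g: "\<And>n. g n \<in> C_0 T" "\<And>n x. 0 \<le> g n x" "\<And>n x. g n x \<le> 1"
    "\<And>x. x \<in> topspace T \<Longrightarrow> (\<lambda>n. g n x) \<longlonglongrightarrow> indicator C x"
    using indicator_closed_limit[OF T C] by metis
  have gm: "g n \<in> borel_measurable (borel_of T)" for n
    using g(1)[of n] by (auto simp: C_0_def continuous_map_borel_measurable)
  then have gM: "g n \<in> borel_measurable M" "g n \<in> borel_measurable N" for n
    using M(2) N(2) by (auto cong: measurable_cong_sets)
  have "(\<lambda>n. \<integral>x. g n x \<partial>M) \<longlonglongrightarrow> (\<integral>x. indicator C x \<partial>M)"
    by (rule integral_dominated_convergence[where w="\<lambda>_. 1"])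
       (use g gM CM in \<open>auto simp: sp intro!: AE_I2\<close>)
  moreover have "(\<lambda>n. \<integral>x. g n x \<partial>N) \<longlonglongrightarrow> (\<integral>x. indicator C x \<partial>N)"
    by (rule integral_dominated_convergence[where w="\<lambda>_. 1"])
       (use g gM CM in \<open>auto simp: sp intro!: AE_I2\<close>)
  ultimately have "(\<integral>x. indicator C x \<partial>M) = (\<integral>x. indicator C x \<partial>N :: real)"
    using eq[OF g(1)] LIMSEQ_unique by simp
  then have "measure M C = measure N C"
    using CM closedin_subset[OF C] by (simp add: sp Int_absorb2)
  then show "emeasure M C = emeasure N C"
    by (simp add: M.emeasure_eq_measure N.emeasure_eq_measure)
qed

section \<open>Markov semigroups\<close>

text \<open>Values off the space are left free. A nonzero constant is not in \<open>B_b\<close>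
  unless the space fills the whole type, but constants are the comparison functions of most
  estimates.\<close>

definition bounded_measurable :: "'a topology \<Rightarrow> ('a \<Rightarrow> real) \<Rightarrow> bool" where
  "bounded_measurable T f \<longleftrightarrow> f \<in> borel_measurable (borel_of T) \<and> (\<exists>C. \<forall>x\<in>topspace T. \<bar>f x\<bar> \<le> C)"

lemma bounded_measurable_B_b: "f \<in> B_b T \<Longrightarrow> bounded_measurable T f"
  by (auto simp: B_b_def bounded_measurable_def bounded_range_real_iff)

lemma bounded_measurable_C_b: "f \<in> C_b T \<Longrightarrow> bounded_measurable T f"
  using C_b_subset_B_b bounded_measurable_B_b by blast

lemma bounded_measurable_C_0: "f \<in> C_0 T \<Longrightarrow> bounded_measurable T f"
  using C_0_subset_C_b bounded_measurable_C_b by blast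

lemma bounded_measurable_const: "bounded_measurable T (\<lambda>_. c)"
  by (auto simp: bounded_measurable_def)

lemma bounded_measurable_linear:
  assumes "bounded_measurable T f" "bounded_measurable T g"
  shows "bounded_measurable T (\<lambda>x. a * f x + b * g x)"
proof -
  obtain C D where C: "\<And>x. x \<in> topspace T \<Longrightarrow> \<bar>f x\<bar> \<le> C" and D: "\<And>x. x \<in> topspace T \<Longrightarrow> \<bar>g x\<bar> \<le> D"
    using assms by (auto simp: bounded_measurable_def)
  have "\<bar>a * f x + b * g x\<bar> \<le> \<bar>a\<bar> * C + \<bar>b\<bar> * D" if "x \<in> topspace T" for x
    by (intro abs_lincomb_le C D that)
  then show ?thesis
    using assms unfolding bounded_measurable_def by auto
qed

lemma bounded_measurable_diff:
  "bounded_measurable T f \<Longrightarrow> bounded_measurable T g \<Longrightarrow> bounded_measurable T (\<lambda>x. f x - g x)"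
  using bounded_measurable_linear[of T f g 1 "-1"] by simp

section \<open>Path space, evaluations and filtration\<close>

lemma space_path_space: "space (path_space T) = cadlag T"
proof -
  have "cadlag T \<subseteq> space (\<Pi>\<^sub>M t\<in>{0..}. borel_of T)"
    by (auto simp: cadlag_def space_PiM)
  then show ?thesis by (auto simp: path_space_def space_restrict_space)
qed

lemma eval_path_measurable:
  assumes "t \<ge> 0"
  shows "(\<lambda>w. w t) \<in> path_space T \<rightarrow>\<^sub>M borel_of T"
  unfolding path_space_def using assms
  by (intro measurable_restrict_space1 measurable_component_singleton) auto

lemma space_filtration: "space (filtration T s) = cadlag T"
  by (simp add: filtration_def)

lemma eval_filtration_measurable:
  assumes "0 \<le> t" "t \<le> s"
  shows "(\<lambda>w. w t) \<in> filtration T s \<rightarrow>\<^sub>M borel_of T"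
proof -
  have "(\<lambda>w. restrict w {0..s}) \<in> cadlag T \<rightarrow> space (\<Pi>\<^sub>M t\<in>{0..s}. borel_of T)"
    by (auto simp: cadlag_def space_PiM)
  then have "(\<lambda>w. restrict w {0..s}) \<in> filtration T s \<rightarrow>\<^sub>M (\<Pi>\<^sub>M t\<in>{0..s}. borel_of T)"
    unfolding filtration_def by (rule measurable_vimage_algebra1)
  moreover have "(\<lambda>v. v t) \<in> (\<Pi>\<^sub>M t\<in>{0..s}. borel_of T) \<rightarrow>\<^sub>M borel_of T"
    using assms by (intro measurable_component_singleton) auto
  ultimately have "(\<lambda>w. restrict w {0..s} t) \<in> filtration T s \<rightarrow>\<^sub>M borel_of T"
    by (rule measurable_compose)
  then show ?thesis using assms by simp
qed

text \<open>Makes the past a subalgebra of each law, so that conditional expectations given it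
  behave as they should.\<close>

lemma sets_filtration_subset: "sets (filtration T s) \<subseteq> sets (path_space T)"
proof -
  have f: "(\<lambda>w. restrict w {0..s}) \<in> cadlag T \<rightarrow> space (\<Pi>\<^sub>M t\<in>{0..s}. borel_of T)"
    by (auto simp: cadlag_def space_PiM)
  have m: "(\<lambda>w. \<lambda>t\<in>{0..s}. w t) \<in> path_space T \<rightarrow>\<^sub>M (\<Pi>\<^sub>M t\<in>{0..s}. borel_of T)"
    by (intro measurable_restrict eval_path_measurable) auto
  show ?thesis
    unfolding filtration_def sets_vimage_algebra2[OF f]
    using measurable_sets[OF m] by (auto simp: space_path_space)
qed

locale markov_semigroup =
  fixes T :: "'a topology" and P :: "'a \<Rightarrow> (real \<Rightarrow> 'a) measure"
  assumes markov: "markov_process T P"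
begin

abbreviation S :: "real \<Rightarrow> ('a \<Rightarrow> real) \<Rightarrow> 'a \<Rightarrow> real" where
  "S \<equiv> semigroup_of T P"

lemma P_measurable: "P \<in> borel_of T \<rightarrow>\<^sub>M prob_algebra (path_space T)"
  using markov by (simp add: markov_process_def)

lemma
  assumes "x \<in> topspace T"
  shows P_prob: "prob_space (P x)" and P_sets: "sets (P x) = sets (path_space T)"
    and P_space: "space (P x) = cadlag T"
proof -
  have "P x \<in> space (prob_algebra (path_space T))"
    using measurable_space[OF P_measurable] assms by simp
  then show "prob_space (P x)" and s: "sets (P x) = sets (path_space T)"
    by (auto simp: space_prob_algebra)
  show "space (P x) = cadlag T"
    using sets_eq_imp_space_eq[OF s] by (simp add: space_path_space)
qed

lemma eval_measurable:
  assumes "x \<in> topspace T" "t \<ge> 0"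
  shows "(\<lambda>w. w t) \<in> P x \<rightarrow>\<^sub>M borel_of T"
  using eval_path_measurable[OF assms(2)] P_sets[OF assms(1)] by (simp cong: measurable_cong_sets)

lemma eval_in: "w \<in> cadlag T \<Longrightarrow> t \<ge> 0 \<Longrightarrow> w t \<in> topspace T"
  by (auto simp: cadlag_def)

lemma S_eq: "x \<in> topspace T \<Longrightarrow> S t f x = (\<integral>w. f (w t) \<partial>P x)"
  by (simp add: semigroup_of_def)

lemma S_off: "x \<notin> topspace T \<Longrightarrow> S t f x = 0"
  by (simp add: semigroup_of_def)

lemma S_integrable:
  assumes "bounded_measurable T f" "x \<in> topspace T" "t \<ge> 0"
  shows "integrable (P x) (\<lambda>w. f (w t))"
proof -
  interpret prob_space "P x" by (rule P_prob[OF assms(2)])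
  obtain C where C: "\<And>y. y \<in> topspace T \<Longrightarrow> \<bar>f y\<bar> \<le> C"
    using assms by (auto simp: bounded_measurable_def)
  have m: "(\<lambda>w. f (w t)) \<in> borel_measurable (P x)"
    using measurable_compose[OF eval_measurable[OF assms(2,3)]] assms(1)
    by (auto simp: bounded_measurable_def)
  show ?thesis
    by (rule integrable_const_bound[OF _ m, where B=C])
       (use C P_space[OF assms(2)] eval_in assms(3) in \<open>auto intro!: AE_I2\<close>)
qed

lemma S_linear:
  assumes "bounded_measurable T f" "bounded_measurable T g" "t \<ge> 0"
  shows "S t (\<lambda>y. a * f y + b * g y) x = a * S t f x + b * S t g x"
  using S_integrable[OF assms(1) _ assms(3)] S_integrable[OF assms(2) _ assms(3)]
  by (cases "x \<in> topspace T") (auto simp: S_eq S_off)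

lemma S_diff:
  assumes "bounded_measurable T f" "bounded_measurable T g" "t \<ge> 0"
  shows "S t (\<lambda>y. f y - g y) x = S t f x - S t g x"
  using S_linear[OF assms, of 1 "-1"] by simp

lemma S_mono:
  assumes "bounded_measurable T f" "bounded_measurable T g" "t \<ge> 0"
    and "\<And>y. y \<in> topspace T \<Longrightarrow> f y \<le> g y"
  shows "S t f x \<le> S t g x"
proof (cases "x \<in> topspace T")
  case True
  then show ?thesis
    unfolding S_eq[OF True]
    by (intro integral_mono S_integrable assms) (use assms(3,4) P_space eval_in in auto)
qed (simp add: S_off)

lemma S_const: "x \<in> topspace T \<Longrightarrow> S t (\<lambda>_. c) x = c"
  using prob_space.prob_space[OF P_prob] by (simp add: S_eq)

lemma S_cong:
  assumes "\<And>y. y \<in> topspace T \<Longrightarrow> f y = g y" "t \<ge> 0"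
  shows "S t f x = S t g x"
proof (cases "x \<in> topspace T")
  case True
  then show ?thesis
    unfolding S_eq[OF True]
    by (intro Bochner_Integration.integral_cong) (use assms P_space eval_in in auto)
qed (simp add: S_off)

lemma S_le:
  assumes "bounded_measurable T f" "t \<ge> 0" "x \<in> topspace T" "\<And>y. y \<in> topspace T \<Longrightarrow> f y \<le> c"
  shows "S t f x \<le> c"
  using S_mono[OF assms(1) bounded_measurable_const assms(2) assms(4), of x] S_const[OF assms(3)] by simp

lemma S_ge:
  assumes "bounded_measurable T f" "t \<ge> 0" "x \<in> topspace T" "\<And>y. y \<in> topspace T \<Longrightarrow> c \<le> f y"
  shows "c \<le> S t f x"
  using S_mono[OF bounded_measurable_const assms(1) assms(2) assms(4), of x] S_const[OF assms(3)] by simp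

lemma S_abs_le:
  assumes "bounded_measurable T f" "t \<ge> 0" "x \<in> topspace T" "\<And>y. y \<in> topspace T \<Longrightarrow> \<bar>f y\<bar> \<le> c"
  shows "\<bar>S t f x\<bar> \<le> c"
  using S_le[OF assms(1-3), of c] S_ge[OF assms(1-3), of "-c"] assms(4) by (auto simp: abs_le_iff) force+

lemma S_0:
  assumes "bounded_measurable T f" "x \<in> topspace T"
  shows "S 0 f x = f x"
proof -
  interpret prob_space "P x" by (rule P_prob[OF assms(2)])
  have "AE w in P x. w 0 = x" using markov assms(2) by (auto simp: markov_process_def)
  then have "AE w in P x. f (w 0) = f x" by eventually_elim simp
  then have "(\<integral>w. f (w 0) \<partial>P x) = (\<integral>w. f x \<partial>P x)"
    using S_integrable[OF assms, of 0] by (intro integral_cong_AE) auto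
  then show ?thesis using assms by (simp add: S_eq prob_space)
qed

lemma S_bounded_measurable:
  assumes "bounded_measurable T f" "t \<ge> 0"
  shows "bounded_measurable T (S t f)"
proof -
  obtain C where C: "\<And>y. y \<in> topspace T \<Longrightarrow> \<bar>f y\<bar> \<le> C"
    using assms by (auto simp: bounded_measurable_def)
  have "f \<in> borel_measurable (borel_of T)" using assms(1) by (simp add: bounded_measurable_def)
  then have "(\<lambda>w. f (w t)) \<in> borel_measurable (path_space T)"
    by (rule measurable_compose[OF eval_path_measurable[OF assms(2)]])
  then have "(\<lambda>x. \<integral>w. f (w t) \<partial>P x) \<in> borel_measurable (borel_of T)"
    by (intro measurable_compose[OF measurable_prob_algebraD[OF P_measurable]]
        integral_measurable_subprob_algebra)
  then have "S t f \<in> borel_measurable (borel_of T)"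
    by (rule measurable_cong[THEN iffD1, rotated]) (simp add: S_eq)
  then show ?thesis
    using S_abs_le[OF assms _ C] unfolding bounded_measurable_def by blast
qed

lemma S_B_b:
  assumes "f \<in> B_b T" "t \<ge> 0"
  shows "S t f \<in> B_b T"
proof -
  have b: "bounded_measurable T (S t f)"
    using S_bounded_measurable[OF bounded_measurable_B_b[OF assms(1)] assms(2)] .
  then obtain C where C: "\<And>x. x \<in> topspace T \<Longrightarrow> \<bar>S t f x\<bar> \<le> C"
    by (auto simp: bounded_measurable_def)
  have "\<bar>S t f x\<bar> \<le> max C 0" for x
    using C[of x] by (cases "x \<in> topspace T") (auto simp: S_off)
  then show ?thesis
    using b by (auto simp: B_b_def bounded_measurable_def bounded_range_real_iff vanishes_off_def S_off)
qed

text \<open>The Markov property tested against a bounded function of the past. With the past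
  function 1 it becomes the semigroup property, with a product of evaluations the recursion for
  finite-dimensional distributions; conditional expectations do not occur after this point.\<close>

lemma markov_integral:
  assumes x: "x \<in> topspace T" and s: "s \<ge> 0" "t \<ge> 0" and f: "f \<in> B_b T"
    and g: "g \<in> borel_measurable (filtration T s)" "\<And>w. \<bar>g w\<bar> \<le> C"
  shows "(\<integral>w. g w * f (w (s + t)) \<partial>P x) = (\<integral>w. g w * S t f (w s) \<partial>P x)"
proof -
  interpret prob_space "P x" by (rule P_prob[OF x])
  have sub: "subalgebra (P x) (filtration T s)"
    using sets_filtration_subset P_sets[OF x] P_space[OF x]
    by (simp add: subalgebra_def space_filtration)
  interpret finite_measure_subalgebra "P x" "filtration T s"
    by unfold_locales (rule sub)
  have fm: "integrable (P x) (\<lambda>w. f (w (s + t)))"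
    using S_integrable[OF bounded_measurable_B_b[OF f] x, of "s + t"] s by simp
  have gm: "g \<in> borel_measurable (P x)" by (rule measurable_from_subalg[OF sub g(1)])
  have "integrable (P x) (\<lambda>w. g w * f (w (s + t)))"
  proof (rule Bochner_Integration.integrable_bound[OF integrable_mult_right[OF fm, of C]])
    show "AE w in P x. norm (g w * f (w (s + t))) \<le> norm (C * f (w (s + t)))"
    proof (rule AE_I2)
      fix w show "norm (g w * f (w (s + t))) \<le> norm (C * f (w (s + t)))"
        using g(2)[of w] unfolding real_norm_def abs_mult by (intro mult_right_mono) auto
    qed
  qed (use fm gm in simp)
  from real_cond_exp_intg(2)[OF this g(1)] fm
  have "(\<integral>w. g w * f (w (s + t)) \<partial>P x)
      = (\<integral>w. g w * real_cond_exp (P x) (filtration T s) (\<lambda>w. f (w (s + t))) w \<partial>P x)" by simp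
  also have "\<dots> = (\<integral>w. g w * S t f (w s) \<partial>P x)"
  proof (rule integral_cong_AE)
    have "AE w in P x. real_cond_exp (P x) (filtration T s) (\<lambda>w. f (w (s + t))) w = S t f (w s)"
      using markov x s f unfolding markov_process_def by blast
    then show "AE w in P x. g w * real_cond_exp (P x) (filtration T s) (\<lambda>w. f (w (s + t))) w = g w * S t f (w s)"
      by eventually_elim simp
    show "(\<lambda>w. g w * S t f (w s)) \<in> borel_measurable (P x)"
      using gm S_integrable[OF bounded_measurable_B_b[OF S_B_b[OF f s(2)]] x s(1)] by simp
  qed (use gm in simp)
  finally show ?thesis .
qed

lemma S_add:
  assumes "f \<in> B_b T" "s \<ge> 0" "t \<ge> 0"
  shows "S (s + t) f x = S s (S t f) x"
proof (cases "x \<in> topspace T")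
  case True
  show ?thesis
    using markov_integral[OF True assms(2,3,1), of "\<lambda>_. 1" 1] by (simp add: S_eq[OF True])
qed (simp add: S_off)

end

section \<open>The maximum principle for Feller semigroups\<close>

text \<open>The time axis is the closed half-line, so that continuity at time 0 is included and
  maxima over [0, t0] times a compact set exist.\<close>

definition jointly_continuous :: "'a topology \<Rightarrow> (real \<Rightarrow> 'a \<Rightarrow> real) \<Rightarrow> bool" where
  "jointly_continuous T v \<longleftrightarrow>
     continuous_map (prod_topology (top_of_set {0::real..}) T) euclideanreal (\<lambda>(t, x). v t x)"

lemma jointly_continuousI:
  assumes "\<And>t x e. t \<ge> 0 \<Longrightarrow> x \<in> topspace T \<Longrightarrow> e > 0 \<Longrightarrow>
    \<exists>\<delta>>0. \<exists>U. openin T U \<and> x \<in> U \<and> (\<forall>s\<ge>0. \<forall>y\<in>U. \<bar>s - t\<bar> < \<delta> \<longrightarrow> \<bar>v s y - v t x\<bar> < e)"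
  shows "jointly_continuous T v"
  unfolding jointly_continuous_def continuous_map_real_iff
proof (intro ballI allI impI)
  fix z and e :: real assume z: "z \<in> topspace (prod_topology (top_of_set {0::real..}) T)" and e: "e > 0"
  then obtain t x where tx: "z = (t, x)" "t \<ge> 0" "x \<in> topspace T" by auto
  then obtain \<delta> U where U: "\<delta> > 0" "openin T U" "x \<in> U"
    "\<And>s y. s \<ge> 0 \<Longrightarrow> y \<in> U \<Longrightarrow> \<bar>s - t\<bar> < \<delta> \<Longrightarrow> \<bar>v s y - v t x\<bar> < e"
    using assms[OF tx(2,3) e] by blast
  have "openin (prod_topology (top_of_set {0::real..}) T) (({0..} \<inter> ball t \<delta>) \<times> U)"
    using U(2) by (simp add: openin_prod_Times_iff openin_open_Int)
  moreover have "z \<in> ({0..} \<inter> ball t \<delta>) \<times> U" using tx U by auto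
  moreover have "\<forall>y\<in>({0..} \<inter> ball t \<delta>) \<times> U.
      \<bar>(case y of (t, x) \<Rightarrow> v t x) - (case z of (t, x) \<Rightarrow> v t x)\<bar> < e"
    using U(4) tx(1) by (auto simp: dist_real_def abs_minus_commute)
  ultimately show "\<exists>V. openin (prod_topology (top_of_set {0::real..}) T) V \<and> z \<in> V \<and>
      (\<forall>y\<in>V. \<bar>(case y of (t, x) \<Rightarrow> v t x) - (case z of (t, x) \<Rightarrow> v t x)\<bar> < e)"
    by blast
qed

lemma jointly_continuousD:
  fixes t e :: real
  assumes "jointly_continuous T v" "t \<ge> 0" "x \<in> topspace T" "e > 0"
  obtains \<delta> U where "\<delta> > 0" "openin T U" "x \<in> U"
    "\<And>s y. s \<ge> 0 \<Longrightarrow> y \<in> U \<Longrightarrow> \<bar>s - t\<bar> < \<delta> \<Longrightarrow> \<bar>v s y - v t x\<bar> < e"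
proof -
  have "(t, x) \<in> topspace (prod_topology (top_of_set {0::real..}) T)" using assms by simp
  from assms(1)[unfolded jointly_continuous_def continuous_map_real_iff, THEN bspec, OF this,
      THEN spec, THEN mp, OF assms(4)]
  obtain V where V: "openin (prod_topology (top_of_set {0::real..}) T) V" "(t, x) \<in> V"
    and close: "\<forall>y\<in>V. \<bar>(case y of (t, x) \<Rightarrow> v t x) - (case (t, x) of (t, x) \<Rightarrow> v t x)\<bar> < e"
    by blast
  obtain W U where W: "openin (top_of_set {0::real..}) W" "openin T U" "t \<in> W" "x \<in> U" "W \<times> U \<subseteq> V"
    using V(1)[unfolded openin_prod_topology_alt, rule_format, OF V(2)] by auto
  then obtain W' where W': "open W'" "W = {0..} \<inter> W'" by (auto simp: openin_open)
  then obtain \<delta> where d: "\<delta> > 0" "ball t \<delta> \<subseteq> W'" using W(3) openE[of W' t] by blast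
  show ?thesis
  proof
    fix s y assume sy: "s \<ge> 0" "y \<in> U" "\<bar>s - t\<bar> < \<delta>"
    then have "s \<in> W" using d W' by (auto simp: dist_real_def abs_minus_commute subset_eq)
    then have "(s, y) \<in> V" using W(5) sy(2) by auto
    from bspec[OF close this] show "\<bar>v s y - v t x\<bar> < e" by simp
  qed (use d W in auto)
qed

lemma jointly_continuous_const: "jointly_continuous T (\<lambda>_ _. c)"
  unfolding jointly_continuous_def by (simp add: case_prod_unfold)

lemma jointly_continuous_time: "jointly_continuous T (\<lambda>t _. t)"
  by (rule jointly_continuousI) (metis openin_topspace)

lemma jointly_continuous_space:
  assumes "continuous_map T euclideanreal f"
  shows "jointly_continuous T (\<lambda>_. f)"
proof (rule jointly_continuousI)
  fix t :: real and x and e :: real assume "x \<in> topspace T" "e > 0"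
  then obtain U where "openin T U" "x \<in> U" "\<forall>y\<in>U. \<bar>f y - f x\<bar> < e"
    using assms unfolding continuous_map_real_iff by blast
  then show "\<exists>\<delta>>0. \<exists>U. openin T U \<and> x \<in> U \<and> (\<forall>s\<ge>0. \<forall>y\<in>U. \<bar>s - t\<bar> < \<delta> \<longrightarrow> \<bar>f y - f x\<bar> < e)"
    by (intro exI[of _ "1::real"] conjI exI[of _ U]) auto
qed

lemma jointly_continuous_diff:
  "jointly_continuous T u \<Longrightarrow> jointly_continuous T v \<Longrightarrow> jointly_continuous T (\<lambda>t x. u t x - v t x)"
  unfolding jointly_continuous_def case_prod_unfold by (rule continuous_map_diff)

lemma jointly_continuous_add:
  "jointly_continuous T u \<Longrightarrow> jointly_continuous T v \<Longrightarrow> jointly_continuous T (\<lambda>t x. u t x + v t x)"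
  unfolding jointly_continuous_def case_prod_unfold by (rule continuous_map_add)

lemma jointly_continuous_mult:
  "jointly_continuous T u \<Longrightarrow> jointly_continuous T v \<Longrightarrow> jointly_continuous T (\<lambda>t x. u t x * v t x)"
  unfolding jointly_continuous_def case_prod_unfold by (rule continuous_map_real_mult)

lemma jointly_continuous_slice:
  assumes "jointly_continuous T v" "t \<ge> 0"
  shows "continuous_map T euclideanreal (v t)"
  unfolding continuous_map_real_iff
proof (intro ballI allI impI)
  fix x and e :: real assume "x \<in> topspace T" "e > 0"
  then obtain \<delta> U where "\<delta> > 0" "openin T U" "x \<in> U"
    "\<And>s y. s \<ge> 0 \<Longrightarrow> y \<in> U \<Longrightarrow> \<bar>s - t\<bar> < \<delta> \<Longrightarrow> \<bar>v s y - v t x\<bar> < e"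
    using jointly_continuousD[OF assms] by metis
  then show "\<exists>U. openin T U \<and> x \<in> U \<and> (\<forall>y\<in>U. \<bar>v t y - v t x\<bar> < e)"
    using assms(2) by (intro exI[of _ U]) auto
qed

lemma jointly_continuous_attains_sup:
  assumes v: "jointly_continuous T v" and L: "compactin T L" "L \<noteq> {}" and "t0 \<ge> 0"
  obtains t x where "0 \<le> t" "t \<le> t0" "x \<in> L" "\<And>s y. 0 \<le> s \<Longrightarrow> s \<le> t0 \<Longrightarrow> y \<in> L \<Longrightarrow> v s y \<le> v t x"
proof -
  let ?K = "{0..t0} \<times> L"
  have "compactin (prod_topology (top_of_set {0::real..}) T) ?K"
    using L by (auto simp: compactin_Times compactin_subtopology)
  then have "compact ((\<lambda>(t, x). v t x) ` ?K)"
    using image_compactin[OF _ v[unfolded jointly_continuous_def]] by simp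
  moreover have "(\<lambda>(t, x). v t x) ` ?K \<noteq> {}" using L assms(4) by auto
  ultimately obtain m where "m \<in> (\<lambda>(t, x). v t x) ` ?K" "\<And>z. z \<in> (\<lambda>(t, x). v t x) ` ?K \<Longrightarrow> z \<le> m"
    using compact_attains_sup by metis
  then show ?thesis using that by force
qed

text \<open>The analysis of one semigroup, separated from the smooth structure; test functions
  return in \<open>product_process\<close>. Applied to each factor and to the product.\<close>

locale feller_semigroup = markov_semigroup +
  assumes metrizable: "metrizable_space T" and loc_compact: "locally_compact_space T"
    and sig_compact: "sigma_compact T"
    and S_C_0: "\<And>t f. t \<ge> 0 \<Longrightarrow> f \<in> C_0 T \<Longrightarrow> S t f \<in> C_0 T"
    and S_limit: "\<And>f. f \<in> C_0 T \<Longrightarrow> uniform_limit (topspace T) (\<lambda>t. S t f) f (at_right 0)"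
begin

lemma C_0_B_b: "f \<in> C_0 T \<Longrightarrow> f \<in> B_b T"
  using C_0_subset_C_b C_b_subset_B_b by blast

lemma S_small:
  assumes f: "f \<in> C_0 T" and e: "e > 0"
  obtains \<delta> where "\<delta> > 0" "\<And>h x. 0 \<le> h \<Longrightarrow> h \<le> \<delta> \<Longrightarrow> x \<in> topspace T \<Longrightarrow> \<bar>S h f x - f x\<bar> < e"
proof -
  have "\<forall>\<^sub>F h in at_right 0. \<forall>x\<in>topspace T. dist (S h f x) (f x) < e"
    using S_limit[OF f] e by (simp add: uniform_limit_iff)
  then obtain b where b: "b > 0" "\<And>h. 0 < h \<Longrightarrow> h < b \<Longrightarrow> \<forall>x\<in>topspace T. \<bar>S h f x - f x\<bar> < e"
    unfolding eventually_at_right_field dist_real_def by auto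
  show ?thesis
  proof (rule that[of "b/2"])
    fix h :: real and x assume hx: "0 \<le> h" "h \<le> b/2" "x \<in> topspace T"
    show "\<bar>S h f x - f x\<bar> < e"
    proof (cases "h = 0")
      case True
      then show ?thesis using S_0[OF bounded_measurable_C_0[OF f] hx(3)] e by simp
    next
      case False
      then show ?thesis using b(2)[of h] hx b(1) by auto
    qed
  qed (use b in auto)
qed

text \<open>\<open>S s\<close> is a contraction and the increment from s to s + h is
  \<open>S s\<close> applied to the increment at time 0. Hence the modulus of continuity at 0 holds
  at every time and at every point.\<close>

lemma S_time_increment:
  assumes f: "f \<in> C_0 T" and "0 \<le> s" "0 \<le> h" "x \<in> topspace T"
    and e: "\<And>y. y \<in> topspace T \<Longrightarrow> \<bar>S h f y - f y\<bar> \<le> e"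
  shows "\<bar>S (s + h) f x - S s f x\<bar> \<le> e"
proof -
  have bf: "bounded_measurable T f" and bS: "bounded_measurable T (S h f)"
    using f S_bounded_measurable assms(3) bounded_measurable_C_0 by auto
  have "S (s + h) f x - S s f x = S s (\<lambda>y. S h f y - f y) x"
    using S_add[OF C_0_B_b[OF f] assms(2,3)] S_diff[OF bS bf assms(2)] by simp
  also have "\<bar>\<dots>\<bar> \<le> e"
    by (rule S_abs_le) (use assms bounded_measurable_linear[OF bS bf, of 1 "-1"] in auto)
  finally show ?thesis .
qed

text \<open>The modulus in time is uniform over the space, so it may be combined with the spatial
  continuity of the single function \<open>S t f\<close>.\<close>

lemma S_jointly_continuous_C_0:
  assumes f: "f \<in> C_0 T"
  shows "jointly_continuous T (\<lambda>t. S t f)"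
proof (rule jointly_continuousI)
  fix t :: real and x and e :: real assume t: "t \<ge> 0" and x: "x \<in> topspace T" and e: "e > 0"
  obtain \<delta> where d: "\<delta> > 0" "\<And>h x. 0 \<le> h \<Longrightarrow> h \<le> \<delta> \<Longrightarrow> x \<in> topspace T \<Longrightarrow> \<bar>S h f x - f x\<bar> < e/2"
    using S_small[OF f, of "e/2"] e by auto
  have "continuous_map T euclideanreal (S t f)" using S_C_0[OF t f] by (simp add: C_0_def)
  then obtain U where U: "openin T U" "x \<in> U" "\<And>y. y \<in> U \<Longrightarrow> \<bar>S t f y - S t f x\<bar> < e/2"
    using x e unfolding continuous_map_real_iff by (meson half_gt_zero)
  have "\<bar>S s f y - S t f x\<bar> < e" if "s \<ge> 0" "y \<in> U" "\<bar>s - t\<bar> < \<delta>" for s :: real and y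
  proof -
    have y: "y \<in> topspace T" using U(1) that(2) openin_subset by blast
    have "\<bar>S s f y - S t f y\<bar> \<le> e/2"
    proof (cases "t \<le> s")
      case True
      have "\<bar>S (t + (s - t)) f y - S t f y\<bar> \<le> e/2"
        by (rule S_time_increment[OF f t _ y less_imp_le[OF d(2)]]) (use True that in auto)
      then show ?thesis by simp
    next
      case False
      have "\<bar>S (s + (t - s)) f y - S s f y\<bar> \<le> e/2"
        by (rule S_time_increment[OF f that(1) _ y less_imp_le[OF d(2)]]) (use False that in auto)
      then show ?thesis by (simp add: abs_minus_commute)
    qed
    then show ?thesis using U(3)[OF that(2)] by linarith
  qed
  then show "\<exists>\<delta>>0. \<exists>U. openin T U \<and> x \<in> U \<and> (\<forall>s\<ge>0. \<forall>y\<in>U. \<bar>s - t\<bar> < \<delta> \<longrightarrow> \<bar>S s f y - S t f x\<bar> < e)"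
    using U d by blast
qed

text \<open>Tightness of the law of the process at time t: cutoffs increase their mass to the total
  mass, which is 1. Both joint continuity on \<open>C_b\<close> and the barrier of the maximum
  principle start from this function.\<close>

lemma S_cutoff:
  assumes x: "x \<in> topspace T" and t: "t \<ge> 0" and e: "e > 0"
  obtains \<eta> where "\<eta> \<in> C_0 T" "\<And>x. 0 \<le> \<eta> x" "\<And>x. \<eta> x \<le> 1" "1 - S t \<eta> x < e"
proof -
  interpret prob_space "P x" by (rule P_prob[OF x])
  obtain \<eta> :: "nat \<Rightarrow> 'a \<Rightarrow> real" where \<eta>: "\<And>n. \<eta> n \<in> C_0 T" "\<And>n x. 0 \<le> \<eta> n x" "\<And>n x. \<eta> n x \<le> 1"
    "\<And>x. x \<in> topspace T \<Longrightarrow> (\<lambda>n. \<eta> n x) \<longlonglongrightarrow> 1"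
    using C_0_cutoff_sequence[OF metrizable loc_compact sig_compact] by metis
  have "(\<lambda>n. \<integral>w. \<eta> n (w t) \<partial>P x) \<longlonglongrightarrow> (\<integral>w. 1 \<partial>P x)"
  proof (rule integral_dominated_convergence[where w="\<lambda>_. 1"])
    show "(\<lambda>w. \<eta> n (w t)) \<in> borel_measurable (P x)" for n
      using S_integrable[OF bounded_measurable_C_0[OF \<eta>(1)] x t] by auto
  qed (use \<eta> P_space[OF x] eval_in t in \<open>auto intro!: AE_I2\<close>)
  then have "(\<lambda>n. S t (\<eta> n) x) \<longlonglongrightarrow> 1" by (simp add: S_eq[OF x] prob_space)
  then obtain n where "S t (\<eta> n) x > 1 - e"
    using order_tendstoD(1)[of _ 1 sequentially "1 - e"] e
    by (metis eventually_happens trivial_limit_sequentially diff_less_eq less_add_same_cancel1)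
  then show ?thesis using that[of "\<eta> n"] \<eta> by auto
qed

lemma S_jointly_continuous:
  assumes f: "f \<in> C_b T"
  shows "jointly_continuous T (\<lambda>t. S t f)"
proof (rule jointly_continuousI)
  fix t :: real and x and e :: real assume t: "t \<ge> 0" and x: "x \<in> topspace T" and e: "e > 0"
  obtain C where C: "\<And>x. \<bar>f x\<bar> \<le> C" using f by (auto simp: C_b_def bounded_range_real_iff)
  have C0: "C \<ge> 0" using C[of x] by linarith
  \<comment> \<open>The remainder costs 2 C r at a nearby point and C r at (t, x) itself; with this
    \<open>r\<close> the sum stays below e/2.\<close>
  define r where "r = e / (6 * (C + 1))"
  have r: "r > 0" "3 * C * r < e / 2" using e C0 by (auto simp: r_def field_simps)
  obtain \<eta> where \<eta>: "\<eta> \<in> C_0 T" "\<And>x. 0 \<le> \<eta> x" "\<And>x. \<eta> x \<le> 1" "1 - S t \<eta> x < r"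
    using S_cutoff[OF x t r(1)] by metis
  define g where "g y = \<eta> y * f y" for y
  have g: "g \<in> C_0 T" unfolding g_def by (rule C_0_mult[OF \<eta>(1) f])
  obtain \<delta>1 U1 where 1: "\<delta>1 > 0" "openin T U1" "x \<in> U1"
    "\<And>s y. s \<ge> 0 \<Longrightarrow> y \<in> U1 \<Longrightarrow> \<bar>s - t\<bar> < \<delta>1 \<Longrightarrow> \<bar>S s \<eta> y - S t \<eta> x\<bar> < r"
    using jointly_continuousD[OF S_jointly_continuous_C_0[OF \<eta>(1)] t x r(1)] by metis
  obtain \<delta>2 U2 where 2: "\<delta>2 > 0" "openin T U2" "x \<in> U2"
    "\<And>s y. s \<ge> 0 \<Longrightarrow> y \<in> U2 \<Longrightarrow> \<bar>s - t\<bar> < \<delta>2 \<Longrightarrow> \<bar>S s g y - S t g x\<bar> < e/2"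
    using jointly_continuousD[OF S_jointly_continuous_C_0[OF g] t x, of "e/2"] e by auto
  have close: "\<bar>S s f y - S s g y\<bar> \<le> C * (1 - S s \<eta> y)" if "s \<ge> 0" "y \<in> topspace T" for s :: real and y
  proof -
    have b: "bounded_measurable T f" "bounded_measurable T g" "bounded_measurable T \<eta>"
      using f g \<eta>(1) bounded_measurable_C_0 bounded_measurable_C_b by auto
    have bd: "bounded_measurable T (\<lambda>y. f y - g y)" "bounded_measurable T (\<lambda>y. C - C * \<eta> y)"
      using bounded_measurable_linear[OF b(1,2), of 1 "-1"]
        bounded_measurable_linear[OF bounded_measurable_const[of T C] b(3), of 1 "-C"] by auto
    have n: "\<bar>f z - g z\<bar> \<le> C - C * \<eta> z" for z
    proof -
      have "f z - g z = f z * (1 - \<eta> z)" by (simp add: g_def algebra_simps)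
      also have "\<bar>\<dots>\<bar> \<le> C * (1 - \<eta> z)"
        unfolding abs_mult using C[of z] \<eta>(3)[of z] by (intro mult_mono) auto
      finally show ?thesis by (simp add: algebra_simps)
    qed
    have m: "S s (\<lambda>y. C - C * \<eta> y) y = C - C * S s \<eta> y"
      using S_linear[OF bounded_measurable_const[of T C] b(3) that(1), of 1 "-C" y] S_const[OF that(2), of s C] by simp
    have "S s (\<lambda>y. f y - g y) y \<le> S s (\<lambda>y. C - C * \<eta> y) y"
      by (rule S_mono[OF bd that(1)]) (use n abs_le_D1 in blast)
    moreover have "S s (\<lambda>y. 0 - (f y - g y)) y \<le> S s (\<lambda>y. C - C * \<eta> y) y"
    proof (rule S_mono[OF _ bd(2) that(1)])
      show "bounded_measurable T (\<lambda>y. 0 - (f y - g y))"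
        using bounded_measurable_linear[OF bd(1) bd(1), of "-1" 0] by simp
      show "0 - (f y - g y) \<le> C - C * \<eta> y" for y using n[of y] by linarith
    qed
    moreover have "S s (\<lambda>y. f y - g y) y = S s f y - S s g y"
      by (rule S_diff[OF b(1,2) that(1)])
    moreover have "S s (\<lambda>y. 0 - (f y - g y)) y = - (S s f y - S s g y)"
      using S_linear[OF b(1,2) that(1), of "-1" 1 y] by simp
    ultimately show ?thesis using m by (simp add: abs_le_iff algebra_simps)
  qed
  have "\<bar>S s f y - S t f x\<bar> < e" if "s \<ge> 0" "y \<in> U1 \<inter> U2" "\<bar>s - t\<bar> < min \<delta>1 \<delta>2" for s :: real and y
  proof -
    have y: "y \<in> topspace T" using 1(2) that(2) openin_subset by blast
    have "1 - S s \<eta> y \<le> 2 * r" using 1(4)[of s y] \<eta>(4) that by auto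
    then have "C * (1 - S s \<eta> y) \<le> C * (2 * r)" using C0 by (rule mult_left_mono)
    then have a: "\<bar>S s f y - S s g y\<bar> \<le> C * (2 * r)" using close[OF that(1) y] by linarith
    have "C * (1 - S t \<eta> x) \<le> C * r" using C0 \<eta>(4) by (intro mult_left_mono) auto
    then have b: "\<bar>S t f x - S t g x\<bar> \<le> C * r" using close[OF t x] by linarith
    have c: "\<bar>S s g y - S t g x\<bar> < e/2" using 2(4)[of s y] that by auto
    have "C * (2 * r) + C * r < e/2" using r(2) by simp
    then show ?thesis using a b c by linarith
  qed
  then show "\<exists>\<delta>>0. \<exists>U. openin T U \<and> x \<in> U \<and> (\<forall>s\<ge>0. \<forall>y\<in>U. \<bar>s - t\<bar> < \<delta> \<longrightarrow> \<bar>S s f y - S t f x\<bar> < e)"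
    using 1 2 by (intro exI[of _ "min \<delta>1 \<delta>2"] conjI exI[of _ "U1 \<inter> U2"]) auto
qed

lemma S_C_b:
  assumes f: "f \<in> C_b T" and t: "t \<ge> 0"
  shows "S t f \<in> C_b T"
proof -
  have "S t f \<in> B_b T" using S_B_b f C_b_subset_B_b t by blast
  then show ?thesis
    using jointly_continuous_slice[OF S_jointly_continuous[OF f] t]
    by (auto simp: B_b_def C_b_def)
qed

text \<open>On a finite time grid the compact sets of the functions
  \<open>S (n * \<delta>) f\<close> are united. Between grid points the function moves by at most
  e/2, uniformly in space, so the rounded-down time decides.\<close>

lemma S_vanishes_uniformly:
  fixes t0 :: real
  assumes f: "f \<in> C_0 T" and "e > 0"
  obtains K where "compactin T K"
    "\<And>t x. 0 \<le> t \<Longrightarrow> t \<le> t0 \<Longrightarrow> x \<in> topspace T \<Longrightarrow> x \<notin> K \<Longrightarrow> \<bar>S t f x\<bar> < e"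
proof -
  obtain \<delta> where d: "\<delta> > 0" "\<And>h x. 0 \<le> h \<Longrightarrow> h \<le> \<delta> \<Longrightarrow> x \<in> topspace T \<Longrightarrow> \<bar>S h f x - f x\<bar> < e/2"
    using S_small[OF f, of "e/2"] assms(2) by auto
  have "\<exists>K. compactin T K \<and> (\<forall>x\<in>topspace T - K. \<bar>S (real n * \<delta>) f x\<bar> < e/2)" for n
  proof -
    have "S (real n * \<delta>) f \<in> C_0 T" "e/2 > 0" using S_C_0[OF _ f] d(1) assms(2) by auto
    then obtain K where "compactin T K" "\<And>x. x \<in> topspace T \<Longrightarrow> x \<notin> K \<Longrightarrow> \<bar>S (real n * \<delta>) f x\<bar> < e/2"
      using C_0_small_off_compact by blast
    then show ?thesis by (intro exI[of _ K]) auto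
  qed
  then obtain K where K: "\<And>n. compactin T (K n)"
    "\<And>n x. x \<in> topspace T - K n \<Longrightarrow> \<bar>S (real n * \<delta>) f x\<bar> < e/2" by metis
  define N where "N = nat \<lceil>t0 / \<delta>\<rceil>"
  show ?thesis
  proof
    show "compactin T (\<Union>n\<le>N. K n)" using K(1) by (intro compactin_Union) auto
    fix t :: real and x assume t: "0 \<le> t" "t \<le> t0" and x: "x \<in> topspace T" "x \<notin> (\<Union>n\<le>N. K n)"
    define n where "n = nat \<lfloor>t / \<delta>\<rfloor>"
    have n: "real n \<le> t / \<delta>" "t / \<delta> \<le> real n + 1"
      using t d(1) by (auto simp: n_def)
    have "t / \<delta> \<le> t0 / \<delta>" using t d(1) by (simp add: divide_right_mono)
    then have nN: "n \<le> N" using n(1) unfolding N_def by linarith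
    have nd: "0 \<le> t - real n * \<delta>" "t - real n * \<delta> \<le> \<delta>"
      using n d(1) by (auto simp: field_simps)
    have "\<bar>S (real n * \<delta> + (t - real n * \<delta>)) f x - S (real n * \<delta>) f x\<bar> \<le> e/2"
      by (rule S_time_increment[OF f _ nd(1) x(1) less_imp_le[OF d(2)]]) (use nd d(1) in auto)
    moreover have "\<bar>S (real n * \<delta>) f x\<bar> < e/2" using K(2)[of x n] x nN by auto
    moreover have "real n * \<delta> + (t - real n * \<delta>) = t" by simp
    ultimately show "\<bar>S t f x\<bar> < e" by (simp only:)
  qed
qed

text \<open>The barrier \<open>1 - S t \<eta>\<close> solves the evolution equation, is close to 1 at infinity and small at a
  given point; subtracting a multiple of it forces the supremum to be attained.\<close>

lemma maximum_principle:
  assumes v: "jointly_continuous T v" "\<And>t x. 0 \<le> t \<Longrightarrow> t \<le> t0 \<Longrightarrow> x \<in> topspace T \<Longrightarrow> \<bar>v t x\<bar> \<le> C"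
    and init: "\<And>x. x \<in> topspace T \<Longrightarrow> v 0 x \<le> 0"
    and sub: "\<And>t x e. 0 < t \<Longrightarrow> t \<le> t0 \<Longrightarrow> x \<in> topspace T \<Longrightarrow> e > 0 \<Longrightarrow>
      \<forall>\<^sub>F h in at_right 0. v t x \<le> S h (v (t - h)) x + e * h"
    and t1: "0 \<le> t1" "t1 \<le> t0" and x1: "x1 \<in> topspace T"
  shows "v t1 x1 \<le> 0"
proof (rule ccontr)
  assume "\<not> v t1 x1 \<le> 0"
  then have a: "v t1 x1 > 0" by simp
  \<comment> \<open>The surplus 1 over the bound of \<open>v\<close> makes the barrier win at
    infinity: where \<open>S t \<eta>\<close> is below 1/(2 D), the penalized function is at most (D
    - 1) - D + 1/2, hence negative.\<close>
  define D where "D = C + 1"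
  have D: "D \<ge> 1" using v(2)[OF t1 x1] by (auto simp: D_def)
  \<comment> \<open>The drift and the barrier each take at most a quarter of \<open>v t1 x1\<close>,
    so the penalized function \<open>z\<close> remains positive at that point.\<close>
  define \<epsilon> where "\<epsilon> = v t1 x1 / (4 * (t1 + 1))"
  have eps: "\<epsilon> > 0" "\<epsilon> * t1 \<le> v t1 x1 / 4"
    using a t1 by (auto simp: \<epsilon>_def field_simps)
  obtain \<eta> where \<eta>: "\<eta> \<in> C_0 T" "\<And>x. 0 \<le> \<eta> x" "\<And>x. \<eta> x \<le> 1" "1 - S t1 \<eta> x1 < v t1 x1 / (4 * D)"
    using S_cutoff[OF x1 t1(1), of "v t1 x1 / (4 * D)"] a D by (auto simp: divide_pos_pos)
  have \<eta>b: "bounded_measurable T \<eta>" using \<eta>(1) by (rule bounded_measurable_C_0)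
  define z where "z t x = v t x - D * (1 - S t \<eta> x) - \<epsilon> * t" for t x
  have "D * (1 - S t1 \<eta> x1) \<le> v t1 x1 / 4"
  proof -
    have "D * (1 - S t1 \<eta> x1) \<le> D * (v t1 x1 / (4 * D))" using \<eta>(4) D by (intro mult_left_mono) auto
    then show ?thesis using D by simp
  qed
  then have z1: "z t1 x1 > 0" unfolding z_def using eps(2) a by linarith
  obtain L where L: "compactin T L"
    "\<And>t x. 0 \<le> t \<Longrightarrow> t \<le> t0 \<Longrightarrow> x \<in> topspace T \<Longrightarrow> x \<notin> L \<Longrightarrow> \<bar>S t \<eta> x\<bar> < 1 / (2 * D)"
    using S_vanishes_uniformly[OF \<eta>(1), of "1 / (2 * D)" t0] D by (auto simp: divide_pos_pos)
  have out: "z t x < 0" if "0 \<le> t" "t \<le> t0" "x \<in> topspace T" "x \<notin> L" for t x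
  proof -
    have "D * S t \<eta> x \<le> D * (1 / (2 * D))" using L(2)[OF that] D by (intro mult_left_mono) auto
    then have "D * S t \<eta> x \<le> 1/2" using D by simp
    moreover have "\<epsilon> * t \<ge> 0" using eps(1) that(1) by simp
    moreover have "v t x \<le> D - 1" using v(2)[OF that(1-3)] by (simp add: D_def)
    ultimately show ?thesis by (simp add: z_def algebra_simps)
  qed
  have "jointly_continuous T (\<lambda>t x. v t x - D * (1 - S t \<eta> x) - \<epsilon> * t)"
    by (intro jointly_continuous_diff jointly_continuous_mult jointly_continuous_const
        jointly_continuous_time v(1) S_jointly_continuous_C_0 \<eta>(1))
  then have zc: "jointly_continuous T z" by (simp add: z_def[abs_def])
  have "x1 \<in> L" using out[OF t1 x1] z1 by force
  then obtain t x where m: "0 \<le> t" "t \<le> t0" "x \<in> L" "\<And>s y. 0 \<le> s \<Longrightarrow> s \<le> t0 \<Longrightarrow> y \<in> L \<Longrightarrow> z s y \<le> z t x"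
    using jointly_continuous_attains_sup[OF zc L(1) _ order_trans[OF t1]] by blast
  have zpos: "z t x > 0" using m(4)[OF t1 \<open>x1 \<in> L\<close>] z1 by linarith
  \<comment> \<open>The maximum over the compact set is global in space: \<open>z\<close> is
    negative outside \<open>L\<close> and positive at the maximum point.\<close>
  have max: "z s y \<le> z t x" if "0 \<le> s" "s \<le> t0" "y \<in> topspace T" for s :: real and y
    using out[OF that] m(4)[OF that(1,2), of y] zpos by (cases "y \<in> L") auto
  have x: "x \<in> topspace T" using m(3) compactin_subset_topspace[OF L(1)] by auto
  have "S 0 \<eta> x \<le> 1" using S_0[OF \<eta>b x] \<eta>(3) by simp
  then have "D * (1 - S 0 \<eta> x) \<ge> 0" using D by simp
  then have "z 0 x \<le> 0" using init[OF x] by (simp add: z_def)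
  then have t: "t > 0" using zpos m(1) by (cases "t = 0") auto
  have "\<forall>\<^sub>F h in at_right 0. v t x \<le> S h (v (t - h)) x + \<epsilon>/2 * h"
    by (rule sub[OF t m(2) x]) (use eps in simp)
  moreover have "\<forall>\<^sub>F h in at_right 0. 0 < h \<and> h < t"
    using t unfolding eventually_at_right_field by blast
  ultimately have "\<forall>\<^sub>F h in at_right (0::real). False"
  proof eventually_elim
    case (elim h)
    then have h: "0 < h" "h < t" and le: "v t x \<le> S h (v (t - h)) x + \<epsilon>/2 * h" by auto
    have vb: "bounded_measurable T (v (t - h))"
      using continuous_map_borel_measurable[OF jointly_continuous_slice[OF v(1), of "t - h"]]
        v(2)[of "t - h"] h m(2) unfolding bounded_measurable_def by (auto intro!: exI[of _ C])
    have wb: "bounded_measurable T (\<lambda>y. D - D * S (t - h) \<eta> y)"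
      using bounded_measurable_linear[OF bounded_measurable_const[of T D] S_bounded_measurable[OF \<eta>b, of "t - h"], of 1 "-D"] h
      by simp
    have hw: "S h (\<lambda>y. D - D * S (t - h) \<eta> y) x = D - D * S t \<eta> x"
      using S_linear[OF bounded_measurable_const[of T D] S_bounded_measurable[OF \<eta>b, of "t - h"], of h 1 "-D" x] h
        S_const[OF x, of h D] S_add[OF C_0_B_b[OF \<eta>(1)], of h "t - h" x] by simp
    \<comment> \<open>Moving the barrier back by h and applying \<open>S h\<close> reproduces it at
      time t, so it cancels and leaves the maximum of \<open>z\<close> plus the drift at time t -
      h.\<close>
    have "S h (v (t - h)) x - (D - D * S t \<eta> x) = S h (\<lambda>y. v (t - h) y - (D - D * S (t - h) \<eta> y)) x"
      using S_diff[OF vb wb, of h x] h hw by simp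
    also have "\<dots> \<le> z t x + \<epsilon> * (t - h)"
    proof (rule S_le)
      show "bounded_measurable T (\<lambda>y. v (t - h) y - (D - D * S (t - h) \<eta> y))"
        by (rule bounded_measurable_diff[OF vb wb])
      show "v (t - h) y - (D - D * S (t - h) \<eta> y) \<le> z t x + \<epsilon> * (t - h)" if "y \<in> topspace T" for y
        using max[of "t - h" y] that h m(2) by (simp add: z_def algebra_simps)
    qed (use h x in auto)
    \<comment> \<open>Stepping back by h gains \<epsilon> h from the drift, while the error allowed
      in the evolution inequality is only half of that: a contradiction.\<close>
    finally have "v t x \<le> (D - D * S t \<eta> x) + z t x + \<epsilon> * (t - h) + \<epsilon>/2 * h" using le by linarith
    then have "\<epsilon> * h \<le> 0" by (simp add: z_def algebra_simps)
    then show False using eps(1) h(1) by (simp add: mult_le_0_iff)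
  qed
  then show False by simp
qed

end

section \<open>The extended generator\<close>

context markov_semigroup
begin

lemma gen_unique:
  assumes "((\<lambda>t. diff_quotient T P f t x) \<longlongrightarrow> l) (at_right 0)"
  shows "gen T P f x = l"
  unfolding gen_def by (rule tendsto_Lim[OF _ assms]) simp

lemma gen_off:
  assumes "vanishes_off T f" "x \<notin> topspace T"
  shows "gen T P f x = 0"
  by (rule gen_unique) (use assms in \<open>simp add: diff_quotient_def S_off vanishes_off_def\<close>)

lemma gen_domI:
  assumes f: "f \<in> C_b T"
    and lim: "\<And>K e. compactin T K \<Longrightarrow> e > 0 \<Longrightarrow>
      \<exists>\<delta>>0. \<forall>t x. 0 < t \<longrightarrow> t < \<delta> \<longrightarrow> x \<in> K \<longrightarrow> \<bar>diff_quotient T P f t x - g x\<bar> < e"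
  shows "f \<in> gen_dom T P" and "\<And>x. x \<in> topspace T \<Longrightarrow> gen T P f x = g x"
proof -
  have u: "uniform_limit K (diff_quotient T P f) g (at_right 0)" if K: "compactin T K" for K
    unfolding uniform_limit_iff
  proof (intro allI impI)
    fix e :: real assume "e > 0"
    then obtain \<delta> where "\<delta> > 0" "\<And>t x. 0 < t \<Longrightarrow> t < \<delta> \<Longrightarrow> x \<in> K \<Longrightarrow> \<bar>diff_quotient T P f t x - g x\<bar> < e"
      using lim[OF K] by blast
    then show "\<forall>\<^sub>F t in at_right 0. \<forall>x\<in>K. dist (diff_quotient T P f t x) (g x) < e"
      unfolding eventually_at_right_field dist_real_def by (intro exI[of _ \<delta>]) auto
  qed
  then show "f \<in> gen_dom T P" using f unfolding gen_dom_def by blast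
  fix x assume "x \<in> topspace T"
  then show "gen T P f x = g x"
    by (intro gen_unique tendsto_uniform_limitI[OF u[of "{x}"]]) auto
qed

lemma gen_tendsto:
  assumes "f \<in> gen_dom T P" "x \<in> topspace T"
  shows "((\<lambda>t. diff_quotient T P f t x) \<longlongrightarrow> gen T P f x) (at_right 0)"
proof -
  obtain g where g: "\<And>K. compactin T K \<Longrightarrow> uniform_limit K (diff_quotient T P f) g (at_right 0)"
    using assms(1) unfolding gen_dom_def by blast
  have "((\<lambda>t. diff_quotient T P f t x) \<longlongrightarrow> g x) (at_right 0)"
    by (rule tendsto_uniform_limitI[OF g[of "{x}"]]) (use assms(2) in auto)
  then show ?thesis using gen_unique by simp
qed

lemma gen_domD:
  assumes "f \<in> gen_dom T P" "compactin T K" "e > 0"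
  obtains \<delta> where "\<delta> > 0"
    "\<And>t x. 0 < t \<Longrightarrow> t < \<delta> \<Longrightarrow> x \<in> K \<Longrightarrow> \<bar>diff_quotient T P f t x - gen T P f x\<bar> < e"
proof -
  obtain g where g: "\<And>K. compactin T K \<Longrightarrow> uniform_limit K (diff_quotient T P f) g (at_right 0)"
    using assms(1) unfolding gen_dom_def by blast
  have eq: "gen T P f x = g x" if "x \<in> K" for x
    by (rule gen_unique, rule tendsto_uniform_limitI[OF g[OF assms(2)] that])
  have "\<forall>\<^sub>F t in at_right 0. \<forall>x\<in>K. dist (diff_quotient T P f t x) (g x) < e"
    using g[OF assms(2)] assms(3) by (simp add: uniform_limit_iff)
  then show ?thesis
    using that eq unfolding eventually_at_right_field dist_real_def by auto
qed

lemma gen_dom_C_b: "f \<in> gen_dom T P \<Longrightarrow> f \<in> C_b T"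
  by (simp add: gen_dom_def)

lemma diff_quotient_linear:
  assumes "bounded_measurable T f" "bounded_measurable T g" "t \<ge> 0"
  shows "diff_quotient T P (\<lambda>x. a * f x + b * g x) t x
    = a * diff_quotient T P f t x + b * diff_quotient T P g t x"
  unfolding diff_quotient_def S_linear[OF assms]
  by (simp add: diff_divide_distrib add_divide_distrib algebra_simps)

lemma gen_dom_linear:
  assumes f: "f \<in> gen_dom T P" and g: "g \<in> gen_dom T P"
  shows "(\<lambda>x. a * f x + b * g x) \<in> gen_dom T P"
    and "gen T P (\<lambda>x. a * f x + b * g x) x = a * gen T P f x + b * gen T P g x"
proof -
  have b: "bounded_measurable T f" "bounded_measurable T g"
    using f g gen_dom_C_b bounded_measurable_C_b by auto
  have c: "(\<lambda>x. a * f x + b * g x) \<in> C_b T" by (intro C_b_linear gen_dom_C_b f g)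
  have lim: "\<exists>\<delta>>0. \<forall>t x. 0 < t \<longrightarrow> t < \<delta> \<longrightarrow> x \<in> K \<longrightarrow>
      \<bar>diff_quotient T P (\<lambda>x. a * f x + b * g x) t x - (a * gen T P f x + b * gen T P g x)\<bar> < e"
    if K: "compactin T K" and e: "e > 0" for K e
  proof -
    define r where "r = e / (\<bar>a\<bar> + \<bar>b\<bar> + 1)"
    have r: "r > 0" using e by (simp add: r_def add_nonneg_pos)
    obtain \<delta>1 where 1: "\<delta>1 > 0"
      "\<And>t x. 0 < t \<Longrightarrow> t < \<delta>1 \<Longrightarrow> x \<in> K \<Longrightarrow> \<bar>diff_quotient T P f t x - gen T P f x\<bar> < r"
      using gen_domD[OF f K r] by blast
    obtain \<delta>2 where 2: "\<delta>2 > 0"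
      "\<And>t x. 0 < t \<Longrightarrow> t < \<delta>2 \<Longrightarrow> x \<in> K \<Longrightarrow> \<bar>diff_quotient T P g t x - gen T P g x\<bar> < r"
      using gen_domD[OF g K r] by blast
    have "\<bar>diff_quotient T P (\<lambda>x. a * f x + b * g x) t x - (a * gen T P f x + b * gen T P g x)\<bar> < e"
      if t: "0 < t" "t < min \<delta>1 \<delta>2" and x: "x \<in> K" for t x
    proof -
      let ?u = "diff_quotient T P f t x - gen T P f x" and ?v = "diff_quotient T P g t x - gen T P g x"
      have uv: "\<bar>?u\<bar> < r" "\<bar>?v\<bar> < r" using 1(2)[of t x] 2(2)[of t x] t x by auto
      have "diff_quotient T P (\<lambda>x. a * f x + b * g x) t x - (a * gen T P f x + b * gen T P g x) = a * ?u + b * ?v"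
        unfolding diff_quotient_linear[OF b less_imp_le[OF t(1)]] by (simp add: algebra_simps)
      also have "\<bar>\<dots>\<bar> < e" by (rule abs_lincomb_less[OF uv[unfolded r_def]])
      finally show ?thesis .
    qed
    then show ?thesis using 1(1) 2(1) by (intro exI[of _ "min \<delta>1 \<delta>2"]) auto
  qed
  show "(\<lambda>x. a * f x + b * g x) \<in> gen_dom T P" by (rule gen_domI(1)[OF c lim])
  show "gen T P (\<lambda>x. a * f x + b * g x) x = a * gen T P f x + b * gen T P g x"
  proof (cases "x \<in> topspace T")
    case True
    then show ?thesis using gen_domI(2)[OF c lim] by blast
  next
    case False
    then show ?thesis using c f g gen_dom_C_b by (simp add: gen_off C_b_def)
  qed
qed

lemma gen_dom0I:
  assumes f: "f \<in> C_0 T" and g: "g \<in> C_0 T"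
    and lim: "\<And>e. e > 0 \<Longrightarrow>
      \<exists>\<delta>>0. \<forall>t x. 0 < t \<longrightarrow> t < \<delta> \<longrightarrow> x \<in> topspace T \<longrightarrow> \<bar>diff_quotient T P f t x - g x\<bar> < e"
  shows "f \<in> gen_dom0 T P" and "gen T P f = g"
proof -
  have u: "uniform_limit (topspace T) (diff_quotient T P f) g (at_right 0)"
    unfolding uniform_limit_iff
  proof (intro allI impI)
    fix e :: real assume "e > 0"
    then obtain \<delta> where "\<delta> > 0"
      "\<And>t x. 0 < t \<Longrightarrow> t < \<delta> \<Longrightarrow> x \<in> topspace T \<Longrightarrow> \<bar>diff_quotient T P f t x - g x\<bar> < e"
      using lim by blast
    then show "\<forall>\<^sub>F t in at_right 0. \<forall>x\<in>topspace T. dist (diff_quotient T P f t x) (g x) < e"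
      unfolding eventually_at_right_field dist_real_def by (intro exI[of _ \<delta>]) auto
  qed
  then show "f \<in> gen_dom0 T P" using f g unfolding gen_dom0_def by blast
  show "gen T P f = g"
  proof
    fix x show "gen T P f x = g x"
    proof (cases "x \<in> topspace T")
      case True
      show ?thesis by (rule gen_unique, rule tendsto_uniform_limitI[OF u True])
    next
      case False
      then show ?thesis using f g gen_off[of f x] by (simp add: C_0_def vanishes_off_def)
    qed
  qed
qed

lemma
  assumes "f \<in> gen_dom0 T P"
  shows gen_dom0_C_0: "f \<in> C_0 T" and gen_C_0: "gen T P f \<in> C_0 T"
    and gen_dom0_uniform: "uniform_limit (topspace T) (diff_quotient T P f) (gen T P f) (at_right 0)"
proof -
  obtain g where g: "g \<in> C_0 T" "uniform_limit (topspace T) (diff_quotient T P f) g (at_right 0)"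
    and f: "f \<in> C_0 T"
    using assms unfolding gen_dom0_def by blast
  have "gen T P f x = g x" for x
  proof (cases "x \<in> topspace T")
    case True
    show ?thesis by (rule gen_unique, rule tendsto_uniform_limitI[OF g(2) True])
  next
    case False
    then show ?thesis using f g gen_off[of f x] by (simp add: C_0_def vanishes_off_def)
  qed
  then have "gen T P f = g" by blast
  then show "f \<in> C_0 T" "gen T P f \<in> C_0 T"
    "uniform_limit (topspace T) (diff_quotient T P f) (gen T P f) (at_right 0)" using f g by auto
qed

lemma gen_dom0D:
  assumes "f \<in> gen_dom0 T P" "e > 0"
  obtains \<delta> where "\<delta> > 0"
    "\<And>t x. 0 < t \<Longrightarrow> t < \<delta> \<Longrightarrow> x \<in> topspace T \<Longrightarrow> \<bar>diff_quotient T P f t x - gen T P f x\<bar> < e"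
proof -
  have "\<forall>\<^sub>F t in at_right 0. \<forall>x\<in>topspace T. dist (diff_quotient T P f t x) (gen T P f x) < e"
    using gen_dom0_uniform[OF assms(1)] assms(2) by (simp add: uniform_limit_iff)
  then show ?thesis
    using that unfolding eventually_at_right_field dist_real_def by auto
qed

lemma gen_dom0_subset_gen_dom: "gen_dom0 T P \<subseteq> gen_dom T P"
proof
  fix f assume f: "f \<in> gen_dom0 T P"
  have "f \<in> C_b T" using gen_dom0_C_0[OF f] C_0_subset_C_b by blast
  moreover have "uniform_limit K (diff_quotient T P f) (gen T P f) (at_right 0)" if "compactin T K" for K
    by (rule uniform_limit_on_subset[OF gen_dom0_uniform[OF f] compactin_subset_topspace[OF that]])
  ultimately show "f \<in> gen_dom T P" unfolding gen_dom_def by blast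
qed

end

context feller_semigroup
begin

text \<open>Near each point there is a compact neighbourhood, on which the image is a uniform limit
  of difference quotients; these are continuous because \<open>S t\<close> preserves
  \<open>C_b\<close>.\<close>

lemma gen_continuous:
  assumes f: "f \<in> gen_dom T P"
  shows "continuous_map T euclideanreal (gen T P f)"
  unfolding continuous_map_real_iff
proof (intro ballI allI impI)
  fix x and e :: real assume x: "x \<in> topspace T" and e: "e > 0"
  obtain V K where VK: "openin T V" "compactin T K" "x \<in> V" "V \<subseteq> K"
    using loc_compact x unfolding locally_compact_space_def by blast
  have "e/3 > 0" using e by simp
  then obtain \<delta> where d: "\<delta> > 0"
    "\<And>t x. 0 < t \<Longrightarrow> t < \<delta> \<Longrightarrow> x \<in> K \<Longrightarrow> \<bar>diff_quotient T P f t x - gen T P f x\<bar> < e/3"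
    using gen_domD[OF f VK(2)] by blast
  define t where "t = \<delta>/2"
  have t: "0 < t" "t < \<delta>" using d by (auto simp: t_def)
  have fb: "f \<in> C_b T" by (rule gen_dom_C_b[OF f])
  have "(\<lambda>x. (1/t) * S t f x + (-1/t) * f x) \<in> C_b T"
    using S_C_b[OF fb less_imp_le[OF t(1)]] fb by (rule C_b_linear)
  then have "continuous_map T euclideanreal (\<lambda>x. (1/t) * S t f x + (-1/t) * f x)"
    by (simp add: C_b_def)
  then have "continuous_map T euclideanreal (diff_quotient T P f t)"
    by (rule continuous_map_eq) (simp add: diff_quotient_def diff_divide_distrib)
  from this[unfolded continuous_map_real_iff, rule_format, OF x \<open>e/3 > 0\<close>]
  obtain U where U: "openin T U" "x \<in> U"
    "\<And>y. y \<in> U \<Longrightarrow> \<bar>diff_quotient T P f t y - diff_quotient T P f t x\<bar> < e/3"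
    by auto
  have "\<bar>gen T P f y - gen T P f x\<bar> < e" if "y \<in> U \<inter> V" for y
  proof -
    have "x \<in> K" "y \<in> K" "y \<in> U" using that VK by auto
    from d(2)[OF t this(1)] d(2)[OF t this(2)] U(3)[OF this(3)] show ?thesis by linarith
  qed
  then show "\<exists>U. openin T U \<and> x \<in> U \<and> (\<forall>y\<in>U. \<bar>gen T P f y - gen T P f x\<bar> < e)"
    using U(1,2) VK(1,3) by (intro exI[of _ "U \<inter> V"]) auto
qed

text \<open>The difference quotients of \<open>k\<close> need not be bounded, so \<open>S t k - k\<close> cannot simply be
  integrated. Instead it is compared with \<open>t * (M + S t \<psi>)\<close>, where \<open>M + \<psi>\<close> dominates \<open>g\<close> and
  agrees with it where \<open>\<eta> = 1\<close>.\<close>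

lemma increment_upper_bound:
  assumes k: "k \<in> C_b T"
    and lim: "\<And>x. x \<in> topspace T \<Longrightarrow> ((\<lambda>h. diff_quotient T P k h x) \<longlongrightarrow> k' x) (at_right 0)"
    and le: "\<And>x. x \<in> topspace T \<Longrightarrow> k' x \<le> g x + d"
    and M: "\<And>x. g x \<le> M"
    and \<eta>: "\<And>x. \<eta> x \<le> 1"
    and \<psi>: "\<psi> \<in> C_0 T" "\<And>x. \<psi> x = \<eta> x * (g x - M)"
    and small: "\<And>h x. 0 \<le> h \<Longrightarrow> h \<le> \<tau> \<Longrightarrow> x \<in> topspace T \<Longrightarrow> \<bar>S h \<psi> x - \<psi> x\<bar> \<le> e"
    and t1: "0 \<le> t1" "t1 \<le> \<tau>" and x1: "x1 \<in> topspace T"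
  shows "S t1 k x1 - k x1 \<le> t1 * (M + \<psi> x1 + 2 * e + d)"
proof -
  \<comment> \<open>Here d is the distance of \<open>k'\<close> from \<open>g\<close>, and e pays
    for replacing \<open>\<psi> x\<close> by \<open>S t \<psi> x\<close>. Returning to
    \<open>\<psi> x1\<close> at the end costs e once more, whence 2 e in the conclusion.\<close>
  define c where "c = M + e + d"
  define v where "v t x = S t k x - k x - (t * c + t * S t \<psi> x)" for t x
  have kb: "bounded_measurable T k" and \<psi>b: "bounded_measurable T \<psi>"
    using k \<psi>(1) bounded_measurable_C_b bounded_measurable_C_0 by auto
  have kB: "k \<in> B_b T" using k C_b_subset_B_b by blast
  obtain Ck where Ck: "\<And>x. \<bar>k x\<bar> \<le> Ck" using k by (auto simp: C_b_def bounded_range_real_iff)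
  have "\<psi> \<in> C_b T" using \<psi>(1) C_0_subset_C_b by blast
  then obtain Cp where Cp: "\<And>x. \<bar>\<psi> x\<bar> \<le> Cp" by (auto simp: C_b_def bounded_range_real_iff)
  have kc: "continuous_map T euclideanreal k" using k by (simp add: C_b_def)
  have "jointly_continuous T (\<lambda>t x. S t k x - k x - (t * c + t * S t \<psi> x))"
    by (intro jointly_continuous_diff jointly_continuous_add jointly_continuous_mult
        jointly_continuous_const jointly_continuous_time jointly_continuous_space[OF kc]
        S_jointly_continuous[OF k] S_jointly_continuous_C_0[OF \<psi>(1)])
  then have vc: "jointly_continuous T v" by (simp add: v_def[abs_def])
  have "v t1 x1 \<le> 0"
  proof (rule maximum_principle[OF vc, of \<tau> "Ck + Ck + (\<tau> * \<bar>c\<bar> + \<tau> * Cp)"])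
    fix t x assume t: "0 \<le> t" "t \<le> \<tau>" and x: "x \<in> topspace T"
    have "\<bar>S t k x\<bar> \<le> Ck" by (rule S_abs_le[OF kb t(1) x Ck])
    moreover have "\<bar>t * c\<bar> \<le> \<tau> * \<bar>c\<bar>" using t by (simp add: abs_mult mult_right_mono)
    moreover have "\<bar>t * S t \<psi> x\<bar> \<le> \<tau> * Cp"
      using S_abs_le[OF \<psi>b t(1) x Cp] t by (simp add: abs_mult mult_mono)
    ultimately show "\<bar>v t x\<bar> \<le> Ck + Ck + (\<tau> * \<bar>c\<bar> + \<tau> * Cp)"
      using Ck[of x] unfolding v_def by linarith
  next
    fix x assume "x \<in> topspace T"
    then show "v 0 x \<le> 0" using S_0[OF kb] by (simp add: v_def)
  next
    fix t x e' assume t: "0 < t" "t \<le> \<tau>" and x: "x \<in> topspace T" and e': "(e' :: real) > 0"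
    have "\<forall>\<^sub>F h in at_right 0. diff_quotient T P k h x < k' x + e'"
      using order_tendstoD(2)[OF lim[OF x], of "k' x + e'"] e' by simp
    moreover have "\<forall>\<^sub>F h in at_right 0. 0 < h \<and> h < t"
      using t(1) unfolding eventually_at_right_field by blast
    ultimately show "\<forall>\<^sub>F h in at_right 0. v t x \<le> S h (v (t - h)) x + e' * h"
    proof eventually_elim
      case (elim h)
      then have h: "0 < h" "h < t" by auto
      have "S h k x - k x \<le> (k' x + e') * h"
        using elim h(1) by (simp add: diff_quotient_def divide_less_eq)
      also have "\<dots> \<le> (g x + d + e') * h" using le[OF x] h(1) by (intro mult_right_mono) auto
      finally have inc: "S h k x - k x \<le> (g x + d + e') * h" .
      \<comment> \<open>Since \<psi> is \<eta> (g - M), this product being nonnegative is the same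
        as \<open>g x \<le> M + \<psi> x\<close>.\<close>
      have "(1 - \<eta> x) * (M - g x) \<ge> 0" using \<eta>[of x] M[of x] by simp
      then have "g x \<le> M + \<psi> x" by (simp add: \<psi>(2) algebra_simps)
      moreover have "\<psi> x \<le> S t \<psi> x + e" using small[of t x] t x by auto
      ultimately have "(g x + d + e') * h \<le> (c + S t \<psi> x + e') * h"
        using h(1) by (intro mult_right_mono) (auto simp: c_def)
      \<comment> \<open>This compares at time t, not at time 0: the bound contains
        \<open>S t \<psi> x\<close>, which the flow transports exactly, so the terms in t cancel and
        only those in h are left to compare.\<close>
      then have main: "S h k x - k x \<le> (c + S t \<psi> x + e') * h" using inc by linarith
      have bSk: "bounded_measurable T (S (t - h) k)" and bSp: "bounded_measurable T (S (t - h) \<psi>)"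
        using kb \<psi>b h S_bounded_measurable by auto
      have b2: "bounded_measurable T (\<lambda>y. (t - h) * c + (t - h) * S (t - h) \<psi> y)"
        using bounded_measurable_linear[OF bounded_measurable_const[of T "(t - h) * c"] bSp, of 1 "t - h"] by simp
      have "S h (v (t - h)) x = S h (\<lambda>y. S (t - h) k y - k y) x - S h (\<lambda>y. (t - h) * c + (t - h) * S (t - h) \<psi> y) x"
        unfolding v_def[abs_def] using h by (intro S_diff bounded_measurable_diff bSk kb b2) auto
      also have "S h (\<lambda>y. S (t - h) k y - k y) x = S t k x - S h k x"
        using S_diff[OF bSk kb, of h x] S_add[OF kB, of h "t - h" x] h by simp
      also have "S h (\<lambda>y. (t - h) * c + (t - h) * S (t - h) \<psi> y) x = (t - h) * c + (t - h) * S t \<psi> x"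
        using S_linear[OF bounded_measurable_const[of T "(t - h) * c"] bSp, of h 1 "t - h" x] h
          S_const[OF x] S_add[OF C_0_B_b[OF \<psi>(1)], of h "t - h" x] by simp
      finally have eq: "S h (v (t - h)) x = S t k x - S h k x - ((t - h) * c + (t - h) * S t \<psi> x)" .
      show ?case unfolding eq using main by (simp add: v_def algebra_simps)
    qed
  qed (use t1 x1 in auto)
  then have "S t1 k x1 - k x1 \<le> t1 * (c + S t1 \<psi> x1)" by (simp add: v_def algebra_simps)
  also have "\<dots> \<le> t1 * (M + \<psi> x1 + 2 * e + d)"
    using small[OF t1 x1] t1(1) by (intro mult_left_mono) (auto simp: c_def)
  finally show ?thesis .
qed

text \<open>The threshold \<open>t0\<close> depends on \<open>g\<close> only, not on \<open>k\<close>: this is what makes the extended generator closed.\<close>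

lemma diff_quotient_estimate:
  assumes g: "g \<in> C_b T" and K: "compactin T K" and e: "e > 0"
  shows "\<exists>t0>0. \<forall>k k' d t x. k \<in> C_b T \<longrightarrow>
      (\<forall>x\<in>topspace T. ((\<lambda>h. diff_quotient T P k h x) \<longlongrightarrow> k' x) (at_right 0)) \<longrightarrow>
      (\<forall>x\<in>topspace T. \<bar>k' x - g x\<bar> \<le> d) \<longrightarrow> 0 < t \<longrightarrow> t \<le> t0 \<longrightarrow> x \<in> K \<longrightarrow>
      \<bar>diff_quotient T P k t x - g x\<bar> \<le> e + d"
proof -
  obtain C where C: "\<And>x. \<bar>g x\<bar> \<le> C" using g by (auto simp: C_b_def bounded_range_real_iff)
  obtain \<eta> where \<eta>: "\<eta> \<in> C_0 T" "\<And>x. 0 \<le> \<eta> x" "\<And>x. \<eta> x \<le> 1" "\<And>x. x \<in> K \<Longrightarrow> \<eta> x = 1"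
    using C_0_cutoff[OF metrizable loc_compact K] by metis
  have psi: "(\<lambda>x. \<eta> x * (g x - C)) \<in> C_0 T" "(\<lambda>x. \<eta> x * (- g x - C)) \<in> C_0 T"
  proof -
    have "(\<lambda>x. \<eta> x * (g x - C)) = (\<lambda>x. 1 * (\<eta> x * g x) + (- C) * \<eta> x)"
      "(\<lambda>x. \<eta> x * (- g x - C)) = (\<lambda>x. (-1) * (\<eta> x * g x) + (- C) * \<eta> x)"
      by (auto simp: algebra_simps)
    then show "(\<lambda>x. \<eta> x * (g x - C)) \<in> C_0 T" "(\<lambda>x. \<eta> x * (- g x - C)) \<in> C_0 T"
      by (simp_all only: C_0_linear[OF C_0_mult[OF \<eta>(1) g] \<eta>(1)])
  qed
  obtain \<delta>1 where 1: "\<delta>1 > 0" "\<And>h x. 0 \<le> h \<Longrightarrow> h \<le> \<delta>1 \<Longrightarrow> x \<in> topspace T \<Longrightarrow>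
      \<bar>S h (\<lambda>x. \<eta> x * (g x - C)) x - \<eta> x * (g x - C)\<bar> < e/2"
    using S_small[OF psi(1) half_gt_zero[OF e]] by blast
  obtain \<delta>2 where 2: "\<delta>2 > 0" "\<And>h x. 0 \<le> h \<Longrightarrow> h \<le> \<delta>2 \<Longrightarrow> x \<in> topspace T \<Longrightarrow>
      \<bar>S h (\<lambda>x. \<eta> x * (- g x - C)) x - \<eta> x * (- g x - C)\<bar> < e/2"
    using S_small[OF psi(2) half_gt_zero[OF e]] by blast
  show ?thesis
  proof (intro exI[of _ "min \<delta>1 \<delta>2"] conjI allI impI)
    show "min \<delta>1 \<delta>2 > 0" using 1 2 by simp
    fix k k' d t x
    assume k: "k \<in> C_b T"
      and lim': "\<forall>x\<in>topspace T. ((\<lambda>h. diff_quotient T P k h x) \<longlongrightarrow> k' x) (at_right 0)"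
      and cl': "\<forall>x\<in>topspace T. \<bar>k' x - g x\<bar> \<le> d"
      and t: "0 < t" "t \<le> min \<delta>1 \<delta>2" and x: "x \<in> K"
    note lim = bspec[OF lim'] and cl = bspec[OF cl']
    have xT: "x \<in> topspace T" using x compactin_subset_topspace[OF K] by auto
    have kb: "bounded_measurable T k" using k by (rule bounded_measurable_C_b)
    have up: "S t k x - k x \<le> t * (C + \<eta> x * (g x - C) + 2 * (e/2) + d)"
    proof (rule increment_upper_bound[OF k lim _ _ \<eta>(3) psi(1), where g=g and \<tau>="min \<delta>1 \<delta>2"])
      show "k' x \<le> g x + d" if "x \<in> topspace T" for x using cl[OF that] by linarith
      show "g x \<le> C" for x using C[of x] by linarith
      show "\<bar>S h (\<lambda>x. \<eta> x * (g x - C)) x - \<eta> x * (g x - C)\<bar> \<le> e/2"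
        if "0 \<le> h" "h \<le> min \<delta>1 \<delta>2" "x \<in> topspace T" for h x
        using 1(2)[of h x] that by simp
    qed (use t xT in auto)
    \<comment> \<open>The lower bound is the upper bound for the negated functions; the same
      constant \<open>C\<close> dominates g and its negative.\<close>
    have nk: "(\<lambda>x. - k x) \<in> C_b T" using C_b_linear[OF k k, of "-1" 0] by simp
    have neg: "S h (\<lambda>x. - k x) y = - S h k y" if "h \<ge> 0" for h y
      using S_linear[OF kb kb that, of "-1" 0 y] by simp
    have dn: "S t (\<lambda>x. - k x) x - (- k x)
        \<le> t * (C + \<eta> x * (- g x - C) + 2 * (e/2) + d)"
    proof (rule increment_upper_bound[OF nk _ _ _ \<eta>(3) psi(2),
          where g="\<lambda>x. - g x" and \<tau>="min \<delta>1 \<delta>2" and k'="\<lambda>x. - k' x"])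
      show "((\<lambda>h. diff_quotient T P (\<lambda>x. - k x) h x) \<longlongrightarrow> - k' x) (at_right 0)"
        if "x \<in> topspace T" for x
      proof -
        have "\<forall>\<^sub>F h in at_right 0. - diff_quotient T P k h x = diff_quotient T P (\<lambda>x. - k x) h x"
          unfolding eventually_at_right_field
          by (intro exI[of _ 1]) (auto simp: diff_quotient_def neg minus_divide_left)
        then show ?thesis
          by (rule Lim_transform_eventually[OF tendsto_minus[OF lim[OF that]]])
      qed
      show "- k' x \<le> - g x + d" if "x \<in> topspace T" for x using cl[OF that] by linarith
      show "- g x \<le> C" for x using C[of x] by linarith
      show "\<bar>S h (\<lambda>x. \<eta> x * (- g x - C)) x - \<eta> x * (- g x - C)\<bar> \<le> e/2"
        if "0 \<le> h" "h \<le> min \<delta>1 \<delta>2" "x \<in> topspace T" for h x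
        using 2(2)[of h x] that by simp
    qed (use t xT in auto)
    \<comment> \<open>The cutoff is 1 on \<open>K\<close>, so
      \<open>C + \<eta> x * (- g x - C)\<close> collapses to \<open>- g x\<close>.\<close>
    have dn': "- (S t k x - k x) \<le> t * (- g x + e + d)"
      using dn \<eta>(4)[OF x] neg[of t x] t(1) by simp
    have up': "S t k x - k x \<le> t * (g x + e + d)" using up \<eta>(4)[OF x] by simp
    have "diff_quotient T P k t x \<le> g x + e + d"
      using up' t(1) unfolding diff_quotient_def by (simp add: pos_divide_le_eq mult.commute)
    moreover have "- diff_quotient T P k t x \<le> - g x + e + d"
    proof -
      have "- (S t k x - k x) / t \<le> - g x + e + d"
        using dn' t(1) by (subst pos_divide_le_eq) (auto simp: mult.commute)
      then show ?thesis unfolding diff_quotient_def by (simp only: minus_divide_left)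
    qed
    ultimately show "\<bar>diff_quotient T P k t x - g x\<bar> \<le> e + d" by linarith
  qed
qed

text \<open>The uniform threshold from \<open>diff_quotient_estimate\<close> holds for all
  approximants at once, so at a fixed time the approximant may be chosen as close as that time
  requires. The estimate needs a bounded image, which is arranged by subtracting one approximant
  first.\<close>

lemma gen_closed:
  assumes D: "D \<subseteq> gen_dom T P" and fg: "(f, g) \<in> op_closure T D (gen T P)"
  shows "f \<in> gen_dom T P" and "gen T P f = g"
proof -
  have off: "vanishes_off T f" "vanishes_off T g"
    and app: "\<And>e. e > 0 \<Longrightarrow> \<exists>h\<in>D. \<forall>x\<in>topspace T. \<bar>h x - f x\<bar> < e \<and> \<bar>gen T P h x - g x\<bar> < e"
    using fg by (auto simp: op_closure_def)
  \<comment> \<open>The image \<open>g\<close> may be unbounded, but it differs from the image of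
    \<open>h0\<close> by less than 1. The differences \<open>k\<close> and \<open>g'\<close> are
    therefore in \<open>C_b\<close>.\<close>
  obtain h0 where h0D: "h0 \<in> D" and h0: "\<And>x. x \<in> topspace T \<Longrightarrow> \<bar>h0 x - f x\<bar> < 1 \<and> \<bar>gen T P h0 x - g x\<bar> < 1"
    using app[of 1] by auto
  have h0d: "h0 \<in> gen_dom T P" using h0D D by blast
  define k where "k x = f x - h0 x" for x
  define g' where "g' x = g x - gen T P h0 x" for x
  have koff: "vanishes_off T k" and goff: "vanishes_off T g'"
    using off h0d gen_off[of h0] gen_dom_C_b[OF h0d] by (auto simp: k_def g'_def C_b_def vanishes_off_def)
  have app': "\<exists>h\<in>gen_dom T P. \<forall>x\<in>topspace T. \<bar>h x - k x\<bar> < e \<and> \<bar>gen T P h x - g' x\<bar> < e" if e: "e > 0" for e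
  proof -
    obtain h where h: "h \<in> D" "\<And>x. x \<in> topspace T \<Longrightarrow> \<bar>h x - f x\<bar> < e \<and> \<bar>gen T P h x - g x\<bar> < e"
      using app[OF e] by blast
    have hd: "h \<in> gen_dom T P" using h(1) D by blast
    show ?thesis
      using gen_dom_linear[OF hd h0d, of 1 "-1"] h(2)
      by (intro bexI[of _ "\<lambda>x. 1 * h x + (-1) * h0 x"]) (auto simp: k_def g'_def)
  qed
  have kC: "k \<in> C_b T"
    unfolding C_b_def mem_Collect_eq bounded_range_real_iff
  proof (intro conjI koff)
    show "continuous_map T euclideanreal k"
    proof (rule continuous_map_real_uniform_limit)
      fix e :: real assume "e > 0"
      then obtain h where "h \<in> gen_dom T P" "\<forall>x\<in>topspace T. \<bar>h x - k x\<bar> < e" using app' by blast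
      then show "\<exists>g. continuous_map T euclideanreal g \<and> (\<forall>x\<in>topspace T. \<bar>g x - k x\<bar> < e)"
        using gen_dom_C_b by (auto simp: C_b_def)
    qed
    have "\<bar>k x\<bar> \<le> 1" for x
      using h0[of x] koff by (cases "x \<in> topspace T") (auto simp: k_def vanishes_off_def)
    then show "\<exists>C. \<forall>x. \<bar>k x\<bar> \<le> C" by blast
  qed
  have gC: "g' \<in> C_b T"
    unfolding C_b_def mem_Collect_eq bounded_range_real_iff
  proof (intro conjI goff)
    show "continuous_map T euclideanreal g'"
    proof (rule continuous_map_real_uniform_limit)
      fix e :: real assume "e > 0"
      then obtain h where "h \<in> gen_dom T P" "\<forall>x\<in>topspace T. \<bar>gen T P h x - g' x\<bar> < e" using app' by blast
      then show "\<exists>g. continuous_map T euclideanreal g \<and> (\<forall>x\<in>topspace T. \<bar>g x - g' x\<bar> < e)"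
        using gen_continuous by blast
    qed
    have "\<bar>g' x\<bar> \<le> 1" for x
      using h0[of x] goff by (cases "x \<in> topspace T") (auto simp: g'_def vanishes_off_def)
    then show "\<exists>C. \<forall>x. \<bar>g' x\<bar> \<le> C" by blast
  qed
  have lim: "\<exists>\<delta>>0. \<forall>t x. 0 < t \<longrightarrow> t < \<delta> \<longrightarrow> x \<in> K \<longrightarrow> \<bar>diff_quotient T P k t x - g' x\<bar> < e"
    if K: "compactin T K" and e: "e > 0" for K e
  proof -
    from diff_quotient_estimate[OF gC K half_gt_zero[OF e]]
    obtain t0 where t0: "t0 > 0" and est: "\<forall>k k' d t x. k \<in> C_b T \<longrightarrow>
      (\<forall>x\<in>topspace T. ((\<lambda>h. diff_quotient T P k h x) \<longlongrightarrow> k' x) (at_right 0)) \<longrightarrow>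
      (\<forall>x\<in>topspace T. \<bar>k' x - g' x\<bar> \<le> d) \<longrightarrow> 0 < t \<longrightarrow> t \<le> t0 \<longrightarrow> x \<in> K \<longrightarrow>
      \<bar>diff_quotient T P k t x - g' x\<bar> \<le> e/2 + d" by (elim exE conjE)
    have "\<bar>diff_quotient T P k t x - g' x\<bar> < e" if t: "0 < t" "t < t0" and x: "x \<in> K" for t x
    proof -
      have xT: "x \<in> topspace T" using x compactin_subset_topspace[OF K] by auto
      \<comment> \<open>The time t is fixed here. Exchanging \<open>k\<close> for an approximant
        changes the quotient by at most 2 r / t, hence by at most e/8; together with e/2 + r this
        stays below e.\<close>
      define r where "r = min (e/8) (e * t/16)"
      have r: "r > 0" "r \<le> e/8" "2 * r / t \<le> e/8" using e t by (auto simp: r_def divide_le_eq min_def)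
      obtain h where h: "h \<in> gen_dom T P" "\<And>x. x \<in> topspace T \<Longrightarrow> \<bar>h x - k x\<bar> < r \<and> \<bar>gen T P h x - g' x\<bar> < r"
        using app'[OF r(1)] by blast
      have hb: "bounded_measurable T h" and kb: "bounded_measurable T k"
        using gen_dom_C_b[OF h(1)] kC bounded_measurable_C_b by auto
      have a: "\<bar>diff_quotient T P h t x - g' x\<bar> \<le> e/2 + r"
      proof (rule est[rule_format, OF gen_dom_C_b[OF h(1)] gen_tendsto[OF h(1)]])
        show "\<bar>gen T P h x - g' x\<bar> \<le> r" if "x \<in> topspace T" for x using h(2)[OF that] by linarith
      qed (use t x in auto)
      have "\<bar>S t (\<lambda>y. h y - k y) x\<bar> \<le> r"
        by (rule S_abs_le[OF bounded_measurable_diff[OF hb kb] less_imp_le[OF t(1)] xT])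
           (use h(2) less_imp_le in blast)
      then have "\<bar>S t h x - S t k x\<bar> \<le> r" using S_diff[OF hb kb less_imp_le[OF t(1)]] by simp
      moreover have "\<bar>h x - k x\<bar> \<le> r" using h(2)[OF xT] by linarith
      ultimately have n: "\<bar>(S t h x - S t k x) - (h x - k x)\<bar> \<le> 2 * r" by linarith
      have "diff_quotient T P h t x - diff_quotient T P k t x = ((S t h x - S t k x) - (h x - k x)) / t"
        by (simp add: diff_quotient_def diff_divide_distrib)
      also have "\<bar>\<dots>\<bar> = \<bar>(S t h x - S t k x) - (h x - k x)\<bar> / t" using t(1) by simp
      also have "\<dots> \<le> 2 * r / t" using n t(1) by (intro divide_right_mono) auto
      finally show ?thesis using a r e by linarith
    qed
    then show ?thesis using t0 by blast
  qed
  have kd: "k \<in> gen_dom T P" and kg: "\<And>x. x \<in> topspace T \<Longrightarrow> gen T P k x = g' x"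
    using gen_domI[OF kC lim] by auto
  have f: "f = (\<lambda>x. 1 * k x + 1 * h0 x)" by (auto simp: k_def)
  show fd: "f \<in> gen_dom T P" unfolding f by (rule gen_dom_linear(1)[OF kd h0d])
  show "gen T P f = g"
  proof
    fix x show "gen T P f x = g x"
    proof (cases "x \<in> topspace T")
      case True
      then show ?thesis unfolding f gen_dom_linear(2)[OF kd h0d] using kg by (simp add: g'_def)
    next
      case False
      then show ?thesis using off gen_off[OF off(1)] by (simp add: vanishes_off_def)
    qed
  qed
qed

end

context markov_semigroup
begin

lemma gen_dom0_linear:
  assumes f: "f \<in> gen_dom0 T P" and g: "g \<in> gen_dom0 T P"
  shows "(\<lambda>x. a * f x + b * g x) \<in> gen_dom0 T P"
proof (rule gen_dom0I(1))
  show "(\<lambda>x. a * f x + b * g x) \<in> C_0 T" "(\<lambda>x. a * gen T P f x + b * gen T P g x) \<in> C_0 T"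
    using f g by (auto intro: C_0_linear gen_dom0_C_0 gen_C_0)
  fix e :: real assume e: "e > 0"
  define r where "r = e / (\<bar>a\<bar> + \<bar>b\<bar> + 1)"
  have r: "r > 0" using e by (simp add: r_def add_nonneg_pos)
  obtain \<delta>1 where 1: "\<delta>1 > 0"
    "\<And>t x. 0 < t \<Longrightarrow> t < \<delta>1 \<Longrightarrow> x \<in> topspace T \<Longrightarrow> \<bar>diff_quotient T P f t x - gen T P f x\<bar> < r"
    using gen_dom0D[OF f r] by blast
  obtain \<delta>2 where 2: "\<delta>2 > 0"
    "\<And>t x. 0 < t \<Longrightarrow> t < \<delta>2 \<Longrightarrow> x \<in> topspace T \<Longrightarrow> \<bar>diff_quotient T P g t x - gen T P g x\<bar> < r"
    using gen_dom0D[OF g r] by blast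
  have b: "bounded_measurable T f" "bounded_measurable T g"
    using f g gen_dom0_C_0 bounded_measurable_C_0 by auto
  have "\<bar>diff_quotient T P (\<lambda>x. a * f x + b * g x) t x - (a * gen T P f x + b * gen T P g x)\<bar> < e"
    if t: "0 < t" "t < min \<delta>1 \<delta>2" and x: "x \<in> topspace T" for t x
  proof -
    let ?u = "diff_quotient T P f t x - gen T P f x" and ?v = "diff_quotient T P g t x - gen T P g x"
    have uv: "\<bar>?u\<bar> < r" "\<bar>?v\<bar> < r" using 1(2)[of t x] 2(2)[of t x] t x by auto
    have "diff_quotient T P (\<lambda>x. a * f x + b * g x) t x - (a * gen T P f x + b * gen T P g x) = a * ?u + b * ?v"
      unfolding diff_quotient_linear[OF b less_imp_le[OF t(1)]] by (simp add: algebra_simps)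
    also have "\<bar>\<dots>\<bar> < e" by (rule abs_lincomb_less[OF uv[unfolded r_def]])
    finally show ?thesis .
  qed
  then show "\<exists>\<delta>>0. \<forall>t x. 0 < t \<longrightarrow> t < \<delta> \<longrightarrow> x \<in> topspace T \<longrightarrow>
      \<bar>diff_quotient T P (\<lambda>x. a * f x + b * g x) t x - (a * gen T P f x + b * gen T P g x)\<bar> < e"
    using 1(1) 2(1) by (intro exI[of _ "min \<delta>1 \<delta>2"]) auto
qed

end

context feller_semigroup
begin

section \<open>Time averages and density of the domain\<close>

lemma S_continuous_on_time:
  assumes f: "f \<in> C_0 T" and x: "x \<in> topspace T"
  shows "continuous_on {0..} (\<lambda>s. S s f x)"
  unfolding continuous_on_iff
proof (intro ballI allI impI)
  fix t e :: real assume t: "t \<in> {0..}" and e: "e > 0"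
  have t0: "t \<ge> 0" using t by simp
  obtain \<delta> U where "\<delta> > 0" "openin T U" "x \<in> U"
    "\<And>s y. s \<ge> 0 \<Longrightarrow> y \<in> U \<Longrightarrow> \<bar>s - t\<bar> < \<delta> \<Longrightarrow> \<bar>S s f y - S t f x\<bar> < e"
    using jointly_continuousD[OF S_jointly_continuous_C_0[OF f] t0 x e] by metis
  then show "\<exists>d>0. \<forall>s\<in>{0..}. dist s t < d \<longrightarrow> dist (S s f x) (S t f x) < e"
    by (auto simp: dist_real_def)
qed

lemma S_integrable_on:
  assumes "f \<in> C_0 T" "x \<in> topspace T" "a \<ge> 0"
  shows "(\<lambda>s. S s f x) integrable_on {a..b}"
  by (rule integrable_continuous_interval, rule continuous_on_subset[OF S_continuous_on_time[OF assms(1,2)]])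
     (use assms(3) in auto)

text \<open>The error does not depend on x. Membership in \<open>C_0\<close> and the action of
  \<open>S h\<close> thus pass from finite sums to the integral, without a vector-valued integral or
  an interchange of integrations.\<close>

lemma S_Riemann_sum:
  assumes f: "f \<in> C_0 T" and x: "x \<in> topspace T" and ad: "a \<ge> 0" "d \<ge> 0"
    and small: "\<And>h y. 0 \<le> h \<Longrightarrow> h \<le> d \<Longrightarrow> y \<in> topspace T \<Longrightarrow> \<bar>S h f y - f y\<bar> \<le> e"
  shows "\<bar>integral {a..a + real n * d} (\<lambda>s. S s f x) - (\<Sum>k<n. d * S (a + real k * d) f x)\<bar> \<le> real n * d * e"
proof (induction n)
  case (Suc n)
  define b where "b = a + real n * d"
  have b: "b \<ge> a" "b \<ge> 0" using ad by (auto simp: b_def)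
  have bd: "a + real (Suc n) * d = b + d" by (simp add: b_def algebra_simps)
  have split: "integral {a..b + d} (\<lambda>s. S s f x) = integral {a..b} (\<lambda>s. S s f x) + integral {b..b + d} (\<lambda>s. S s f x)"
    using S_integrable_on[OF f x ad(1)] b ad by (intro Henstock_Kurzweil_Integration.integral_combine[symmetric]) auto
  have "integral {b..b + d} (\<lambda>s. S s f x) - d * S b f x = integral {b..b + d} (\<lambda>s. S s f x - S b f x)"
    using S_integrable_on[OF f x b(2)] ad(2) by (subst Henstock_Kurzweil_Integration.integral_diff) auto
  also have "\<bar>\<dots>\<bar> \<le> integral {b..b + d} (\<lambda>s. e)"
  proof (rule integral_norm_bound_integral[where 'a=real, simplified real_norm_def])
    show "(\<lambda>s. S s f x - S b f x) integrable_on {b..b + d}"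
      using S_integrable_on[OF f x b(2)] by (intro Henstock_Kurzweil_Integration.integrable_diff) auto
    fix s assume s: "s \<in> {b..b + d}"
    have "\<bar>S (b + (s - b)) f x - S b f x\<bar> \<le> e"
      by (rule S_time_increment[OF f b(2) _ x]) (use s small in auto)
    then show "\<bar>S s f x - S b f x\<bar> \<le> e" by simp
  qed auto
  also have "\<dots> = d * e" using ad(2) by simp
  finally have "\<bar>integral {b..b + d} (\<lambda>s. S s f x) - d * S b f x\<bar> \<le> d * e" .
  moreover have "\<bar>integral {a..b} (\<lambda>s. S s f x) - (\<Sum>k<n. d * S (a + real k * d) f x)\<bar> \<le> real n * d * e"
    using Suc.IH by (simp only: b_def)
  moreover have "real (Suc n) * d * e = real n * d * e + d * e" by (simp add: algebra_simps)
  ultimately show ?case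
    unfolding bd split sum.lessThan_Suc b_def[symmetric] by linarith
qed simp

text \<open>The classical smoothing: the integral of \<open>S s f\<close> over [0, \<tau>] lies in
  the domain with image \<open>S \<tau> f - f\<close>, and divided by \<tau> it is close to
  f.\<close>

lemma gen_dom0_dense:
  assumes f: "f \<in> C_0 T" and e: "e > 0"
  obtains g where "g \<in> gen_dom0 T P" "\<And>x. x \<in> topspace T \<Longrightarrow> \<bar>g x - f x\<bar> \<le> e"
proof -
  obtain \<tau> where \<tau>: "\<tau> > 0"
    "\<And>h x. 0 \<le> h \<Longrightarrow> h \<le> \<tau> \<Longrightarrow> x \<in> topspace T \<Longrightarrow> \<bar>S h f x - f x\<bar> < e"
    using S_small[OF f e] by blast
  define A where "A x = (if x \<in> topspace T then integral {0..\<tau>} (\<lambda>s. S s f x) else 0)" for x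
  \<comment> \<open>The mesh divides \<tau> exactly, so that the Riemann sums end at \<tau>, and it
    is fine enough for the tolerance \<open>r\<close>.\<close>
  have app: "\<exists>n d. 0 < d \<and> real n * d = \<tau> \<and>
      (\<forall>h y. 0 \<le> h \<longrightarrow> h \<le> d \<longrightarrow> y \<in> topspace T \<longrightarrow> \<bar>S h f y - f y\<bar> \<le> r)" if r: "r > 0" for r
  proof -
    obtain \<delta> where d: "\<delta> > 0"
      "\<And>h x. 0 \<le> h \<Longrightarrow> h \<le> \<delta> \<Longrightarrow> x \<in> topspace T \<Longrightarrow> \<bar>S h f x - f x\<bar> < r"
      using S_small[OF f r] by blast
    obtain n where n: "\<tau> / \<delta> < real n" using reals_Archimedean2 by blast
    have n0: "real n > 0" using n \<tau>(1) d(1) by (meson divide_pos_pos less_trans)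
    have "\<tau> / real n \<le> \<delta>" using n n0 d(1) by (simp add: field_simps)
    then show ?thesis using d(2) n0 \<tau>(1)
      by (intro exI[of _ n] exI[of _ "\<tau> / real n"]) (auto intro: less_imp_le)
  qed
  have sumC: "(\<lambda>x. \<Sum>k<n. d * S (real k * d) f x) \<in> C_0 T" if "d > 0" for n :: nat and d
  proof (rule C_0_sum)
    fix k
    have "S (real k * d) f \<in> C_0 T" using S_C_0 f that by simp
    from C_0_linear[OF this this, of d 0] show "(\<lambda>x. d * S (real k * d) f x) \<in> C_0 T" by simp
  qed
  have AC: "A \<in> C_0 T"
  proof (rule C_0_uniform_limit)
    fix r :: real assume r: "r > 0"
    then have "r / (2 * \<tau>) > 0" using \<tau>(1) by simp
    from app[OF this] obtain n d where nd: "0 < d" "real n * d = \<tau>"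
      "\<And>h y. 0 \<le> h \<Longrightarrow> h \<le> d \<Longrightarrow> y \<in> topspace T \<Longrightarrow> \<bar>S h f y - f y\<bar> \<le> r / (2 * \<tau>)" by blast
    have "\<bar>(\<Sum>k<n. d * S (real k * d) f x) - A x\<bar> < r" if x: "x \<in> topspace T" for x
    proof -
      have "\<bar>integral {0..\<tau>} (\<lambda>s. S s f x) - (\<Sum>k<n. d * S (real k * d) f x)\<bar> \<le> \<tau> * (r / (2 * \<tau>))"
        using S_Riemann_sum[OF f x order_refl less_imp_le[OF nd(1)] nd(3), of n] nd(2) by simp
      also have "\<dots> < r" using r \<tau>(1) by simp
      finally show ?thesis using x by (simp add: A_def abs_minus_commute)
    qed
    then show "\<exists>g\<in>C_0 T. \<forall>x\<in>topspace T. \<bar>g x - A x\<bar> < r"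
      using sumC[OF nd(1), of n] by (intro bexI[of _ "\<lambda>x. \<Sum>k<n. d * S (real k * d) f x"] ballI)
  qed (simp add: vanishes_off_def A_def)
  \<comment> \<open>Applying \<open>S h\<close> to a Riemann sum shifts each of its times by h, by
    the semigroup property; the shifted sum approximates the integral over the shifted
    interval.\<close>
  have SA: "S h A x = integral {h..h + \<tau>} (\<lambda>s. S s f x)" if h: "h \<ge> 0" and x: "x \<in> topspace T" for h x
  proof -
    have "\<bar>S h A x - integral {h..h + \<tau>} (\<lambda>s. S s f x)\<bar> \<le> 0 + r" if r: "r > 0" for r
    proof -
      have "r / (2 * \<tau>) > 0" using \<tau>(1) r by simp
      from app[OF this] obtain n d where nd: "0 < d" "real n * d = \<tau>"
        "\<And>h y. 0 \<le> h \<Longrightarrow> h \<le> d \<Longrightarrow> y \<in> topspace T \<Longrightarrow> \<bar>S h f y - f y\<bar> \<le> r / (2 * \<tau>)" by blast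
      let ?R = "\<lambda>x. \<Sum>k<n. d * S (real k * d) f x"
      have bA: "bounded_measurable T A" and bR: "bounded_measurable T ?R"
        using AC sumC[OF nd(1)] bounded_measurable_C_0 by auto
      have "\<bar>A y - ?R y\<bar> \<le> r / 2" if y: "y \<in> topspace T" for y
        using S_Riemann_sum[OF f y order_refl less_imp_le[OF nd(1)] nd(3), of n] nd(2) y \<tau>(1) by (simp add: A_def)
      then have "\<bar>S h (\<lambda>y. A y - ?R y) x\<bar> \<le> r / 2"
        by (rule S_abs_le[OF bounded_measurable_diff[OF bA bR] h x])
      moreover have "S h ?R x = (\<Sum>k<n. d * S (h + real k * d) f x)"
      proof -
        have "integrable (P x) (\<lambda>w. S (real k * d) f (w h))" for k
          using S_integrable[OF S_bounded_measurable[OF bounded_measurable_C_0[OF f]] x h] nd(1) by simp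
        then have "S h ?R x = (\<Sum>k<n. d * S h (S (real k * d) f) x)"
          by (simp add: S_eq[OF x])
        then show ?thesis using S_add[OF C_0_B_b[OF f] h] nd(1) by simp
      qed
      moreover have "\<bar>integral {h..h + \<tau>} (\<lambda>s. S s f x) - (\<Sum>k<n. d * S (h + real k * d) f x)\<bar> \<le> r / 2"
        using S_Riemann_sum[OF f x h less_imp_le[OF nd(1)] nd(3), of n] nd(2) \<tau>(1) by simp
      ultimately show ?thesis unfolding S_diff[OF bA bR h] by linarith
    qed
    then have "\<bar>S h A x - integral {h..h + \<tau>} (\<lambda>s. S s f x)\<bar> \<le> 0" by (rule field_le_epsilon)
    then show ?thesis by simp
  qed
  have A: "A \<in> gen_dom0 T P"
  proof (rule gen_dom0I(1)[OF AC])
    have St: "S \<tau> f \<in> C_0 T" using S_C_0 f \<tau>(1) by simp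
    show "(\<lambda>x. S \<tau> f x - f x) \<in> C_0 T" using C_0_linear[OF St f, of 1 "-1"] by simp
    fix r :: real assume r: "r > 0"
    have r4: "r / 4 > 0" using r by simp
    obtain \<delta> where d: "\<delta> > 0"
      "\<And>h x. 0 \<le> h \<Longrightarrow> h \<le> \<delta> \<Longrightarrow> x \<in> topspace T \<Longrightarrow> \<bar>S h f x - f x\<bar> < r/4"
      using S_small[OF f r4] by blast
    have "\<bar>diff_quotient T P A h x - (S \<tau> f x - f x)\<bar> < r" if h: "0 < h" "h < \<delta>" and x: "x \<in> topspace T" for h x
    proof -
      \<comment> \<open>The shifted interval and [0, \<tau>] differ only by the end pieces
        [\<tau>, \<tau> + h] and [0, h], and each of these is estimated by a Riemann sum with a
        single term.\<close>
      let ?I = "\<lambda>a b. integral {a..b} (\<lambda>s. S s f x)"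
      have dd: "\<bar>S h' f y - f y\<bar> \<le> r/4" if "0 \<le> h'" "h' \<le> h" "y \<in> topspace T" for h' y
        using d(2)[of h' y] that h by simp
      have "?I 0 h + ?I h (h + \<tau>) = ?I 0 (h + \<tau>)" "?I 0 \<tau> + ?I \<tau> (h + \<tau>) = ?I 0 (h + \<tau>)"
        using h \<tau>(1) S_integrable_on[OF f x order_refl] by (auto intro!: Henstock_Kurzweil_Integration.integral_combine)
      moreover have "\<bar>?I \<tau> (\<tau> + h) - h * S \<tau> f x\<bar> \<le> h * (r/4)" "\<bar>?I 0 h - h * f x\<bar> \<le> h * (r/4)"
        using S_Riemann_sum[OF f x less_imp_le[OF \<tau>(1)] less_imp_le[OF h(1)] dd, of 1]
          S_Riemann_sum[OF f x order_refl less_imp_le[OF h(1)] dd, of 1]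
          S_0[OF bounded_measurable_C_0[OF f] x] by (simp_all add: mult.commute)
      moreover have "h * (S \<tau> f x - f x) = h * S \<tau> f x - h * f x" "h * (r/2) = h * (r/4) + h * (r/4)"
        by (simp_all add: algebra_simps)
      moreover have "S h A x - A x = ?I h (h + \<tau>) - ?I 0 \<tau>"
        unfolding SA[OF less_imp_le[OF h(1)] x] using x by (simp add: A_def)
      ultimately have "\<bar>(S h A x - A x) - h * (S \<tau> f x - f x)\<bar> \<le> h * (r/2)"
        unfolding add.commute[of \<tau> h] by linarith
      moreover have "(S h A x - A x) - h * (S \<tau> f x - f x) = h * (diff_quotient T P A h x - (S \<tau> f x - f x))"
      proof -
        have "h * diff_quotient T P A h x = S h A x - A x" using h(1) by (simp add: diff_quotient_def)
        then show ?thesis by (simp only: right_diff_distrib)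
      qed
      ultimately have "h * \<bar>diff_quotient T P A h x - (S \<tau> f x - f x)\<bar> \<le> h * (r/2)"
        using h(1) by (simp add: abs_mult)
      then have "\<bar>diff_quotient T P A h x - (S \<tau> f x - f x)\<bar> \<le> r/2" using h(1) by simp
      then show ?thesis using r by simp
    qed
    then show "\<exists>\<delta>>0. \<forall>t x. 0 < t \<longrightarrow> t < \<delta> \<longrightarrow> x \<in> topspace T \<longrightarrow>
        \<bar>diff_quotient T P A t x - (S \<tau> f x - f x)\<bar> < r" using d(1) by blast
  qed
  show ?thesis
  proof
    show "(\<lambda>x. A x / \<tau>) \<in> gen_dom0 T P" using gen_dom0_linear[OF A A, of "1/\<tau>" 0] by simp
    fix x assume x: "x \<in> topspace T"
    have "\<bar>A x - \<tau> * f x\<bar> \<le> \<tau> * e"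
      using S_Riemann_sum[OF f x order_refl less_imp_le[OF \<tau>(1)] less_imp_le[OF \<tau>(2)], of 1]
        S_0[OF bounded_measurable_C_0[OF f] x] x by (simp add: A_def)
    moreover have "A x - \<tau> * f x = \<tau> * (A x / \<tau> - f x)" using \<tau>(1) by (simp add: algebra_simps)
    ultimately have "\<tau> * \<bar>A x / \<tau> - f x\<bar> \<le> \<tau> * e" using \<tau>(1) by (simp add: abs_mult)
    then show "\<bar>A x / \<tau> - f x\<bar> \<le> e" using \<tau>(1) by simp
  qed
qed

end

section \<open>Processes mapped onto each other\<close>

lemma jointly_continuous_compose:
  assumes v: "jointly_continuous T v" and p: "continuous_map T' T p"
  shows "jointly_continuous T' (\<lambda>t x. v t (p x))"
proof (rule jointly_continuousI)
  fix t e :: real and x assume t: "t \<ge> 0" and x: "x \<in> topspace T'" and e: "e > 0"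
  have px: "p x \<in> topspace T" using p x by (auto simp: continuous_map_def)
  obtain \<delta> U where U: "\<delta> > 0" "openin T U" "p x \<in> U"
    "\<And>s y. s \<ge> 0 \<Longrightarrow> y \<in> U \<Longrightarrow> \<bar>s - t\<bar> < \<delta> \<Longrightarrow> \<bar>v s y - v t (p x)\<bar> < e"
    using jointly_continuousD[OF v t px e] by metis
  have "openin T' {x \<in> topspace T'. p x \<in> U}" using p U(2) by (simp add: continuous_map_def)
  then show "\<exists>\<delta>>0. \<exists>U. openin T' U \<and> x \<in> U \<and> (\<forall>s\<ge>0. \<forall>y\<in>U. \<bar>s - t\<bar> < \<delta> \<longrightarrow> \<bar>v s (p y) - v t (p x)\<bar> < e)"
    using U x by (intro exI[of _ \<delta>] conjI exI[of _ "{x \<in> topspace T'. p x \<in> U}"]) auto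
qed

text \<open>The value 0 off \<open>T'\<close> is imposed, since nothing is known about
  \<open>p\<close> there.\<close>

definition pullback :: "'b topology \<Rightarrow> ('b \<Rightarrow> 'a) \<Rightarrow> ('a \<Rightarrow> real) \<Rightarrow> 'b \<Rightarrow> real" where
  "pullback T' p f x = (if x \<in> topspace T' then f (p x) else 0)"

lemma pullback_C_b:
  assumes "continuous_map T' T p" "f \<in> C_b T"
  shows "pullback T' p f \<in> C_b T'"
proof -
  obtain C where C: "\<And>x. \<bar>f x\<bar> \<le> C" using assms by (auto simp: C_b_def bounded_range_real_iff)
  have "continuous_map T' euclideanreal (f \<circ> p)"
    using assms continuous_map_compose by (auto simp: C_b_def)
  then have "continuous_map T' euclideanreal (pullback T' p f)"
    by (rule continuous_map_eq) (simp add: pullback_def)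
  moreover have "\<bar>pullback T' p f x\<bar> \<le> max C 0" for x
    using C[of "p x"] by (auto simp: pullback_def)
  moreover have "vanishes_off T' (pullback T' p f)"
    by (simp add: vanishes_off_def pullback_def)
  ultimately show ?thesis
    unfolding C_b_def mem_Collect_eq bounded_range_real_iff by blast
qed

lemma pullback_B_b:
  assumes "p \<in> borel_of T' \<rightarrow>\<^sub>M borel_of T" "f \<in> B_b T"
  shows "pullback T' p f \<in> B_b T'"
proof -
  obtain C where C: "\<And>x. \<bar>f x\<bar> \<le> C" using assms by (auto simp: B_b_def bounded_range_real_iff)
  have "(\<lambda>x. f (p x)) \<in> borel_measurable (borel_of T')"
    using assms measurable_compose by (auto simp: B_b_def)
  then have "pullback T' p f \<in> borel_measurable (borel_of T')"
    by (rule measurable_cong[THEN iffD1, rotated]) (simp add: pullback_def)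
  moreover have "\<bar>pullback T' p f x\<bar> \<le> max C 0" for x
    using C[of "p x"] by (auto simp: pullback_def)
  moreover have "vanishes_off T' (pullback T' p f)"
    by (simp add: vanishes_off_def pullback_def)
  ultimately show ?thesis
    unfolding B_b_def mem_Collect_eq bounded_range_real_iff by blast
qed

context feller_semigroup
begin

text \<open>\<open>S s\<close> commutes with difference quotients and is a contraction, hence
  preserves their uniform convergence.\<close>

lemma gen_dom0_S:
  assumes f: "f \<in> gen_dom0 T P" and s: "s \<ge> 0"
  shows "S s f \<in> gen_dom0 T P" and "gen T P (S s f) = S s (gen T P f)"
proof -
  have f0: "f \<in> C_0 T" and g0: "gen T P f \<in> C_0 T" using gen_dom0_C_0[OF f] gen_C_0[OF f] by auto
  have fb: "bounded_measurable T f" and gb: "bounded_measurable T (gen T P f)"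
    using f0 g0 bounded_measurable_C_0 by auto
  have lim: "\<exists>\<delta>>0. \<forall>t x. 0 < t \<longrightarrow> t < \<delta> \<longrightarrow> x \<in> topspace T \<longrightarrow>
      \<bar>diff_quotient T P (S s f) t x - S s (gen T P f) x\<bar> < e" if e: "e > 0" for e
  proof -
    obtain \<delta> where d: "\<delta> > 0"
      "\<And>t x. 0 < t \<Longrightarrow> t < \<delta> \<Longrightarrow> x \<in> topspace T \<Longrightarrow> \<bar>diff_quotient T P f t x - gen T P f x\<bar> < e/2"
      using gen_dom0D[OF f half_gt_zero[OF e]] by blast
    have "\<bar>diff_quotient T P (S s f) t x - S s (gen T P f) x\<bar> < e"
      if t: "0 < t" "t < \<delta>" and x: "x \<in> topspace T" for t x
    proof -
      have Sb: "bounded_measurable T (S t f)" using S_bounded_measurable[OF fb] t by simp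
      have db: "bounded_measurable T (diff_quotient T P f t)"
        using bounded_measurable_linear[OF Sb fb, of "1/t" "-1/t"]
        by (simp add: diff_quotient_def[abs_def] diff_divide_distrib)
      have "S t (S s f) x = S s (S t f) x"
        using S_add[OF C_0_B_b[OF f0], of t s x] S_add[OF C_0_B_b[OF f0], of s t x] s t by (simp add: add.commute)
      moreover have "S s (diff_quotient T P f t) x = (S s (S t f) x - S s f x) / t"
        using S_linear[OF Sb fb s, of "1/t" "-1/t" x]
        by (simp add: diff_quotient_def[abs_def] diff_divide_distrib)
      ultimately have "diff_quotient T P (S s f) t x = S s (diff_quotient T P f t) x"
        by (simp add: diff_quotient_def)
      moreover have "\<bar>S s (\<lambda>y. diff_quotient T P f t y - gen T P f y) x\<bar> \<le> e/2"
        by (rule S_abs_le[OF bounded_measurable_diff[OF db gb] s x less_imp_le[OF d(2)[OF t]]])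
      ultimately show ?thesis using S_diff[OF db gb s, of x] e by simp
    qed
    then show ?thesis using d(1) by blast
  qed
  show "S s f \<in> gen_dom0 T P" "gen T P (S s f) = S s (gen T P f)"
    using gen_dom0I[OF S_C_0[OF s f0] S_C_0[OF s g0] lim] by auto
qed

end

text \<open>\<open>p\<close> stands for a coordinate projection. Pullback along it keeps
  \<open>C_b\<close> but in general not \<open>C_0\<close>, which is why the process on
  \<open>T'\<close> enters through its extended generator.\<close>

locale feller_map = X: feller_semigroup T P + Y: feller_semigroup T' Q
  for T :: "'a topology" and P and T' :: "'b topology" and Q +
  fixes p :: "'b \<Rightarrow> 'a"
  assumes cont: "continuous_map T' T p"
begin

abbreviation pb :: "('a \<Rightarrow> real) \<Rightarrow> 'b \<Rightarrow> real" where "pb \<equiv> pullback T' p"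

lemma p_in: "x \<in> topspace T' \<Longrightarrow> p x \<in> topspace T"
  using cont by (auto simp: continuous_map_def)

text \<open>Along the flow of \<open>T\<close> the pulled back function changes with \<open>h\<close>; only the uniformity of
  \<open>diff_quotient_estimate\<close> in the function makes a pointwise statement available.\<close>

lemma pullback_infinitesimal:
  assumes gen: "\<And>f. f \<in> gen_dom0 T P \<Longrightarrow> pb f \<in> gen_dom T' Q \<and> gen T' Q (pb f) = pb (gen T P f)"
    and f: "f \<in> gen_dom0 T P" and t: "t > 0" and x: "x \<in> topspace T'" and e: "e > 0"
  shows "\<forall>\<^sub>F h in at_right 0. \<bar>Y.S h (pb (X.S (t - h) f)) x - X.S t f (p x)\<bar> \<le> e * h"
proof -
  let ?L = "gen T P f"
  have f0: "f \<in> C_0 T" and L0: "?L \<in> C_0 T" using X.gen_dom0_C_0[OF f] X.gen_C_0[OF f] by auto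
  have fb: "bounded_measurable T f" and Lb: "bounded_measurable T ?L"
    using f0 L0 bounded_measurable_C_0 by auto
  \<comment> \<open>Four equal shares: two for the quotient of the process on \<open>T'\<close>, one
    for the quotient on \<open>T\<close>, one for moving the image from time s to time t.\<close>
  define r where "r = e/4"
  have r: "r > 0" using e by (simp add: r_def)
  have gC: "pb (X.S t ?L) \<in> C_b T'"
    using pullback_C_b[OF cont] X.S_C_0[OF _ L0, of t] t C_0_subset_C_b by auto
  have K: "compactin T' {x}" using x by simp
  from Y.diff_quotient_estimate[OF gC K r]
  obtain t0 where t0: "t0 > 0" and est: "\<forall>k k' d t' x'. k \<in> C_b T' \<longrightarrow>
      (\<forall>x\<in>topspace T'. ((\<lambda>h. diff_quotient T' Q k h x) \<longlongrightarrow> k' x) (at_right 0)) \<longrightarrow>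
      (\<forall>x\<in>topspace T'. \<bar>k' x - pb (X.S t ?L) x\<bar> \<le> d) \<longrightarrow> 0 < t' \<longrightarrow> t' \<le> t0 \<longrightarrow> x' \<in> {x} \<longrightarrow>
      \<bar>diff_quotient T' Q k t' x' - pb (X.S t ?L) x'\<bar> \<le> r + d" by (elim exE conjE)
  obtain \<delta>1 where 1: "\<delta>1 > 0"
    "\<And>h y. 0 \<le> h \<Longrightarrow> h \<le> \<delta>1 \<Longrightarrow> y \<in> topspace T \<Longrightarrow> \<bar>X.S h ?L y - ?L y\<bar> < r"
    using X.S_small[OF L0 r] by blast
  obtain \<delta>2 where 2: "\<delta>2 > 0"
    "\<And>h y. 0 < h \<Longrightarrow> h < \<delta>2 \<Longrightarrow> y \<in> topspace T \<Longrightarrow> \<bar>diff_quotient T P f h y - ?L y\<bar> < r"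
    using X.gen_dom0D[OF f r] by blast
  have "\<bar>Y.S h (pb (X.S (t - h) f)) x - X.S t f (p x)\<bar> \<le> e * h"
    if h: "0 < h" "h < min (min t t0) (min \<delta>1 \<delta>2)" for h
  proof -
    define s where "s = t - h"
    have s: "s \<ge> 0" "s + h = t" using h by (auto simp: s_def)
    let ?u = "X.S s f"
    have u: "?u \<in> gen_dom0 T P" "gen T P ?u = X.S s ?L" using X.gen_dom0_S[OF f s(1)] by auto
    have inc: "\<bar>X.S t ?L y - X.S s ?L y\<bar> \<le> r" if y: "y \<in> topspace T" for y
      using X.S_time_increment[OF L0 s(1) less_imp_le[OF h(1)] y less_imp_le[OF 1(2)]] h s(2) by simp
    have "\<bar>diff_quotient T' Q (pb ?u) h x - pb (X.S t ?L) x\<bar> \<le> r + r"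
    proof (rule est[rule_format])
      show "pb ?u \<in> C_b T'" using gen[OF u(1)] Y.gen_dom_C_b by blast
      show "((\<lambda>h. diff_quotient T' Q (pb ?u) h y) \<longlongrightarrow> pb (X.S s ?L) y) (at_right 0)"
        if "y \<in> topspace T'" for y
        using Y.gen_tendsto[OF _ that] gen[OF u(1)] u(2) by metis
      show "\<bar>pb (X.S s ?L) y - pb (X.S t ?L) y\<bar> \<le> r" if "y \<in> topspace T'" for y
        using inc[OF p_in[OF that]] that by (simp add: pullback_def abs_minus_commute)
    qed (use h in auto)
    then have A: "\<bar>(Y.S h (pb ?u) x - X.S s f (p x)) / h - X.S t ?L (p x)\<bar> \<le> 2 * r"
      using x by (simp add: diff_quotient_def pullback_def)
    have Sb: "bounded_measurable T (X.S h f)" using X.S_bounded_measurable[OF fb] h by simp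
    have db: "bounded_measurable T (diff_quotient T P f h)"
      using bounded_measurable_linear[OF Sb fb, of "1/h" "-1/h"]
      by (simp add: diff_quotient_def[abs_def] diff_divide_distrib)
    have "X.S s (diff_quotient T P f h) (p x) = (X.S t f (p x) - X.S s f (p x)) / h"
      using X.S_linear[OF Sb fb s(1), of "1/h" "-1/h" "p x"] X.S_add[OF X.C_0_B_b[OF f0] s(1), of h "p x"] h s(2)
      by (simp add: diff_quotient_def[abs_def] diff_divide_distrib)
    moreover have "\<bar>X.S s (\<lambda>y. diff_quotient T P f h y - ?L y) (p x)\<bar> \<le> r"
      by (rule X.S_abs_le[OF bounded_measurable_diff[OF db Lb] s(1) p_in[OF x] less_imp_le[OF 2(2)[OF h(1)]]])
         (use h in auto)
    ultimately have B: "\<bar>(X.S t f (p x) - X.S s f (p x)) / h - X.S s ?L (p x)\<bar> \<le> r"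
      using X.S_diff[OF db Lb s(1), of "p x"] by simp
    \<comment> \<open>\<open>X.S s f (p x)\<close> is inserted as the common starting value: both
      semigroups act for a time h on the same function, one after and one before the pullback, with
      the same derivative to leading order.\<close>
    have "Y.S h (pb ?u) x - X.S t f (p x)
        = h * ((Y.S h (pb ?u) x - X.S s f (p x)) / h - (X.S t f (p x) - X.S s f (p x)) / h)"
      using h(1) by (simp add: diff_divide_distrib[symmetric])
    also have "\<bar>\<dots>\<bar> \<le> h * e"
    proof -
      have "\<bar>(Y.S h (pb ?u) x - X.S s f (p x)) / h - (X.S t f (p x) - X.S s f (p x)) / h\<bar> \<le> e"
        using A B inc[OF p_in[OF x]] unfolding r_def by linarith
      then show ?thesis using h(1) by (simp add: abs_mult)
    qed
    finally show ?thesis by (simp add: s_def mult.commute)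
  qed
  then show ?thesis
    unfolding eventually_at_right_field using t t0 1 2
    by (intro exI[of _ "min (min t t0) (min \<delta>1 \<delta>2)"]) auto
qed

lemma semigroup_pullback:
  assumes gen: "\<And>f. f \<in> gen_dom0 T P \<Longrightarrow> pb f \<in> gen_dom T' Q \<and> gen T' Q (pb f) = pb (gen T P f)"
    and f: "f \<in> C_0 T" and t: "t \<ge> 0" and x: "x \<in> topspace T'"
  shows "Y.S t (pb f) x = X.S t f (p x)"
proof -
  have dom: "Y.S t (pb f) x = X.S t f (p x)" if f: "f \<in> gen_dom0 T P" for f
  proof -
    have f0: "f \<in> C_0 T" using X.gen_dom0_C_0[OF f] .
    have fb: "bounded_measurable T f" using f0 bounded_measurable_C_0 by auto
    have pC: "pb f \<in> C_b T'" using gen[OF f] Y.gen_dom_C_b by blast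
    have pB: "pb f \<in> B_b T'" using pC C_b_subset_B_b by blast
    have pbm: "bounded_measurable T' (pb f)" using pC bounded_measurable_C_b by auto
    have "f \<in> C_b T" using f0 C_0_subset_C_b by blast
    then obtain C where C: "\<And>x. \<bar>f x\<bar> \<le> C" by (auto simp: C_b_def bounded_range_real_iff)
    have C0: "C \<ge> 0" using C[of undefined] by linarith
    have pbC: "\<bar>pb f y\<bar> \<le> C" for y using C[of "p y"] C0 by (auto simp: pullback_def)
    \<comment> \<open>The maximum principle is one-sided; \<open>c\<close> is the sign by which it
      is applied to the difference and to its negative.\<close>
    have le: "c * (Y.S t (pb f) x - X.S t f (p x)) \<le> 0" if c: "\<bar>c\<bar> = 1" for c
    proof -
      define v where "v t x = c * (Y.S t (pb f) x - X.S t f (p x))" for t x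
      have "jointly_continuous T' (\<lambda>t x. c * (Y.S t (pb f) x - X.S t f (p x)))"
        by (intro jointly_continuous_mult jointly_continuous_const jointly_continuous_diff
            Y.S_jointly_continuous[OF pC] jointly_continuous_compose[OF X.S_jointly_continuous_C_0[OF f0] cont])
      then have vc: "jointly_continuous T' v" by (simp add: v_def[abs_def])
      have "v t x \<le> 0"
      proof (rule Y.maximum_principle[OF vc, of t "2 * C"])
        fix s y assume s: "0 \<le> s" "s \<le> t" and y: "y \<in> topspace T'"
        have "\<bar>Y.S s (pb f) y\<bar> \<le> C" "\<bar>X.S s f (p y)\<bar> \<le> C"
          using Y.S_abs_le[OF pbm s(1) y pbC] X.S_abs_le[OF fb s(1) p_in[OF y] C] by auto
        then show "\<bar>v s y\<bar> \<le> 2 * C" unfolding v_def abs_mult c mult_1 by linarith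
      next
        fix y assume y: "y \<in> topspace T'"
        show "v 0 y \<le> 0"
          using Y.S_0[OF pbm y] X.S_0[OF fb p_in[OF y]] y by (simp add: v_def pullback_def)
      next
        fix s y and e :: real assume s: "0 < s" "s \<le> t" and y: "y \<in> topspace T'" and e: "e > 0"
        have "\<forall>\<^sub>F h in at_right 0. 0 < h \<and> h < s"
          using s(1) unfolding eventually_at_right_field by blast
        moreover have "\<forall>\<^sub>F h in at_right 0. \<bar>Y.S h (pb (X.S (s - h) f)) y - X.S s f (p y)\<bar> \<le> e * h"
          by (rule pullback_infinitesimal[OF gen f s(1) y e])
        ultimately show "\<forall>\<^sub>F h in at_right 0. v s y \<le> Y.S h (v (s - h)) y + e * h"
        proof eventually_elim
          case (elim h)
          then have h: "0 < h" "h < s" by auto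
          have b1: "bounded_measurable T' (Y.S (s - h) (pb f))"
            using Y.S_bounded_measurable[OF pbm] h by simp
          have "X.S (s - h) f \<in> C_b T" using X.S_C_0[OF _ f0, of "s - h"] h C_0_subset_C_b by auto
          then have b2: "bounded_measurable T' (pb (X.S (s - h) f))"
            using pullback_C_b[OF cont] bounded_measurable_C_b by blast
          have "Y.S h (v (s - h)) y = Y.S h (\<lambda>z. c * Y.S (s - h) (pb f) z + (-c) * pb (X.S (s - h) f) z) y"
            using h by (intro Y.S_cong) (auto simp: v_def pullback_def algebra_simps)
          also have "\<dots> = c * Y.S s (pb f) y - c * Y.S h (pb (X.S (s - h) f)) y"
            using Y.S_linear[OF b1 b2, of h c "-c" y] Y.S_add[OF pB, of h "s - h" y] h by simp
          \<comment> \<open>The contribution of \<open>Y.S s (pb f)\<close> cancels by the semigroup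
            property, leaving only the defect controlled by
            \<open>pullback_infinitesimal\<close>.\<close>
          finally have "v s y - Y.S h (v (s - h)) y = c * (Y.S h (pb (X.S (s - h) f)) y - X.S s f (p y))"
            by (simp add: v_def algebra_simps)
          also have "\<dots> \<le> \<bar>\<dots>\<bar>" by (rule abs_ge_self)
          also have "\<dots> \<le> e * h" using elim(2) unfolding abs_mult c by simp
          finally show ?case by simp
        qed
      qed (use t x in auto)
      then show ?thesis by (simp add: v_def)
    qed
    show ?thesis using le[of 1] le[of "-1"] by simp
  qed
  have fb: "bounded_measurable T f" using f bounded_measurable_C_0 by auto
  have "f \<in> C_b T" using f C_0_subset_C_b by blast
  then have pbm: "bounded_measurable T' (pb f)"
    using pullback_C_b[OF cont] bounded_measurable_C_b by blast
  have "\<bar>Y.S t (pb f) x - X.S t f (p x)\<bar> \<le> 0 + e" if e: "e > 0" for e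
  proof -
    obtain g where g: "g \<in> gen_dom0 T P" "\<And>x. x \<in> topspace T \<Longrightarrow> \<bar>g x - f x\<bar> \<le> e/2"
      using X.gen_dom0_dense[OF f half_gt_zero[OF e]] by blast
    have gb: "bounded_measurable T g" using X.gen_dom0_C_0[OF g(1)] bounded_measurable_C_0 by auto
    have gp: "bounded_measurable T' (pb g)" using gen[OF g(1)] Y.gen_dom_C_b bounded_measurable_C_b by blast
    have "\<bar>X.S t (\<lambda>y. g y - f y) (p x)\<bar> \<le> e/2"
      by (rule X.S_abs_le[OF bounded_measurable_diff[OF gb fb] t p_in[OF x] g(2)])
    moreover have "\<bar>Y.S t (\<lambda>y. pb g y - pb f y) x\<bar> \<le> e/2"
      by (rule Y.S_abs_le[OF bounded_measurable_diff[OF gp pbm] t x])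
         (use g(2) p_in in \<open>auto simp: pullback_def\<close>)
    ultimately show ?thesis
      using X.S_diff[OF gb fb t, of "p x"] Y.S_diff[OF gp pbm t, of x] dom[OF g(1)] by linarith
  qed
  then have "\<bar>Y.S t (pb f) x - X.S t f (p x)\<bar> \<le> 0" by (rule field_le_epsilon)
  then show ?thesis by simp
qed

end

section \<open>Finite-dimensional distributions and laws of paths\<close>

lemma B_b_mult:
  assumes "f \<in> B_b T" "g \<in> B_b T"
  shows "(\<lambda>x. f x * g x) \<in> B_b T"
proof -
  obtain C D where C: "\<And>x. \<bar>f x\<bar> \<le> C" and D: "\<And>x. \<bar>g x\<bar> \<le> D"
    using assms by (auto simp: B_b_def bounded_range_real_iff)
  have "\<bar>f x * g x\<bar> \<le> C * D" for x
    unfolding abs_mult using C[of x] D[of x] by (intro mult_mono) auto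
  then show ?thesis
    using assms unfolding B_b_def vanishes_off_def mem_Collect_eq bounded_range_real_iff by auto
qed

lemma indicator_B_b: "A \<in> sets (borel_of T) \<Longrightarrow> indicator A \<in> B_b T"
  using sets.sets_into_space[of A "borel_of T"]
  by (auto simp: B_b_def vanishes_off_def bounded_range_real_iff indicator_def)

text \<open>The indicator of a cylinder set is a finite product of indicators of evaluations.
  Uniqueness is obtained on the full product over all times, of which the path space carries the
  trace sigma-algebra.\<close>

lemma path_measure_eqI:
  assumes M: "prob_space M" "sets M = sets (path_space T)" and N: "prob_space N" "sets N = sets (path_space T)"
    and eq: "\<And>J f. finite J \<Longrightarrow> J \<subseteq> {0..} \<Longrightarrow> (\<And>t. f t \<in> B_b T) \<Longrightarrow>
      (\<integral>w. (\<Prod>t\<in>J. f t (w t)) \<partial>M) = (\<integral>w. (\<Prod>t\<in>J. f t (w t)) \<partial>N)"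
  shows "M = N"
proof -
  let ?\<Pi> = "\<Pi>\<^sub>M t\<in>{0..}. borel_of T"
  have inc: "(\<lambda>w. w) \<in> path_space T \<rightarrow>\<^sub>M ?\<Pi>"
    unfolding path_space_def by (rule measurable_restrict_space1) simp
  have incM: "(\<lambda>w. w) \<in> M \<rightarrow>\<^sub>M ?\<Pi>" and incN: "(\<lambda>w. w) \<in> N \<rightarrow>\<^sub>M ?\<Pi>"
    using inc M(2) N(2) by (auto cong: measurable_cong_sets)
  have sp: "space M = cadlag T" "space N = cadlag T"
    using sets_eq_imp_space_eq[OF M(2)] sets_eq_imp_space_eq[OF N(2)] by (auto simp: space_path_space)
  have "distr M ?\<Pi> (\<lambda>w. w) = distr N ?\<Pi> (\<lambda>w. w)"
  proof (rule measure_eqI_PiM_infinite)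
    fix A and J :: "real set" assume J: "finite J" "J \<subseteq> {0..}" and A: "\<And>t. t \<in> J \<Longrightarrow> A t \<in> sets (borel_of T)"
    let ?B = "prod_emb {0..} (\<lambda>_. borel_of T) J (Pi\<^sub>E J A)"
    have B: "?B \<in> sets ?\<Pi>" using J A by (intro sets_PiM_I) auto
    \<comment> \<open>\<open>A t\<close> is known to be measurable for t in \<open>J\<close> only,
      whereas the hypothesis expects a function in \<open>B_b\<close> at every time.\<close>
    define f where "f t = (if t \<in> J then indicator (A t) else (\<lambda>_. 0 :: real))" for t
    have f: "f t \<in> B_b T" for t
      using A indicator_B_b by (auto simp: f_def B_b_def vanishes_off_def)
    have ind: "indicator ?B w = (\<Prod>t\<in>J. f t (w t))" if w: "w \<in> cadlag T" for w
    proof -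
      have ext: "w \<in> extensional {0..}" "\<And>t. t \<ge> 0 \<Longrightarrow> w t \<in> topspace T"
        using w by (auto simp: cadlag_def PiE_iff)
      then have "w \<in> ?B \<longleftrightarrow> (\<forall>t\<in>J. w t \<in> A t)" using J(2) by (auto simp: prod_emb_def PiE_iff)
      moreover have "(\<Prod>t\<in>J. f t (w t)) = (if \<forall>t\<in>J. w t \<in> A t then 1 else 0)"
        using J(1) by (auto simp: f_def indicator_eq_0_iff intro!: prod.neutral prod_zero)
      ultimately show ?thesis by (simp add: indicator_def)
    qed
    have *: "emeasure (distr L ?\<Pi> (\<lambda>w. w)) ?B = ennreal (\<integral>w. (\<Prod>t\<in>J. f t (w t)) \<partial>L)"
      if L: "prob_space L" "(\<lambda>w. w) \<in> L \<rightarrow>\<^sub>M ?\<Pi>" "space L = cadlag T" for L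
    proof -
      interpret L: prob_space L by fact
      have BL: "?B \<inter> space L \<in> sets L" using measurable_sets[OF L(2) B] by simp
      have "emeasure (distr L ?\<Pi> (\<lambda>w. w)) ?B = emeasure L (?B \<inter> space L)"
        using emeasure_distr[OF L(2) B] by simp
      also have "\<dots> = ennreal (measure L (?B \<inter> space L))" by (rule L.emeasure_eq_measure)
      also have "measure L (?B \<inter> space L) = (\<integral>w. indicator ?B w \<partial>L)" by simp
      also have "\<dots> = (\<integral>w. (\<Prod>t\<in>J. f t (w t)) \<partial>L)"
        by (intro Bochner_Integration.integral_cong) (auto simp: ind L(3))
      finally show ?thesis .
    qed
    show "emeasure (distr M ?\<Pi> (\<lambda>w. w)) ?B = emeasure (distr N ?\<Pi> (\<lambda>w. w)) ?B"
      using *[OF M(1) incM sp(1)] *[OF N(1) incN sp(2)] eq[OF J f] by simp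
  next
    interpret prob_space "distr M ?\<Pi> (\<lambda>w. w)" using M(1) incM by (rule prob_space.prob_space_distr)
    show "finite_measure (distr M ?\<Pi> (\<lambda>w. w))" by unfold_locales
  qed auto
  note d = this
  show ?thesis
  proof (rule measure_eqI)
    show "sets M = sets N" using M N by simp
    fix A assume "A \<in> sets M"
    then obtain B where B: "B \<in> sets ?\<Pi>" "A = B \<inter> cadlag T"
      unfolding M(2) path_space_def sets_restrict_space by auto
    have "emeasure M (B \<inter> space M) = emeasure N (B \<inter> space N)"
      using arg_cong[OF d, of "\<lambda>L. emeasure L B"] emeasure_distr[OF incM B(1)] emeasure_distr[OF incN B(1)] by simp
    then show "emeasure M A = emeasure N A" using B(2) sp by simp
  qed
qed

context markov_semigroup
begin

text \<open>The latest time is integrated out: its factor is moved to the preceding time by the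
  semigroup and merged with the factor there. This lowers the number of times by one while keeping
  the shape of the product.\<close>

lemma markov_product:
  fixes J :: "real set"
  assumes x: "x \<in> topspace T" and J: "finite J" "J \<noteq> {}" "J \<subseteq> {0..}" and b: "Max J < b"
    and F: "\<And>t. F t \<in> B_b T"
  shows "(\<integral>w. (\<Prod>t\<in>insert b J. F t (w t)) \<partial>P x) =
    (\<integral>w. (\<Prod>t\<in>J. (F(Max J := \<lambda>y. F (Max J) y * S (b - Max J) (F b) y)) t (w t)) \<partial>P x)"
proof -
  define s where "s = Max J"
  have s: "s \<in> J" "s \<ge> 0" "s < b"
    using Max_in[OF J(1,2)] subsetD[OF J(3), of s] b by (simp_all add: s_def)
  have bJ: "b \<notin> J" using b Max_ge[OF J(1), of b] by auto
  obtain C where C: "\<And>t y. \<bar>F t y\<bar> \<le> C t"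
    using F unfolding B_b_def mem_Collect_eq bounded_range_real_iff by metis
  have "(\<integral>w. (\<Prod>t\<in>insert b J. F t (w t)) \<partial>P x) = (\<integral>w. (\<Prod>t\<in>J. F t (w t)) * F b (w (s + (b - s))) \<partial>P x)"
    using J(1) bJ by (simp add: mult.commute)
  also have "\<dots> = (\<integral>w. (\<Prod>t\<in>J. F t (w t)) * S (b - s) (F b) (w s) \<partial>P x)"
  proof (rule markov_integral[OF x s(2) _ F, where C="\<Prod>t\<in>J. C t"])
    show "(\<lambda>w. \<Prod>t\<in>J. F t (w t)) \<in> borel_measurable (filtration T s)"
    proof (rule borel_measurable_prod)
      fix t assume "t \<in> J"
      then have "0 \<le> t" "t \<le> s" using J by (auto simp: s_def)
      then show "(\<lambda>w. F t (w t)) \<in> borel_measurable (filtration T s)"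
        using measurable_compose[OF eval_filtration_measurable] F[of t] by (auto simp: B_b_def)
    qed
    show "\<bar>\<Prod>t\<in>J. F t (w t)\<bar> \<le> (\<Prod>t\<in>J. C t)" for w
      unfolding abs_prod by (intro prod_mono) (simp add: C)
  qed (use s in auto)
  also have "\<dots> = (\<integral>w. (\<Prod>t\<in>J. (F(s := \<lambda>y. F s y * S (b - s) (F b) y)) t (w t)) \<partial>P x)"
  proof -
    have "(\<Prod>t\<in>J. F t (w t)) * c = (\<Prod>t\<in>J. (F(s := \<lambda>y. F s y * c' y)) t (w t))" if "c = c' (w s)" for w c c'
      unfolding prod.remove[OF J(1) s(1)] that by simp
    then show ?thesis by (intro Bochner_Integration.integral_cong) auto
  qed
  finally show ?thesis by (simp add: s_def)
qed

end

lemma cadlag_map: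
  assumes p: "continuous_map T' T p" and w: "w \<in> cadlag T'"
  shows "(\<lambda>t\<in>{0..}. p (w t)) \<in> cadlag T"
proof -
  have in': "\<And>t. t \<ge> 0 \<Longrightarrow> w t \<in> topspace T'"
    and r: "\<And>t. t \<ge> 0 \<Longrightarrow> limitin T' w (w t) (at_right t)"
    and l: "\<And>t. t > 0 \<Longrightarrow> \<exists>l. limitin T' w l (at_left t)"
    using w by (auto simp: cadlag_def)
  have "limitin T (\<lambda>t\<in>{0..}. p (w t)) (p (w t)) (at_right t)" if t: "t \<ge> 0" for t
  proof (rule limitin_transform_eventually[OF _ continuous_map_limit[OF p r[OF t]]])
    show "\<forall>\<^sub>F s in at_right t. (p \<circ> w) s = (\<lambda>t\<in>{0..}. p (w t)) s"
      unfolding eventually_at_right_field using t by (intro exI[of _ "t + 1"]) auto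
  qed
  moreover have "\<exists>l. limitin T (\<lambda>t\<in>{0..}. p (w t)) l (at_left t)" if t: "t > 0" for t
  proof -
    obtain l where l: "limitin T' w l (at_left t)" using l[OF t] by blast
    have "limitin T (\<lambda>t\<in>{0..}. p (w t)) (p l) (at_left t)"
    proof (rule limitin_transform_eventually[OF _ continuous_map_limit[OF p l]])
      show "\<forall>\<^sub>F s in at_left t. (p \<circ> w) s = (\<lambda>t\<in>{0..}. p (w t)) s"
        unfolding eventually_at_left_field using t by (intro exI[of _ 0]) auto
    qed
    then show ?thesis by blast
  qed
  ultimately show ?thesis
    using p in' by (auto simp: cadlag_def continuous_map_def)
qed

lemma path_map_measurable:
  assumes p: "continuous_map T' T p"
  shows "(\<lambda>w. \<lambda>t\<in>{0..}. p (w t)) \<in> path_space T' \<rightarrow>\<^sub>M path_space T"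
  unfolding path_space_def[of T]
proof (rule measurable_restrict_space2)
  show "(\<lambda>w. \<lambda>t\<in>{0..}. p (w t)) \<in> space (path_space T') \<rightarrow> cadlag T"
    using cadlag_map[OF p] by (auto simp: space_path_space)
  show "(\<lambda>w. \<lambda>t\<in>{0..}. p (w t)) \<in> path_space T' \<rightarrow>\<^sub>M (\<Pi>\<^sub>M t\<in>{0..}. borel_of T)"
    by (intro measurable_restrict measurable_compose[OF eval_path_measurable continuous_map_measurable[OF p]]) auto
qed

context feller_map
begin

lemma pb_B_b: "f \<in> B_b T \<Longrightarrow> pb f \<in> B_b T'"
  by (rule pullback_B_b[OF continuous_map_measurable[OF cont]])

text \<open>Both sides are integrals against one-time laws, which \<open>C_0\<close> determines. The
  extension is needed because indicators of Borel sets appear in cylinder sets.\<close>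

lemma semigroup_pullback_B_b:
  assumes sg: "\<And>f. f \<in> C_0 T \<Longrightarrow> Y.S t (pb f) x = X.S t f (p x)"
    and f: "f \<in> B_b T" and t: "t \<ge> 0" and x: "x \<in> topspace T'"
  shows "Y.S t (pb f) x = X.S t f (p x)"
proof -
  note px = p_in[OF x]
  have mY: "(\<lambda>w. p (w t)) \<in> Q x \<rightarrow>\<^sub>M borel_of T"
    by (rule measurable_compose[OF Y.eval_measurable[OF x t] continuous_map_measurable[OF cont]])
  have mX: "(\<lambda>w. w t) \<in> P (p x) \<rightarrow>\<^sub>M borel_of T" by (rule X.eval_measurable[OF px t])
  have Yi: "Y.S t (pb f) x = (\<integral>y. f y \<partial>distr (Q x) (borel_of T) (\<lambda>w. p (w t)))"
    if f: "f \<in> B_b T" for f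
  proof -
    have "f \<in> borel_measurable (borel_of T)" using f by (simp add: B_b_def)
    then have "(\<integral>y. f y \<partial>distr (Q x) (borel_of T) (\<lambda>w. p (w t))) = (\<integral>w. f (p (w t)) \<partial>Q x)"
      by (rule integral_distr[OF mY])
    also have "\<dots> = (\<integral>w. pb f (w t) \<partial>Q x)"
      by (intro Bochner_Integration.integral_cong)
         (use Y.P_space[OF x] Y.eval_in t in \<open>auto simp: pullback_def\<close>)
    finally show ?thesis by (simp add: Y.S_eq[OF x])
  qed
  have Xi: "X.S t f (p x) = (\<integral>y. f y \<partial>distr (P (p x)) (borel_of T) (\<lambda>w. w t))"
    if f: "f \<in> B_b T" for f
  proof -
    have "f \<in> borel_measurable (borel_of T)" using f by (simp add: B_b_def)
    then show ?thesis unfolding X.S_eq[OF px] by (rule integral_distr[OF mX, symmetric])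
  qed
  have "distr (Q x) (borel_of T) (\<lambda>w. p (w t)) = distr (P (p x)) (borel_of T) (\<lambda>w. w t)"
  proof (rule measure_eqI_C_0[OF X.metrizable X.loc_compact X.sig_compact])
    show "prob_space (distr (Q x) (borel_of T) (\<lambda>w. p (w t)))"
      by (rule prob_space.prob_space_distr[OF Y.P_prob[OF x] mY])
    show "prob_space (distr (P (p x)) (borel_of T) (\<lambda>w. w t))"
      by (rule prob_space.prob_space_distr[OF X.P_prob[OF px] mX])
    fix f assume f: "f \<in> C_0 T"
    show "(\<integral>y. f y \<partial>distr (Q x) (borel_of T) (\<lambda>w. p (w t))) = (\<integral>y. f y \<partial>distr (P (p x)) (borel_of T) (\<lambda>w. w t))"
      using sg[OF f] Yi[OF X.C_0_B_b[OF f]] Xi[OF X.C_0_B_b[OF f]] by simp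
  qed auto
  then show ?thesis using Yi[OF f] Xi[OF f] by simp
qed

text \<open>Intertwined semigroups give equal finite-dimensional distributions by induction over the
  latest time. Since it is only \<open>p\<close> of the path that is tested, the product process is
  compared through pulled back factors throughout.\<close>

lemma law_pullback:
  assumes sg: "\<And>f t x. f \<in> C_0 T \<Longrightarrow> t \<ge> 0 \<Longrightarrow> x \<in> topspace T' \<Longrightarrow> Y.S t (pb f) x = X.S t f (p x)"
    and x: "x \<in> topspace T'"
  shows "distr (Q x) (path_space T) (\<lambda>w. \<lambda>t\<in>{0..}. p (w t)) = P (p x)"
proof (rule path_measure_eqI)
  note px = p_in[OF x]
  have sgB: "Y.S t (pb f) x = X.S t f (p x)" if "f \<in> B_b T" "t \<ge> 0" "x \<in> topspace T'" for f t x
    using semigroup_pullback_B_b[OF sg[OF _ that(2,3)] that] .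
  have m: "(\<lambda>w. \<lambda>t\<in>{0..}. p (w t)) \<in> Q x \<rightarrow>\<^sub>M path_space T"
    using path_map_measurable[OF cont] Y.P_sets[OF x] by (simp cong: measurable_cong_sets)
  show "prob_space (distr (Q x) (path_space T) (\<lambda>w. \<lambda>t\<in>{0..}. p (w t)))"
    by (rule prob_space.prob_space_distr[OF Y.P_prob[OF x] m])
  show "prob_space (P (p x))" "sets (P (p x)) = sets (path_space T)"
    using X.P_prob[OF px] X.P_sets[OF px] by auto
  have fdd: "(\<integral>w. (\<Prod>t\<in>J. pb (f t) (w t)) \<partial>Q x) = (\<integral>w. (\<Prod>t\<in>J. f t (w t)) \<partial>P (p x))"
    if "finite J" "J \<subseteq> {0..}" "\<And>t. f t \<in> B_b T" for J f
    using that
  proof (induction J arbitrary: f rule: finite_linorder_max_induct)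
    case empty
    then show ?case using prob_space.prob_space[OF Y.P_prob[OF x]] prob_space.prob_space[OF X.P_prob[OF px]] by simp
  next
    case (insert b J)
    have b: "b \<ge> 0" "J \<subseteq> {0..}" using insert.prems by auto
    show ?case
    \<comment> \<open>\<open>Max {}\<close> is unspecified, so the case of a single time is settled
      by the semigroups directly.\<close>
    proof (cases "J = {}")
      case True
      then show ?thesis using sgB[OF insert.prems(2) b(1) x] b by (simp add: Y.S_eq[OF x] X.S_eq[OF px])
    next
      case False
      define s where "s = Max J"
      have s: "s \<in> J" "s \<ge> 0" "s < b"
        using Max_in[OF insert.hyps(1) False] subsetD[OF b(2), of s] insert.hyps by (simp_all add: s_def)
      \<comment> \<open>The merged factors correspond on both sides: pullback commutes with products
        and, by \<open>sgB\<close>, with the semigroups.\<close>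
      define f' where "f' = f(s := \<lambda>y. f s y * X.S (b - s) (f b) y)"
      have f': "f' t \<in> B_b T" for t
        using insert.prems(2) B_b_mult[OF insert.prems(2)[of s] X.S_B_b[OF insert.prems(2)[of b], of "b - s"]] s
        by (simp add: f'_def)
      have "(\<lambda>t. pb (f t))(s := \<lambda>y. pb (f s) y * Y.S (b - s) (pb (f b)) y) = (\<lambda>t. pb (f' t))"
      proof (intro ext)
        fix t y
        show "((\<lambda>t. pb (f t))(s := \<lambda>y. pb (f s) y * Y.S (b - s) (pb (f b)) y)) t y = pb (f' t) y"
          using sgB[OF insert.prems(2), of "b - s" y b] s
          by (cases "y \<in> topspace T'") (auto simp: f'_def pullback_def)
      qed
      then have "(\<integral>w. (\<Prod>t\<in>insert b J. pb (f t) (w t)) \<partial>Q x) = (\<integral>w. (\<Prod>t\<in>J. pb (f' t) (w t)) \<partial>Q x)"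
        using Y.markov_product[OF x insert.hyps(1) False b(2), of b "\<lambda>t. pb (f t)"] s pb_B_b[OF insert.prems(2)]
        by (simp add: s_def)
      also have "\<dots> = (\<integral>w. (\<Prod>t\<in>J. f' t (w t)) \<partial>P (p x))"
        by (rule insert.IH[OF b(2) f'])
      also have "\<dots> = (\<integral>w. (\<Prod>t\<in>insert b J. f t (w t)) \<partial>P (p x))"
        using X.markov_product[OF px insert.hyps(1) False b(2), of b f] s insert.prems(2)
        by (simp add: s_def f'_def)
      finally show ?thesis .
    qed
  qed
  fix J :: "real set" and f :: "real \<Rightarrow> 'a \<Rightarrow> real" assume J: "finite J" "J \<subseteq> {0..}" and f: "\<And>t. f t \<in> B_b T"
  have fm: "(\<lambda>w. f t (w t)) \<in> borel_measurable (path_space T)" if "t \<in> J" for t :: real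
  proof (rule measurable_compose[OF eval_path_measurable])
    show "f t \<in> borel_measurable (borel_of T)" using f[of t] by (simp add: B_b_def)
  qed (use J(2) that in auto)
  have "(\<integral>w. (\<Prod>t\<in>J. f t (w t)) \<partial>distr (Q x) (path_space T) (\<lambda>w. \<lambda>t\<in>{0..}. p (w t)))
      = (\<integral>w. (\<Prod>t\<in>J. f t ((\<lambda>t\<in>{0..}. p (w t)) t)) \<partial>Q x)"
    by (rule integral_distr[OF m]) (use fm in \<open>auto intro: borel_measurable_prod\<close>)
  also have "\<dots> = (\<integral>w. (\<Prod>t\<in>J. pb (f t) (w t)) \<partial>Q x)"
    by (intro Bochner_Integration.integral_cong prod.cong)
       (use Y.P_space[OF x] Y.eval_in J(2) in \<open>auto simp: pullback_def\<close>)
  also have "\<dots> = (\<integral>w. (\<Prod>t\<in>J. f t (w t)) \<partial>P (p x))" by (rule fdd[OF J f])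
  finally show "(\<integral>w. (\<Prod>t\<in>J. f t (w t)) \<partial>distr (Q x) (path_space T) (\<lambda>w. \<lambda>t\<in>{0..}. p (w t)))
      = (\<integral>w. (\<Prod>t\<in>J. f t (w t)) \<partial>P (p x))" .
qed simp

end

section \<open>Tensor products and couplings\<close>

lemma coord_fun_eq_pullback: "coord_fun E i = pullback (prod_space E) (\<lambda>x. x i)"
  by (intro ext) (simp add: coord_fun_def pullback_def)

text \<open>Pulling back does not increase supremum norms, so graph approximation by test functions
  on a factor becomes graph approximation on the product.\<close>

lemma op_closure_pullback:
  assumes fg: "(f, g) \<in> op_closure T D L"
    and p: "\<And>x. x \<in> topspace T' \<Longrightarrow> p x \<in> topspace T"
    and D: "\<And>h. h \<in> D \<Longrightarrow> pullback T' p h \<in> D' \<and> (\<forall>x\<in>topspace T'. L' (pullback T' p h) x = L h (p x))"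
  shows "(pullback T' p f, pullback T' p g) \<in> op_closure T' D' L'"
proof -
  have "\<exists>h\<in>D'. \<forall>x\<in>topspace T'. \<bar>h x - pullback T' p f x\<bar> < e \<and> \<bar>L' h x - pullback T' p g x\<bar> < e"
    if e: "e > 0" for e
  proof -
    obtain h where h: "h \<in> D" "\<And>x. x \<in> topspace T \<Longrightarrow> \<bar>h x - f x\<bar> < e \<and> \<bar>L h x - g x\<bar> < e"
      using fg e by (auto simp: op_closure_def)
    show ?thesis
      using D[OF h(1)] h(2) p by (intro bexI[of _ "pullback T' p h"]) (auto simp: pullback_def)
  qed
  then show ?thesis by (simp add: op_closure_def vanishes_off_def pullback_def)
qed

text \<open>Written as an elementary tensor, a function of one coordinate has constants as its
  remaining factors; the extended domain has to contain them, and the generator kills them.\<close>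

lemma (in markov_semigroup) gen_dom_const:
  shows "(\<lambda>x. if x \<in> topspace T then c else 0) \<in> gen_dom T P"
    and "gen T P (\<lambda>x. if x \<in> topspace T then c else 0) x = 0"
proof -
  let ?c = "\<lambda>x. if x \<in> topspace T then c else 0"
  have "continuous_map T euclideanreal ?c"
    by (rule continuous_map_eq[of _ _ "\<lambda>_. c"]) auto
  then have C: "?c \<in> C_b T"
    by (auto simp: C_b_def vanishes_off_def bounded_range_real_iff intro!: exI[of _ "\<bar>c\<bar>"])
  have S: "S t ?c x = ?c x" if "t \<ge> 0" for t x
    using S_cong[OF _ that, of ?c "\<lambda>_. c" x] S_const[of x t c] by (cases "x \<in> topspace T") (auto simp: S_off)
  have lim: "\<exists>\<delta>>0. \<forall>t x. 0 < t \<longrightarrow> t < \<delta> \<longrightarrow> x \<in> K \<longrightarrow> \<bar>diff_quotient T P ?c t x - 0\<bar> < e"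
    if "compactin T K" "e > 0" for K and e :: real
    using that(2) by (intro exI[of _ 1]) (simp add: diff_quotient_def S)
  show "?c \<in> gen_dom T P" by (rule gen_domI(1)[OF C lim])
  show "gen T P ?c x = 0"
    using gen_domI(2)[OF C lim, of x] gen_off[of ?c x] by (cases "x \<in> topspace T") (auto simp: vanishes_off_def)
qed

lemma (in markov_semigroup) gen_dom_sum:
  fixes m :: nat
  assumes "\<And>k. k < m \<Longrightarrow> u k \<in> gen_dom T P"
  shows "(\<lambda>x. \<Sum>k<m. c k * u k x) \<in> gen_dom T P"
  using assms
proof (induction m)
  case 0
  then show ?case using gen_dom_const(1)[of 0] by simp
next
  case (Suc m)
  have "(\<lambda>x. 1 * (\<Sum>k<m. c k * u k x) + c m * u m x) \<in> gen_dom T P"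
    by (rule gen_dom_linear(1)) (use Suc in auto)
  then show ?case by simp
qed

lemma alg_tensor_linear:
  fixes E :: "'i::finite \<Rightarrow> 'a topology"
  assumes ms: "\<And>i. markov_semigroup (E i) (P i)" and fg: "f \<in> alg_tensor E P" "g \<in> alg_tensor E P"
  shows "(\<lambda>x. a * f x + b * g x) \<in> alg_tensor E P"
proof -
  obtain m :: nat and u where f: "f = (\<lambda>x. \<Sum>k<m. \<Prod>i\<in>UNIV. u k i (x i))"
    "\<And>k i. k < m \<Longrightarrow> u k i \<in> gen_dom (E i) (P i)"
    using fg(1) unfolding alg_tensor_def by blast
  obtain n :: nat and v where g: "g = (\<lambda>x. \<Sum>k<n. \<Prod>i\<in>UNIV. v k i (x i))"
    "\<And>k i. k < n \<Longrightarrow> v k i \<in> gen_dom (E i) (P i)"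
    using fg(2) unfolding alg_tensor_def by blast
  \<comment> \<open>A scalar is absorbed into one factor of each elementary tensor;
    \<open>i0\<close> is an arbitrary index chosen for that. The two sums are then
    concatenated.\<close>
  obtain i0 :: 'i where True by simp
  define w where "w k i = (if k < m then (if i = i0 then (\<lambda>y. a * u k i y) else u k i)
    else (if i = i0 then (\<lambda>y. b * v (k - m) i y) else v (k - m) i))" for k i
  have scale: "(\<lambda>y. c * h y) \<in> gen_dom (E i) (P i)" if "h \<in> gen_dom (E i) (P i)" for c h i
    using markov_semigroup.gen_dom_linear(1)[OF ms that that, of c 0] by simp
  have w: "w k i \<in> gen_dom (E i) (P i)" if "k < m + n" for k i
    using f(2)[of k i] g(2)[of "k - m" i] scale that by (auto simp: w_def)
  have sc: "(\<Prod>i\<in>UNIV. (if i = i0 then (\<lambda>y. c * h i y) else h i) (x i)) = c * (\<Prod>i\<in>UNIV. h i (x i))"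
    for c :: real and h :: "'i \<Rightarrow> 'a \<Rightarrow> real" and x
    by (simp add: prod.remove[of UNIV i0] mult.assoc)
  have "a * f x + b * g x = (\<Sum>k<m + n. \<Prod>i\<in>UNIV. w k i (x i))" for x
  proof -
    have "(\<Sum>k<m + n. \<Prod>i\<in>UNIV. w k i (x i))
        = (\<Sum>k<m. \<Prod>i\<in>UNIV. w k i (x i)) + (\<Sum>k<n. \<Prod>i\<in>UNIV. w (k + m) i (x i))"
    proof -
      have "(\<Sum>k<m + n. F k) = (\<Sum>k<m. F k) + (\<Sum>k<n. F (k + m))" for F :: "nat \<Rightarrow> real"
        by (induction n) (auto simp: add.commute add.left_commute)
      then show ?thesis .
    qed
    also have "(\<Sum>k<m. \<Prod>i\<in>UNIV. w k i (x i)) = a * f x"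
      unfolding f(1) sum_distrib_left by (intro sum.cong refl) (simp add: w_def sc)
    also have "(\<Sum>k<n. \<Prod>i\<in>UNIV. w (k + m) i (x i)) = b * g x"
      unfolding g(1) sum_distrib_left by (intro sum.cong refl) (simp add: w_def sc)
    finally show ?thesis ..
  qed
  then show ?thesis unfolding alg_tensor_def using w by blast
qed

text \<open>With the other coordinates frozen, their factors become scalar coefficients; this works
  at every x, even off the product space.\<close>

lemma alg_tensor_section:
  fixes E :: "'i::finite \<Rightarrow> 'a topology"
  assumes ms: "\<And>i. markov_semigroup (E i) (P i)" and f: "f \<in> alg_tensor E P"
  shows "(\<lambda>y. f (x(i := y))) \<in> gen_dom (E i) (P i)"
proof -
  obtain m :: nat and u where f: "f = (\<lambda>x. \<Sum>k<m. \<Prod>i\<in>UNIV. u k i (x i))"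
    "\<And>k i. k < m \<Longrightarrow> u k i \<in> gen_dom (E i) (P i)"
    using f unfolding alg_tensor_def by blast
  have "(\<lambda>y. f (x(i := y))) = (\<lambda>y. \<Sum>k<m. (\<Prod>j\<in>UNIV - {i}. u k j (x j)) * u k i y)"
    unfolding f(1) by (simp add: prod.remove[of UNIV i] mult.commute)
  then show ?thesis using markov_semigroup.gen_dom_sum[OF ms f(2)] by simp
qed

lemma partial_gen_linear:
  assumes "markov_semigroup (E i) (P i)"
    and "(\<lambda>y. f (x(i := y))) \<in> gen_dom (E i) (P i)" "(\<lambda>y. g (x(i := y))) \<in> gen_dom (E i) (P i)"
  shows "partial_gen E P i (\<lambda>x. a * f x + b * g x) x = a * partial_gen E P i f x + b * partial_gen E P i g x"
  unfolding partial_gen_def by (rule markov_semigroup.gen_dom_linear(2)[OF assms])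

lemma tensor_dom_linear:
  assumes ms: "\<And>i. markov_semigroup (E i) (P i)" and f: "f \<in> tensor_dom E P" and g: "g \<in> tensor_dom E P"
  shows "(\<lambda>x. a * f x + b * g x) \<in> tensor_dom E P"
proof -
  have s: "(\<lambda>y. f (x(i := y))) \<in> gen_dom (E i) (P i)" "(\<lambda>y. g (x(i := y))) \<in> gen_dom (E i) (P i)"
    if "x \<in> topspace (prod_space E)" for x i
    using f g that by (auto simp: tensor_dom_def)
  have "\<exists>h\<in>alg_tensor E P. \<forall>x\<in>topspace (prod_space E). \<bar>h x - (a * f x + b * g x)\<bar> < e \<and>
      (\<forall>i. \<bar>partial_gen E P i h x - partial_gen E P i (\<lambda>x. a * f x + b * g x) x\<bar> < e)" if e: "e > 0" for e
  proof -
    define r where "r = e / (\<bar>a\<bar> + \<bar>b\<bar> + 1)"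
    have r: "r > 0" using e by (simp add: r_def add_nonneg_pos)
    obtain h where h: "h \<in> alg_tensor E P" "\<And>x. x \<in> topspace (prod_space E) \<Longrightarrow>
        \<bar>h x - f x\<bar> < r \<and> (\<forall>i. \<bar>partial_gen E P i h x - partial_gen E P i f x\<bar> < r)"
      using f r unfolding tensor_dom_def by blast
    obtain k where k: "k \<in> alg_tensor E P" "\<And>x. x \<in> topspace (prod_space E) \<Longrightarrow>
        \<bar>k x - g x\<bar> < r \<and> (\<forall>i. \<bar>partial_gen E P i k x - partial_gen E P i g x\<bar> < r)"
      using g r unfolding tensor_dom_def by blast
    have lin: "\<bar>(a * y + b * z) - (a * y' + b * z')\<bar> < e" if "\<bar>y - y'\<bar> < r" "\<bar>z - z'\<bar> < r" for y z y' z'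
    proof -
      have "(a * y + b * z) - (a * y' + b * z') = a * (y - y') + b * (z - z')" by (simp add: algebra_simps)
      also have "\<bar>\<dots>\<bar> < e" by (rule abs_lincomb_less[OF that[unfolded r_def]])
      finally show ?thesis .
    qed
    show ?thesis
    proof (intro bexI[of _ "\<lambda>x. a * h x + b * k x"] ballI conjI allI)
      fix x i assume x: "x \<in> topspace (prod_space E)"
      show "\<bar>(a * h x + b * k x) - (a * f x + b * g x)\<bar> < e" using h(2)[OF x] k(2)[OF x] lin by blast
      show "\<bar>partial_gen E P i (\<lambda>x. a * h x + b * k x) x - partial_gen E P i (\<lambda>x. a * f x + b * g x) x\<bar> < e"
        unfolding partial_gen_linear[where E=E and P=P and i=i and f=f and g=g, OF ms s[OF x]]
          partial_gen_linear[where E=E and P=P and i=i and f=h and g=k,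
            OF ms alg_tensor_section[OF ms h(1)] alg_tensor_section[OF ms k(1)]]
        using h(2)[OF x] k(2)[OF x] lin by blast
    qed (rule alg_tensor_linear[OF ms h(1) k(1)])
  qed
  moreover have "(\<lambda>x. a * f x + b * g x) \<in> C_b (prod_space E)"
    using f g C_b_linear by (auto simp: tensor_dom_def)
  moreover have "(\<lambda>y. a * f (x(i := y)) + b * g (x(i := y))) \<in> gen_dom (E i) (P i)"
    if "x \<in> topspace (prod_space E)" for x i
    by (rule markov_semigroup.gen_dom_linear(1)[OF ms s[OF that]])
  ultimately show ?thesis by (auto simp: tensor_dom_def)
qed

text \<open>If some other coordinate leaves its space, the section through x is identically 0 on
  \<open>E i\<close>; if the i-th does, the semigroup is 0 by convention. This is needed for the
  coupling operator to take values in \<open>B_b\<close>, whose members vanish off the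
  space.\<close>

lemma partial_gen_off:
  assumes ms: "markov_semigroup (E i) (P i)" and f: "vanishes_off (prod_space E) f"
    and x: "x \<notin> topspace (prod_space E)"
  shows "partial_gen E P i f x = 0"
proof -
  interpret markov_semigroup "E i" "P i" by fact
  have "S t (\<lambda>y. f (x(i := y))) (x i) = 0" if "t \<ge> 0" for t
  proof (cases "x i \<in> topspace (E i)")
    case True
    obtain j where "x j \<notin> topspace (E j)" using x by (auto simp: PiE_iff)
    moreover from this True have "j \<noteq> i" by blast
    ultimately have "x(i := y) \<notin> topspace (prod_space E)" for y by (auto simp: PiE_iff intro!: exI[of _ j])
    then have "f (x(i := y)) = 0" for y using f by (simp add: vanishes_off_def)
    then show ?thesis by (simp add: semigroup_of_def)
  qed (simp add: S_off)
  moreover have "f (x(i := x i)) = 0" using f x by (simp add: vanishes_off_def)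
  ultimately have "\<forall>\<^sub>F t in at_right 0. diff_quotient (E i) (P i) (\<lambda>y. f (x(i := y))) t (x i) = 0"
    unfolding eventually_at_right_field diff_quotient_def by (intro exI[of _ 1]) auto
  then have "((\<lambda>t. diff_quotient (E i) (P i) (\<lambda>y. f (x(i := y))) t (x i)) \<longlongrightarrow> 0) (at_right 0)"
    by (rule tendsto_eventually)
  then show ?thesis unfolding partial_gen_def by (rule gen_unique)
qed

text \<open>A function of the i-th coordinate is one elementary tensor, with the indicators of the
  spaces as its other factors. Sections in those directions are constant, so only the i-th generator
  survives in the sum.\<close>

lemma
  fixes E :: "'i::finite \<Rightarrow> 'a topology"
  assumes ms: "\<And>i. markov_semigroup (E i) (P i)" and f: "f \<in> gen_dom (E i) (P i)"
  shows coord_fun_tensor_dom: "coord_fun E i f \<in> tensor_dom E P"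
    and sum_gen_coord_fun: "x \<in> topspace (prod_space E) \<Longrightarrow> sum_gen E P (coord_fun E i f) x = gen (E i) (P i) f (x i)"
proof -
  have off: "f y = 0" if "y \<notin> topspace (E i)" for y
    using markov_semigroup.gen_dom_C_b[OF ms f] that by (simp add: C_b_def vanishes_off_def)
  have sec_i: "(\<lambda>y. coord_fun E i f (x(i := y))) = f" if x: "x \<in> topspace (prod_space E)" for x
    using x off by (auto simp: coord_fun_def PiE_iff fun_eq_iff)
  have sec_j: "(\<lambda>y. coord_fun E i f (x(j := y))) = (\<lambda>y. if y \<in> topspace (E j) then f (x i) else 0)"
    if x: "x \<in> topspace (prod_space E)" "j \<noteq> i" for x j
    using x by (auto simp: coord_fun_def PiE_iff fun_eq_iff)
  have sec: "(\<lambda>y. coord_fun E i f (x(j := y))) \<in> gen_dom (E j) (P j)" if "x \<in> topspace (prod_space E)" for x j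
    using sec_i[OF that] sec_j[OF that] f markov_semigroup.gen_dom_const(1)[OF ms] by (cases "j = i") simp_all
  have pg: "partial_gen E P j (coord_fun E i f) x = (if j = i then gen (E i) (P i) f (x i) else 0)"
    if "x \<in> topspace (prod_space E)" for x j
    using sec_i[OF that] sec_j[OF that] markov_semigroup.gen_dom_const(2)[OF ms]
    by (cases "j = i") (simp_all add: partial_gen_def)
  show "sum_gen E P (coord_fun E i f) x = gen (E i) (P i) f (x i)" if "x \<in> topspace (prod_space E)"
    unfolding sum_gen_def pg[OF that] by simp
  define u where "u j = (if j = i then f else (\<lambda>y. if y \<in> topspace (E j) then 1 else 0))" for j
  have u: "u j \<in> gen_dom (E j) (P j)" for j
    using f markov_semigroup.gen_dom_const(1)[OF ms] by (simp add: u_def)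
  have "coord_fun E i f x = (\<Sum>k<1::nat. \<Prod>j\<in>UNIV. u j (x j))" for x
  proof (cases "x \<in> topspace (prod_space E)")
    case True
    then have "(\<Prod>j\<in>UNIV - {i}. u j (x j)) = 1" by (intro prod.neutral) (auto simp: u_def PiE_iff)
    then have "(\<Prod>j\<in>UNIV. u j (x j)) = f (x i)" unfolding prod.remove[of UNIV i, simplified] by (simp add: u_def)
    then show ?thesis using True by (simp add: coord_fun_def)
  next
    case False
    then obtain j where "x j \<notin> topspace (E j)" by (auto simp: PiE_iff)
    then have "u j (x j) = 0" using off by (auto simp: u_def)
    then have "(\<Prod>j\<in>UNIV. u j (x j)) = 0" by (intro prod_zero) auto
    then show ?thesis using False by (simp add: coord_fun_def)
  qed
  then have alg: "coord_fun E i f \<in> alg_tensor E P"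
    unfolding alg_tensor_def using u
    by (intro CollectI exI[of _ "1::nat"] exI[of _ "\<lambda>_. u"]) auto
  have "coord_fun E i f \<in> C_b (prod_space E)"
    unfolding coord_fun_eq_pullback
  proof (rule pullback_C_b)
    show "continuous_map (prod_space E) (E i) (\<lambda>x. x i)"
      by (rule continuous_map_product_projection) simp
  qed (rule markov_semigroup.gen_dom_C_b[OF ms f])
  then show "coord_fun E i f \<in> tensor_dom E P"
    unfolding tensor_dom_def using sec
    by (intro CollectI conjI ballI allI impI bexI[OF _ alg]) auto
qed

lemma state_space_product:
  fixes E :: "'i::finite \<Rightarrow> 'a topology"
  assumes "\<And>i. state_space (E i) (A i)"
  shows "metrizable_space (prod_space E)" "locally_compact_space (prod_space E)" "sigma_compact (prod_space E)"
proof -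
  have E: "metrizable_space (E i)" "locally_compact_space (E i)" "second_countable (E i)" for i
    using assms[of i] by (auto simp: state_space_def completely_metrizable_imp_metrizable_space)
  show "metrizable_space (prod_space E)"
    unfolding metrizable_space_product_topology using E(1) by (simp add: countable_finite)
  show "locally_compact_space (prod_space E)"
    unfolding locally_compact_space_product_topology using E(2) by simp
  show "sigma_compact (prod_space E)"
    by (intro sigma_compact_product sigma_compact_second_countable E)
qed

lemma feller_semigroupI:
  assumes "metrizable_space T" "locally_compact_space T" "sigma_compact T" "feller_process T A P"
  shows "feller_semigroup T P"
  using assms by (intro feller_semigroup.intro markov_semigroup.intro feller_semigroup_axioms.intro)
    (auto simp: feller_process_def)

lemma coord_path_eq: "coord_path i = (\<lambda>w. \<lambda>t\<in>{0..}. w t i)"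
  by (simp add: coord_path_def fun_eq_iff)

text \<open>Once the semigroups are intertwined on \<open>C_b\<close>, the difference quotients
  correspond exactly, and continuous images of compact sets are compact; so locally uniform limits
  carry over.\<close>

lemma (in feller_map) gen_pullback:
  assumes sg: "\<And>f t x. f \<in> C_b T \<Longrightarrow> t \<ge> 0 \<Longrightarrow> x \<in> topspace T' \<Longrightarrow> Y.S t (pb f) x = X.S t f (p x)"
    and f: "f \<in> gen_dom T P"
  shows "pb f \<in> gen_dom T' Q" and "x \<in> topspace T' \<Longrightarrow> gen T' Q (pb f) x = gen T P f (p x)"
proof -
  have fC: "f \<in> C_b T" by (rule X.gen_dom_C_b[OF f])
  have lim: "\<exists>\<delta>>0. \<forall>t x. 0 < t \<longrightarrow> t < \<delta> \<longrightarrow> x \<in> K \<longrightarrow> \<bar>diff_quotient T' Q (pb f) t x - gen T P f (p x)\<bar> < e"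
    if K: "compactin T' K" and e: "e > 0" for K e
  proof -
    obtain \<delta> where d: "\<delta> > 0"
      "\<And>t y. 0 < t \<Longrightarrow> t < \<delta> \<Longrightarrow> y \<in> p ` K \<Longrightarrow> \<bar>diff_quotient T P f t y - gen T P f y\<bar> < e"
      using X.gen_domD[OF f image_compactin[OF K cont] e] by blast
    have "diff_quotient T' Q (pb f) t x = diff_quotient T P f t (p x)" if "0 < t" "x \<in> K" for t x
    proof -
      have "x \<in> topspace T'" using that compactin_subset_topspace[OF K] by auto
      then show ?thesis using sg[OF fC, of t x] that by (simp add: diff_quotient_def pullback_def)
    qed
    then show ?thesis using d by (intro exI[of _ \<delta>]) auto
  qed
  note dom = Y.gen_domI[OF pullback_C_b[OF cont fC] lim]
  show "pb f \<in> gen_dom T' Q" by (rule dom(1))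
  show "gen T' Q (pb f) x = gen T P f (p x)" if "x \<in> topspace T'" using dom(2)[OF _ _ that] .
qed

text \<open>\<open>Q\<close> is any Feller process on the product, not yet related to the factors;
  both directions of the theorem start here.\<close>

locale product_process =
  fixes E :: "'i::finite \<Rightarrow> 'a topology" and A :: "'i \<Rightarrow> ('a, 'b::euclidean_space) chart set"
    and P :: "'i \<Rightarrow> 'a \<Rightarrow> (real \<Rightarrow> 'a) measure" and Q :: "('i \<Rightarrow> 'a) \<Rightarrow> (real \<Rightarrow> 'i \<Rightarrow> 'a) measure"
  assumes state: "\<And>i. state_space (E i) (A i)"
    and feller: "\<And>i. feller_process (E i) (A i) (P i)"
    and fellerQ: "feller_process (prod_space E) (product_atlas A) Q"
begin

sublocale Y: feller_semigroup "prod_space E" Q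
  by (rule feller_semigroupI[OF state_space_product[OF state] fellerQ])

lemma fs: "feller_semigroup (E i) (P i)"
  using state[of i] feller[of i]
  by (intro feller_semigroupI sigma_compact_second_countable)
     (auto simp: state_space_def completely_metrizable_imp_metrizable_space)

lemma ms: "markov_semigroup (E i) (P i)"
  using fs by (rule feller_semigroup.axioms)

lemma fm: "feller_map (E i) (P i) (prod_space E) Q (\<lambda>x. x i)"
  by (intro feller_map.intro feller_map_axioms.intro fs Y.feller_semigroup_axioms
      continuous_map_product_projection) simp

lemma C_c_inf_gen_dom: "f \<in> C_c_inf (E i) (A i) \<Longrightarrow> f \<in> gen_dom (E i) (P i)"
  using feller[of i] subsetD[OF markov_semigroup.gen_dom0_subset_gen_dom[OF ms[of i]]]
  by (auto simp: feller_process_def)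

lemmas coord_tensor = coord_fun_tensor_dom[where E=E and P=P, OF ms]
lemmas sum_gen_coord = sum_gen_coord_fun[where E=E and P=P, OF ms]
lemmas tensor_linear = tensor_dom_linear[where E=E and P=P, OF ms]

lemma coupling_of_generated:
  assumes core: "\<And>i. is_core (E i) (P i) (C_c_inf (E i) (A i))"
    and kill: "kills_marginals E A (D, G)" and cg: "generated_by_sum E P (D, G) Q"
  shows "feller_coupling E A P Q"
proof -
  let ?L = "\<lambda>f x. sum_gen E P f x + G f x"
  have "distr (Q x) (path_space (E i)) (coord_path i) = P i (x i)" if x: "x \<in> topspace (prod_space E)" for i x
  proof -
    interpret feller_map "E i" "P i" "prod_space E" Q "\<lambda>x. x i" by (rule fm)
    have test: "pb h \<in> tensor_dom E P \<inter> D \<and> (\<forall>x\<in>topspace (prod_space E). ?L (pb h) x = gen (E i) (P i) h (x i))"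
      if h: "h \<in> C_c_inf (E i) (A i)" for h
      using kill h coord_tensor[OF C_c_inf_gen_dom[OF h]] sum_gen_coord[OF C_c_inf_gen_dom[OF h]]
      by (auto simp: kills_marginals_def coord_fun_eq_pullback[symmetric])
    have "pb f \<in> gen_dom (prod_space E) Q \<and> gen (prod_space E) Q (pb f) = pb (gen (E i) (P i) f)"
      if f: "f \<in> gen_dom0 (E i) (P i)" for f
    proof -
      have "(f, gen (E i) (P i) f) \<in> op_closure (E i) (C_c_inf (E i) (A i)) (gen (E i) (P i))"
        using core[of i] f by (simp add: is_core_def)
      then have "(pb f, pb (gen (E i) (P i) f)) \<in> op_closure (prod_space E) (tensor_dom E P \<inter> D) ?L"
      proof (rule op_closure_pullback)
        show "\<And>x. x \<in> topspace (prod_space E) \<Longrightarrow> x i \<in> topspace (E i)" by (rule p_in)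
      qed (rule test)
      \<comment> \<open>The pulled back function is in general not in \<open>C_0\<close>, so it is
        the inclusion of the closure in the extended generator that identifies its image.\<close>
      then show ?thesis using cg by (auto simp: generated_by_sum_def closure_generates_def)
    qed
    then show ?thesis
      using law_pullback[OF semigroup_pullback x] by (simp add: coord_path_eq)
  qed
  then show ?thesis using fellerQ by (simp add: feller_coupling_def)
qed

text \<open>Equality of path laws, read at a single time, intertwines the semigroups on all of
  \<open>C_b\<close>. Hence the whole extended domain of the factor is transported, and test
  functions are a special case.\<close>

lemma generator_of_coupling:
  assumes coup: "feller_coupling E A P Q" and f: "f \<in> gen_dom (E i) (P i)"
  shows "coord_fun E i f \<in> gen_dom (prod_space E) Q"
    and "x \<in> topspace (prod_space E) \<Longrightarrow> gen (prod_space E) Q (coord_fun E i f) x = gen (E i) (P i) f (x i)"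
proof -
  interpret feller_map "E i" "P i" "prod_space E" Q "\<lambda>x. x i" by (rule fm)
  have sg: "Y.S t (pb f) x = X.S t f (x i)"
    if f: "f \<in> C_b (E i)" and t: "t \<ge> 0" and x: "x \<in> topspace (prod_space E)" for f t x
  proof -
    have law: "distr (Q x) (path_space (E i)) (coord_path i) = P i (x i)"
      using coup x by (simp add: feller_coupling_def)
    have m: "coord_path i \<in> Q x \<rightarrow>\<^sub>M path_space (E i)"
      unfolding coord_path_eq using path_map_measurable[OF cont] Y.P_sets[OF x] by (simp cong: measurable_cong_sets)
    have "f \<in> borel_measurable (borel_of (E i))" using f C_b_subset_B_b by (auto simp: B_b_def)
    then have fm: "(\<lambda>w. f (w t)) \<in> borel_measurable (path_space (E i))"
      by (rule measurable_compose[OF eval_path_measurable[OF t]])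
    have "X.S t f (x i) = (\<integral>w. f (w t) \<partial>distr (Q x) (path_space (E i)) (coord_path i))"
      unfolding law by (rule X.S_eq[OF p_in[OF x]])
    also have "\<dots> = (\<integral>w. f (coord_path i w t) \<partial>Q x)" by (rule integral_distr[OF m fm])
    also have "\<dots> = (\<integral>w. pb f (w t) \<partial>Q x)"
      by (intro Bochner_Integration.integral_cong)
         (use Y.P_space[OF x] Y.eval_in t in \<open>auto simp: pullback_def coord_path_def\<close>)
    finally show ?thesis by (simp add: Y.S_eq[OF x])
  qed
  show "coord_fun E i f \<in> gen_dom (prod_space E) Q"
    "x \<in> topspace (prod_space E) \<Longrightarrow> gen (prod_space E) Q (coord_fun E i f) x = gen (E i) (P i) f (x i)"
    unfolding coord_fun_eq_pullback using gen_pullback[OF sg f] by auto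
qed

text \<open>Adding the sum back to the difference gives the generator itself, so the closure in
  question is that of the generator restricted to \<open>common_dom\<close>.
  \<open>gen_closed\<close> keeps it inside the extended generator, which also makes it
  single-valued; the core property supplies the inclusion from the other side.\<close>

lemma generator_minus_sum:
  assumes coup: "feller_coupling E A P Q"
  defines "D \<equiv> common_dom E P Q"
    and "G \<equiv> \<lambda>f x. gen (prod_space E) Q f x - sum_gen E P f x"
  shows "linear_operator_on_B_b (prod_space E) (D, G)" and "kills_marginals E A (D, G)"
    and "is_core (prod_space E) Q D \<Longrightarrow> generated_by_sum E P (D, G) Q"
proof -
  have D: "f \<in> tensor_dom E P" "f \<in> gen_dom (prod_space E) Q" "G f \<in> B_b (prod_space E)" if "f \<in> D" for f
    using that by (auto simp: D_def common_dom_def G_def)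
  have DI: "f \<in> D" if "f \<in> tensor_dom E P" "f \<in> gen_dom (prod_space E) Q" "G f \<in> B_b (prod_space E)" for f
    using that by (auto simp: D_def common_dom_def G_def)
  have off: "vanishes_off (prod_space E) f" if "f \<in> tensor_dom E P" for f
    using that by (auto simp: tensor_dom_def C_b_def)
  have sum_off: "sum_gen E P f x = 0" if "f \<in> tensor_dom E P" "x \<notin> topspace (prod_space E)" for f x
    unfolding sum_gen_def using partial_gen_off[where E=E and P=P, OF ms off[OF that(1)] that(2)] by simp
  have sum_lin: "sum_gen E P (\<lambda>x. a * f x + b * g x) x = a * sum_gen E P f x + b * sum_gen E P g x"
    if fg: "f \<in> tensor_dom E P" "g \<in> tensor_dom E P" for f g a b x
  proof (cases "x \<in> topspace (prod_space E)")
    case True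
    have "partial_gen E P i (\<lambda>x. a * f x + b * g x) x = a * partial_gen E P i f x + b * partial_gen E P i g x" for i
      by (rule partial_gen_linear[where E=E and P=P, OF ms]) (use fg True in \<open>auto simp: tensor_dom_def\<close>)
    then show ?thesis by (simp add: sum_gen_def sum.distrib sum_distrib_left)
  next
    case False
    then show ?thesis using sum_off tensor_linear[OF fg] fg by simp
  qed
  have G_lin: "G (\<lambda>x. a * f x + b * g x) = (\<lambda>x. a * G f x + b * G g x)" if "f \<in> D" "g \<in> D" for f g a b
    using Y.gen_dom_linear(2)[OF D(2)[OF that(1)] D(2)[OF that(2)]] sum_lin[OF D(1)[OF that(1)] D(1)[OF that(2)]]
    by (simp add: G_def fun_eq_iff algebra_simps)
  have kill: "coord_fun E i f \<in> D \<and> G (coord_fun E i f) = (\<lambda>_. 0)" if dom: "f \<in> gen_dom (E i) (P i)" for i f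
  proof -
    have t: "coord_fun E i f \<in> tensor_dom E P" by (rule coord_tensor[OF dom])
    have "G (coord_fun E i f) x = 0" for x
      using generator_of_coupling(2)[OF coup dom, of x] sum_gen_coord[OF dom, of x]
        Y.gen_off[OF off[OF t], of x] sum_off[OF t, of x]
      by (cases "x \<in> topspace (prod_space E)") (simp_all add: G_def)
    then have G0: "G (coord_fun E i f) = (\<lambda>_. 0)" by blast
    then show ?thesis using DI[OF t generator_of_coupling(1)[OF coup dom]]
      by (simp add: B_b_def vanishes_off_def)
  qed
  then show "kills_marginals E A (D, G)" using C_c_inf_gen_dom by (simp add: kills_marginals_def)
  \<comment> \<open>The zero function is treated as a function of an arbitrarily chosen coordinate,
    so that the argument for marginals covers it.\<close>
  have zero: "(\<lambda>_. 0) \<in> D"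
  proof -
    obtain i :: 'i where True by simp
    have "(\<lambda>_. 0) \<in> gen_dom (E i) (P i)" using markov_semigroup.gen_dom_const(1)[OF ms, of i 0] by simp
    then have "coord_fun E i (\<lambda>_. 0) \<in> D" using kill by blast
    then show ?thesis by (simp add: coord_fun_def[abs_def])
  qed
  show "linear_operator_on_B_b (prod_space E) (D, G)"
    unfolding linear_operator_on_B_b_def prod.case
  proof (intro conjI ballI allI zero)
    show "D \<subseteq> B_b (prod_space E)" using D(2) Y.gen_dom_C_b C_b_subset_B_b by blast
    show "G ` D \<subseteq> B_b (prod_space E)" using D(3) by blast
    fix f g a b assume fg: "f \<in> D" "g \<in> D"
    show "G (\<lambda>x. a * f x + b * g x) = (\<lambda>x. a * G f x + b * G g x)" by (rule G_lin[OF fg])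
    then show "(\<lambda>x. a * f x + b * g x) \<in> D"
      using tensor_linear[OF D(1)[OF fg(1)] D(1)[OF fg(2)]] Y.gen_dom_linear(1)[OF D(2)[OF fg(1)] D(2)[OF fg(2)]]
        B_b_linear[OF D(3)[OF fg(1)] D(3)[OF fg(2)]] by (intro DI) simp_all
  qed
  assume core: "is_core (prod_space E) Q D"
  have [simp]: "tensor_dom E P \<inter> D = D" using D(1) by blast
  have closed: "f \<in> gen_dom (prod_space E) Q \<and> gen (prod_space E) Q f = g"
    if "(f, g) \<in> op_closure (prod_space E) D (gen (prod_space E) Q)" for f g
    using Y.gen_closed[OF _ that] D(2) by blast
  have "single_valued (op_closure (prod_space E) D (gen (prod_space E) Q))"
    using closed by (blast intro: single_valuedI)
  \<comment> \<open>An identity between operators on all functions, not only on \<open>D\<close>,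
    because \<open>G\<close> is defined by subtraction; it therefore rewrites the closure as a
    whole.\<close>
  moreover have "(\<lambda>f x. sum_gen E P f x + G f x) = gen (prod_space E) Q"
    by (simp add: G_def fun_eq_iff)
  ultimately show "generated_by_sum E P (D, G) Q"
    using core closed by (auto simp: generated_by_sum_def closure_generates_def is_core_def)
qed

end

text \<open>In the converse, the core condition is exact. If any member of
  \<open>coupling_operators\<close> generates \<open>Q\<close>, its domain within
  \<open>tensor_dom\<close> lies in \<open>common_dom\<close>, since there the generator minus the
  sum equals that operator and so has values in \<open>B_b\<close>; the closure of this restriction
  contains the generator on \<open>C_0\<close>, which makes \<open>common_dom\<close> a
  core.\<close>

theorem proposition8:
  fixes E :: "'i::finite \<Rightarrow> 'a topology"
    and A :: "'i \<Rightarrow> ('a, 'b::euclidean_space) chart set"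
    and P :: "'i \<Rightarrow> 'a \<Rightarrow> (real \<Rightarrow> 'a) measure"
  assumes "\<And>i. state_space (E i) (A i)"
    and "\<And>i. feller_process (E i) (A i) (P i)"
    and "\<And>i. is_core (E i) (P i) (C_c_inf (E i) (A i))"
  shows "(\<forall>\<Gamma>\<in>coupling_operators E A P. \<forall>Q.
            feller_process (prod_space E) (product_atlas A) Q \<and> generated_by_sum E P \<Gamma> Q \<longrightarrow>
            feller_coupling E A P Q) \<and>
         (\<forall>Q. feller_coupling E A P Q \<longrightarrow>
            (\<exists>\<Gamma>. linear_operator_on_B_b (prod_space E) \<Gamma> \<and> kills_marginals E A \<Gamma> \<and>
               tensor_dom E P \<inter> fst \<Gamma> = common_dom E P Q \<and>
               (\<forall>f\<in>common_dom E P Q. \<forall>x\<in>topspace (prod_space E).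
                  gen (prod_space E) Q f x = sum_gen E P f x + snd \<Gamma> f x) \<and>
               (is_core (prod_space E) Q (common_dom E P Q) \<longrightarrow>
                  \<Gamma> \<in> coupling_operators E A P \<and> generated_by_sum E P \<Gamma> Q)))"
proof (intro conjI ballI allI impI)
  fix \<Gamma> Q assume G: "\<Gamma> \<in> coupling_operators E A P"
    and Q: "feller_process (prod_space E) (product_atlas A) Q \<and> generated_by_sum E P \<Gamma> Q"
  interpret product_process E A P Q using assms Q by unfold_locales auto
  show "feller_coupling E A P Q"
    using coupling_of_generated[OF assms(3), of "fst \<Gamma>" "snd \<Gamma>"] G Q by (simp add: coupling_operators_def)
next
  fix Q assume coup: "feller_coupling E A P Q"
  then have fQ: "feller_process (prod_space E) (product_atlas A) Q" by (simp add: feller_coupling_def)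
  interpret product_process E A P Q using assms fQ by unfold_locales
  let ?D = "common_dom E P Q" and ?G = "\<lambda>f x. gen (prod_space E) Q f x - sum_gen E P f x"
  note G = generator_minus_sum[OF coup]
  show "\<exists>\<Gamma>. linear_operator_on_B_b (prod_space E) \<Gamma> \<and> kills_marginals E A \<Gamma> \<and>
     tensor_dom E P \<inter> fst \<Gamma> = common_dom E P Q \<and>
     (\<forall>f\<in>common_dom E P Q. \<forall>x\<in>topspace (prod_space E).
        gen (prod_space E) Q f x = sum_gen E P f x + snd \<Gamma> f x) \<and>
     (is_core (prod_space E) Q (common_dom E P Q) \<longrightarrow>
        \<Gamma> \<in> coupling_operators E A P \<and> generated_by_sum E P \<Gamma> Q)"
  proof (intro exI[of _ "(?D, ?G)"] conjI impI G(1,2))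
    show "tensor_dom E P \<inter> fst (?D, ?G) = ?D" by (auto simp: common_dom_def)
    show "\<forall>f\<in>?D. \<forall>x\<in>topspace (prod_space E). gen (prod_space E) Q f x = sum_gen E P f x + snd (?D, ?G) f x"
      by simp
    assume core: "is_core (prod_space E) Q ?D"
    show "generated_by_sum E P (?D, ?G) Q" by (rule G(3)[OF core])
    then show "(?D, ?G) \<in> coupling_operators E A P"
      using G(1,2) fQ by (auto simp: coupling_operators_def)
  qed
qed

end
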